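(* Let $n>1$ be an integer, $d\in\{1,2,4,8\}$, $N=dn>2d+2$, and let $G$ and $H_\theta$ ($\theta\in S^{N-1}$) be as defined in the context. Then there exist $G$-invariant infinitely smooth convex bodies $K$ and $L$ in $\mathbb{R}^N$ such that $\mathrm{vol}_{N-d}(K\cap H_\theta)\le \mathrm{vol}_{N-d}(L\cap H_\theta)$ for all $\theta\in S^{N-1}$, but $\mathrm{vol}_N(K)>\mathrm{vol}_N(L)$.
   Context: Fix real $d\times d$ matrices $A_1,\dots,A_{d-1}$ such that for every $\sigma\in S^{d-1}$ the vectors $\sigma, A_1\sigma,\dots,A_{d-1}\sigma$ form an orthonormal basis of $\mathbb{R}^d$ (a complete orthonormal system of linear tangent vector fields on $S^{d-1}$; empty if $d=1$). Put $A_0=I_d$ and let $\mathcal{A}_i=\mathrm{diag}(A_i,\dots,A_i)$ be the $N\times N$ block diagonal matrix with $n$ equal blocks, $i=0,1,\dots,d-1$. Define $$G=\Big\{\sum_{i=0}^{d-1}\lambda_i\mathcal{A}_i:\ (\lambda_0,\dots,\lambda_{d-1})\in S^{d-1}\Big\}\subset O(N)$$ (so $G=\{I_N,-I_N\}$ if $d=1$). For $\theta\in S^{N-1}$, $H_\theta$ is the $(N-d)$-dimensional linear subspace of $\mathbb{R}^N$ orthogonal to $\theta=\mathcal{A}_0\theta,\mathcal{A}_1\theta,\dots,\mathcal{A}_{d-1}\theta$. A body $K$ is $G$-invariant if $gK=K$ for all $g\in G$; since $-I_N\in G$, such bodies are origin-symmetric. A convex body is a compact convex set with nonempty interior. An origin-symmetric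 body $K$ is infinitely smooth if its radial function $\rho_K(\theta)=\sup\{\lambda\ge 0:\lambda\theta\in K\}$ is a $C^\infty$ function on $S^{N-1}$. *)

theory Defs
  imports "HOL-Analysis.Analysis"
begin

definition orthonormal_basis_of :: "'a::euclidean_space set \<Rightarrow> 'a set \<Rightarrow> bool" where
  "orthonormal_basis_of V B \<longleftrightarrow>
     B \<subseteq> V \<and> pairwise orthogonal B \<and> (\<forall>b\<in>B. norm b = 1) \<and> span B = V"

text \<open>The family indexed by \<open>0, \<dots>, d - 1\<close> with the identity in position \<open>0\<close>; the values of
  \<open>A\<close> outside \<open>1, \<dots>, d - 1\<close> are irrelevant.\<close>

definition frame :: "(nat \<Rightarrow> real^'d^'d) \<Rightarrow> nat \<Rightarrow> real^'d^'d" where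
  "frame A i = (if i = 0 then mat 1 else A i)"

definition complete_tangent_system :: "(nat \<Rightarrow> real^'d^'d) \<Rightarrow> bool" where
  "complete_tangent_system A \<longleftrightarrow>
     (\<forall>\<sigma>\<in>sphere 0 1.
        inj_on (\<lambda>i. frame A i *v \<sigma>) {..<CARD('d)} \<and>
        orthonormal_basis_of UNIV ((\<lambda>i. frame A i *v \<sigma>) ` {..<CARD('d)}))"

text \<open>\<open>\<real>\<^sup>N\<close> with \<open>N = d n\<close> is \<open>real^('n \<times> 'd)\<close>: the coordinate \<open>(k, i)\<close> is the \<open>i\<close>-th
  coordinate inside the \<open>k\<close>-th block.\<close>

definition block_diag :: "real^'d^'d \<Rightarrow> real^('n::finite \<times> 'd::finite)^('n \<times> 'd)" where
  "block_diag M = (\<chi> p q. if fst p = fst q then M $ snd p $ snd q else 0)"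

definition G :: "(nat \<Rightarrow> real^'d^'d) \<Rightarrow> (real^('n::finite \<times> 'd::finite)^('n \<times> 'd)) set" where
  "G A = {\<Sum>i<CARD('d). l i *\<^sub>R block_diag (frame A i) | l :: nat \<Rightarrow> real.
            (\<Sum>i<CARD('d). (l i)\<^sup>2) = 1}"

definition H :: "(nat \<Rightarrow> real^'d^'d) \<Rightarrow> real^('n::finite \<times> 'd::finite) \<Rightarrow> (real^('n \<times> 'd)) set" where
  "H A \<theta> = {x. \<forall>i<CARD('d). orthogonal x (block_diag (frame A i) *v \<theta>)}"

definition invariant_under :: "(real^'m^'m) set \<Rightarrow> (real^'m) set \<Rightarrow> bool" where
  "invariant_under \<G> K \<longleftrightarrow> (\<forall>g\<in>\<G>. (\<lambda>x. g *v x) ` K = K)"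

definition convex_body :: "'a::euclidean_space set \<Rightarrow> bool" where
  "convex_body K \<longleftrightarrow> compact K \<and> convex K \<and> interior K \<noteq> {}"

definition radial :: "'a::real_normed_vector set \<Rightarrow> 'a \<Rightarrow> real" where
  "radial K \<theta> = Sup {l. 0 \<le> l \<and> l *\<^sub>R \<theta> \<in> K}"

text \<open>Class \<open>C\<^sup>k\<close> on an open set, by recursion on the directional derivatives.\<close>

primrec C_k_on :: "nat \<Rightarrow> ('a::euclidean_space \<Rightarrow> real) \<Rightarrow> 'a set \<Rightarrow> bool" where
  "C_k_on 0 f U \<longleftrightarrow> continuous_on U f"
| "C_k_on (Suc k) f U \<longleftrightarrow>
     (\<forall>x\<in>U. f differentiable (at x)) \<and>
     (\<forall>v. C_k_on k (\<lambda>x. frechet_derivative f (at x) v) U)"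

text \<open>A function on a subset of Euclidean space, such as the sphere, is \<open>C\<^sup>\<infinity>\<close> if near every
  point it is the restriction of a \<open>C\<^sup>\<infinity>\<close> function on an open set of the ambient space. On an
  embedded submanifold this is smoothness in charts.\<close>

definition C_infinity_on :: "('a::euclidean_space \<Rightarrow> real) \<Rightarrow> 'a set \<Rightarrow> bool" where
  "C_infinity_on f S \<longleftrightarrow>
     (\<forall>x\<in>S. \<exists>U g. open U \<and> x \<in> U \<and> (\<forall>k. C_k_on k g U) \<and> (\<forall>y\<in>S \<inter> U. g y = f y))"

definition infinitely_smooth_body :: "'a::euclidean_space set \<Rightarrow> bool" where
  "infinitely_smooth_body K \<longleftrightarrow> C_infinity_on (radial K) (sphere 0 1)"

text \<open>Lebesgue measure of dimension \<open>dim V\<close> on a linear subspace \<open>V\<close>: the image of the product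
  Lebesgue measure on \<open>B \<rightarrow> \<real>\<close>, for an orthonormal basis \<open>B\<close> of \<open>V\<close>, under
  \<open>c \<mapsto> \<Sum>b\<in>B. c b *\<^sub>R b\<close>. By rotation invariance it does not depend on the choice of \<open>B\<close>.
  For \<open>B = Basis\<close> this is the library's construction of \<^const>\<open>lborel\<close>.\<close>

definition subspace_lborel :: "'a::euclidean_space set \<Rightarrow> 'a measure" where
  "subspace_lborel V =
     (let B = (SOME B. orthonormal_basis_of V B)
      in distr (\<Pi>\<^sub>M b\<in>B. lborel) borel (\<lambda>c. \<Sum>b\<in>B. c b *\<^sub>R b))"

end

theory Submission
  imports Defs "HOL-Real_Asymp.Real_Asymp"
begin

text \<open>Fix one block and, for \<open>x\<close> in \<open>\<real>\<^sup>N\<close>, let \<open>B\<close> be the squared length of that block of \<open>x\<close>, \<open>A\<close> that of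
all the others together, and \<open>R = A + B\<close>. The elements of \<open>G\<close> act on every block by an isometry,
so a body described by \<open>A\<close> and \<open>B\<close> alone is \<open>G\<close>-invariant. Its sections are one-parametric: in
suitable orthonormal coordinates of \<open>H\<^sub>\<theta>\<close>, \<open>B\<close> is \<open>\<tau>\<close> times the sum of the squares of \<open>d\<close> of the
coordinates, where \<open>1 - \<tau>\<close> is the squared length of the block of \<open>\<theta>\<close> (\<open>adapted_basis\<close>). Put
\<open>e = d/2\<close> and \<open>p = (N - d)/2\<close>. The densities \<open>g \<mu> = \<mu> powr (p - e) * (\<mu> R + B) powr -p\<close>, of
degree \<open>-(N - d)\<close>, are powers of the gauges of ellipsoids, so their spherical integrals over the
sections are constant multiples of \<open>(\<mu> + \<tau>) powr -e\<close>.

Let \<open>P\<close> be the fourth power of the gauge of \<open>L\<close>, and let \<open>K\<close> have \<open>P + \<epsilon> P powr (p/2 + 1) * T\<close> instead,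
with \<open>T\<close> homogeneous of degree \<open>-(N - d)\<close>. To first order in \<open>\<epsilon>\<close>, sections shrink if the integral of
\<open>T\<close> over every section is positive, while the volume grows if the integral of
\<open>T * P powr (-e/2)\<close> is negative (\<open>counterexample_bodies\<close>). So \<open>L\<close> and \<open>T\<close> have to separate these
two conditions.

For the cylinder \<open>A \<le> 1\<close> the weight \<open>P powr (-e/2)\<close> is \<open>A powr -e\<close>, and the weighted integral of \<open>g \<mu>\<close>
is a multiple of \<open>(1 + \<mu>) powr -e\<close>: the section value at \<open>\<tau> = 1\<close>. For the
body \<open>A\<^sup>2 + B\<^sup>2 \<le> 1\<close> inside it the constant becomes \<open>J (\<mu> / (1 + \<mu>))\<close> with \<open>J (1/2) < J 0\<close>; but the body
touches the cylinder so closely along \<open>B = 0\<close> that \<open>J 0 - J t\<close> is \<open>o(t)\<close> (\<open>J_flat\<close>). The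
condition \<open>N > 2 d + 2\<close> is what makes the dominating function integrable (\<open>integrable_tail\<close>).
Now take \<open>T = g 1 - c * g m + (\<kappa>/m) * (g m - g (2 m))\<close> with \<open>m\<close> small. The difference quotient is so
steep in \<open>\<tau>\<close> that the section values of \<open>T\<close> are smallest at \<open>\<tau> = 1\<close>, where \<open>c\<close> makes them barely
positive (\<open>section_transform_lower_bound\<close>). The weighted integral is that small number times \<open>J 0\<close>,
minus a fixed multiple of \<open>J 0 - J (1/2)\<close> from \<open>g 1\<close>, plus terms of size \<open>(J 0 - J (2 m)) / m\<close>; so it is
negative (\<open>exists_constants\<close>). Adding \<open>\<eta> R\<^sup>2\<close> to \<open>P\<close> with \<open>\<eta>\<close> small keeps the strict
inequalities and gives positive curvature, which makes \<open>K\<close> convex for small \<open>\<epsilon>\<close>.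

Polar coordinates enter through \<open>polar_nn_integral\<close>, which expresses the volume of a star body by
an integral over the region between two level sets of a freely chosen gauge. It needs a measure
that scales under dilations and nothing else, hence serves the whole space and the subspaces alike.\<close>

section \<open>Lebesgue measure in orthonormal coordinates\<close>

interpretation lborel_PiM: product_sigma_finite "\<lambda>_. lborel :: real measure"
  by standard

lemma lborel_affine_emeasure:
  fixes l t :: real assumes "l > 0" and [measurable]: "A \<in> sets borel"
  shows "emeasure lborel ((\<lambda>c. t + l * c) -` A) = ennreal (1 / l) * emeasure lborel A"
proof -
  have "emeasure lborel A = emeasure (density (distr lborel borel (\<lambda>x. t + l * x)) (\<lambda>_. ennreal (abs l))) A"
    using lborel_real_affine[of l t] assms by simp
  also have "\<dots> = ennreal l * emeasure lborel ((\<lambda>c. t + l * c) -` A)"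
    using assms by (simp add: emeasure_density_const emeasure_distr)
  finally show ?thesis using assms
    by (simp add: mult.assoc[symmetric] ennreal_mult[symmetric])
qed

text \<open>Translation and anisotropic scaling of the coordinates in one statement: the first gives the
uniqueness of the measure on a subspace, the second the volumes of ellipsoids.\<close>

lemma PiM_lborel_affine:
  fixes l t :: "'i \<Rightarrow> real"
  assumes I: "finite I" and l: "\<And>i. i \<in> I \<Longrightarrow> l i > 0"
  shows "distr (\<Pi>\<^sub>M i\<in>I. lborel) (\<Pi>\<^sub>M i\<in>I. lborel) (\<lambda>c. \<lambda>i\<in>I. t i + l i * c i)
       = scale_measure (ennreal (\<Prod>i\<in>I. 1 / l i)) (\<Pi>\<^sub>M i\<in>I. lborel)"
proof -
  let ?P = "\<Pi>\<^sub>M i\<in>I. (lborel :: real measure)"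
  let ?T = "\<lambda>c. \<lambda>i\<in>I. t i + l i * c i"
  have T[measurable]: "?T \<in> measurable ?P ?P" by measurable
  have pos: "(\<Prod>i\<in>I. l i) > 0" using l by (auto intro: prod_pos)
  have "scale_measure (ennreal (\<Prod>i\<in>I. l i)) (distr ?P ?P ?T) = ?P"
  proof (rule lborel_PiM.PiM_eqI[OF I])
    fix A assume A: "\<And>i. i \<in> I \<Longrightarrow> A i \<in> sets (lborel::real measure)"
    have vim: "?T -` Pi\<^sub>E I A \<inter> space ?P = Pi\<^sub>E I (\<lambda>i. (\<lambda>c. t i + l i * c) -` A i)"
      by (auto simp: space_PiM PiE_iff)
    have m: "(\<lambda>c. t i + l i * c) -` A i \<in> sets lborel" if "i \<in> I" for i
      using measurable_sets[of "\<lambda>c. t i + l i * c" lborel borel "A i"] A[OF that] by simp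
    have "emeasure (distr ?P ?P ?T) (Pi\<^sub>E I A) = (\<Prod>i\<in>I. emeasure lborel ((\<lambda>c. t i + l i * c) -` A i))"
      using A m by (subst emeasure_distr) (auto simp: vim lborel_PiM.emeasure_PiM[OF I] intro!: sets_PiM_I_finite I)
    also have "\<dots> = (\<Prod>i\<in>I. ennreal (1 / l i) * emeasure lborel (A i))"
      using A l by (intro prod.cong refl lborel_affine_emeasure) auto
    also have "\<dots> = ennreal (\<Prod>i\<in>I. 1 / l i) * (\<Prod>i\<in>I. emeasure lborel (A i))"
      using l by (simp add: prod.distrib prod_ennreal less_imp_le)
    finally have eq: "emeasure (distr ?P ?P ?T) (Pi\<^sub>E I A)
        = ennreal (\<Prod>i\<in>I. 1 / l i) * (\<Prod>i\<in>I. emeasure lborel (A i))" .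
    have "ennreal (\<Prod>i\<in>I. l i) * ennreal (\<Prod>i\<in>I. 1 / l i) = 1"
      using pos l by (subst ennreal_mult[symmetric]) (auto simp: prod_dividef prod_nonneg less_imp_le)
    then show "emeasure (scale_measure (ennreal (\<Prod>i\<in>I. l i)) (distr ?P ?P ?T)) (Pi\<^sub>E I A)
        = (\<Prod>i\<in>I. emeasure lborel (A i))"
      by (simp add: eq mult.assoc[symmetric])
  qed simp
  then have "scale_measure (ennreal (\<Prod>i\<in>I. 1 / l i)) ?P
     = scale_measure (ennreal (\<Prod>i\<in>I. 1 / l i)) (scale_measure (ennreal (\<Prod>i\<in>I. l i)) (distr ?P ?P ?T))"
    by simp
  also have "\<dots> = scale_measure (ennreal (\<Prod>i\<in>I. 1 / l i) * ennreal (\<Prod>i\<in>I. l i)) (distr ?P ?P ?T)"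
    by (rule measure_eqI) (simp_all add: mult.assoc)
  also have "ennreal (\<Prod>i\<in>I. 1 / l i) * ennreal (\<Prod>i\<in>I. l i) = 1"
    using pos l by (subst ennreal_mult[symmetric]) (auto simp: prod_dividef prod_nonneg less_imp_le)
  finally show ?thesis unfolding scale_measure_1 by (rule sym)
qed

text \<open>The measure that \<open>subspace_lborel\<close> builds from a chosen basis, with the basis as a parameter.\<close>

definition coord_lborel :: "'a::euclidean_space set \<Rightarrow> 'a measure" where
  "coord_lborel B = distr (\<Pi>\<^sub>M b\<in>B. lborel) borel (\<lambda>c. \<Sum>b\<in>B. c b *\<^sub>R b)"

lemma sets_coord_lborel[simp, measurable_cong]: "sets (coord_lborel B) = sets borel"
  and space_coord_lborel[simp]: "space (coord_lborel B) = UNIV"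
  by (auto simp: coord_lborel_def)

lemma orthonormal_basis_ofD:
  fixes B :: "'a::euclidean_space set"
  assumes "orthonormal_basis_of V B"
  shows "finite B" "\<And>b. b \<in> B \<Longrightarrow> b \<bullet> b = 1" "\<And>b b'. b \<in> B \<Longrightarrow> b' \<in> B \<Longrightarrow> b \<noteq> b' \<Longrightarrow> b \<bullet> b' = 0"
    "span B = V" "independent B"
proof -
  have po: "pairwise orthogonal B" and n: "\<forall>b\<in>B. norm b = 1" and sp: "span B = V"
    using assms by (auto simp: orthonormal_basis_of_def)
  have "0 \<notin> B" using n by auto
  then show ind: "independent B" using po pairwise_orthogonal_independent by blast
  then show "finite B" by (rule independent_imp_finite)
  show "\<And>b. b \<in> B \<Longrightarrow> b \<bullet> b = 1" using n by (simp add: norm_eq_1)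
  show "\<And>b b'. b \<in> B \<Longrightarrow> b' \<in> B \<Longrightarrow> b \<noteq> b' \<Longrightarrow> b \<bullet> b' = 0"
    using po by (auto simp: pairwise_def orthogonal_def)
  show "span B = V" by fact
qed

lemma orthonormal_sum_inner:
  fixes B :: "'a::euclidean_space set"
  assumes "orthonormal_basis_of V B" "b \<in> B"
  shows "(\<Sum>b\<in>B. c b *\<^sub>R b) \<bullet> b = c b"
proof -
  note D = orthonormal_basis_ofD[OF assms(1)]
  have "(\<Sum>b'\<in>B. c b' *\<^sub>R b') \<bullet> b = (\<Sum>b'\<in>B. c b' * (b' \<bullet> b))"
    by (simp add: inner_sum_left)
  also have "\<dots> = (\<Sum>b'\<in>B. if b' = b then c b else 0)"
    using D assms(2) by (intro sum.cong) auto
  finally show ?thesis using D(1) assms(2) by simp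
qed

lemma orthonormal_sum_norm:
  fixes B :: "'a::euclidean_space set"
  assumes "orthonormal_basis_of V B"
  shows "(\<Sum>b\<in>B. c b *\<^sub>R b) \<bullet> (\<Sum>b\<in>B. c b *\<^sub>R b) = (\<Sum>b\<in>B. (c b)\<^sup>2)"
  by (subst inner_sum_right)
     (auto simp: orthonormal_sum_inner[OF assms] power2_eq_square intro!: sum.cong)

lemma orthonormal_expansion:
  fixes B :: "'a::euclidean_space set"
  assumes B: "orthonormal_basis_of V B" and v: "v \<in> V"
  shows "(\<Sum>b\<in>B. (v \<bullet> b) *\<^sub>R b) = v"
proof -
  note D = orthonormal_basis_ofD[OF B]
  obtain u where u: "v = (\<Sum>b\<in>B. u b *\<^sub>R b)"
    using v D(1,4) by (auto simp: span_finite)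
  show ?thesis unfolding u by (intro sum.cong refl) (simp add: orthonormal_sum_inner[OF B])
qed

lemma coord_sum_measurable[measurable]:
  "(\<lambda>c. \<Sum>b\<in>B. c b *\<^sub>R b) \<in> measurable (\<Pi>\<^sub>M b\<in>B. lborel) (borel :: 'a::euclidean_space measure)"
  by measurable

lemma coord_sum_preimage:
  "X \<in> sets (borel :: 'a::euclidean_space measure) \<Longrightarrow>
    {c \<in> space (\<Pi>\<^sub>M b\<in>B. lborel). (\<Sum>b\<in>B. c b *\<^sub>R b) \<in> X} \<in> sets (\<Pi>\<^sub>M b\<in>B. lborel)"
  using measurable_sets[OF coord_sum_measurable, of X B]
  by (simp add: vimage_def Int_def conj_commute)

lemma coord_lborel_translate:
  assumes B: "orthonormal_basis_of V B" and v: "v \<in> V"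
  shows "distr (coord_lborel B) borel ((+) v) = coord_lborel B"
proof -
  note D = orthonormal_basis_ofD[OF B]
  let ?P = "\<Pi>\<^sub>M b\<in>B. (lborel :: real measure)"
  let ?T = "\<lambda>c. \<lambda>i\<in>B. v \<bullet> i + 1 * c i"
  let ?S = "\<lambda>c. \<Sum>b\<in>B. c b *\<^sub>R b"
  have T: "?T \<in> measurable ?P ?P" by measurable
  have P: "distr ?P ?P ?T = ?P"
    by (subst PiM_lborel_affine) (auto simp: D)
  have "distr (coord_lborel B) borel ((+) v) = distr ?P borel ((+) v \<circ> ?S)"
    unfolding coord_lborel_def by (subst distr_distr) auto
  also have "(+) v \<circ> ?S = ?S \<circ> ?T"
    using orthonormal_expansion[OF B v] by (auto simp: fun_eq_iff scaleR_add_left sum.distrib)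
  also have "distr ?P borel (?S \<circ> ?T) = distr (distr ?P ?P ?T) borel ?S"
    using T by (subst distr_distr) auto
  finally show ?thesis unfolding P coord_lborel_def .
qed

lemma coord_lborel_emeasure:
  assumes "X \<in> sets borel"
  shows "emeasure (coord_lborel B) X =
    emeasure (\<Pi>\<^sub>M b\<in>B. lborel) {c \<in> space (\<Pi>\<^sub>M b\<in>B. lborel). (\<Sum>b\<in>B. c b *\<^sub>R b) \<in> X}"
  unfolding coord_lborel_def using assms
  by (subst emeasure_distr) (auto simp: vimage_def Int_def conj_commute)

lemma coord_lborel_concentrated:
  fixes B :: "'a::euclidean_space set"
  assumes B: "orthonormal_basis_of V B"
  shows "AE x in coord_lborel B. x \<in> V"
proof -
  have "V = span B" using B by (auto simp: orthonormal_basis_of_def)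
  then have "closed V" by simp
  then have [measurable]: "V \<in> sets borel" by simp
  have "(\<Sum>b\<in>B. c b *\<^sub>R b) \<in> V" for c
    unfolding \<open>V = span B\<close> by (intro span_sum span_scale span_base)
  then show ?thesis unfolding coord_lborel_def
    by (subst AE_distr_iff) auto
qed

lemma PiM_scale_preimage:
  fixes l :: "'i \<Rightarrow> real"
  assumes I: "finite I" and l: "\<And>i. i \<in> I \<Longrightarrow> l i > 0" and X: "X \<in> sets (\<Pi>\<^sub>M i\<in>I. lborel)"
  shows "emeasure (\<Pi>\<^sub>M i\<in>I. lborel) {c \<in> space (\<Pi>\<^sub>M i\<in>I. lborel). (\<lambda>i\<in>I. l i * c i) \<in> X}
       = ennreal (\<Prod>i\<in>I. 1 / l i) * emeasure (\<Pi>\<^sub>M i\<in>I. lborel) X"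
proof -
  let ?P = "\<Pi>\<^sub>M i\<in>I. (lborel :: real measure)"
  have "emeasure (distr ?P ?P (\<lambda>c. \<lambda>i\<in>I. 0 + l i * c i)) X = ennreal (\<Prod>i\<in>I. 1 / l i) * emeasure ?P X"
    by (subst PiM_lborel_affine[OF I l]) auto
  also have "emeasure (distr ?P ?P (\<lambda>c. \<lambda>i\<in>I. 0 + l i * c i)) X
     = emeasure ?P {c \<in> space ?P. (\<lambda>i\<in>I. l i * c i) \<in> X}"
    using X by (subst emeasure_distr) (auto simp: vimage_def Int_def conj_commute)
  finally show ?thesis .
qed

lemma coord_lborel_dilate:
  fixes B :: "'a::euclidean_space set"
  assumes B: "finite B" and t: "t > 0" and X: "X \<in> sets borel"
  shows "emeasure (coord_lborel B) ((\<lambda>x. t *\<^sub>R x) -` X) = ennreal ((1 / t) ^ card B) * emeasure (coord_lborel B) X"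
proof -
  let ?P = "\<Pi>\<^sub>M i\<in>B. (lborel :: real measure)"
  let ?X = "{c \<in> space ?P. (\<Sum>b\<in>B. c b *\<^sub>R b) \<in> X}"
  have X': "?X \<in> sets ?P" using X by (rule coord_sum_preimage)
  have "(\<lambda>x. t *\<^sub>R x) -` X \<in> sets borel"
    using measurable_sets[of "\<lambda>x. t *\<^sub>R x" borel borel X] X by simp
  then have "emeasure (coord_lborel B) ((\<lambda>x. t *\<^sub>R x) -` X)
      = emeasure ?P {c \<in> space ?P. t *\<^sub>R (\<Sum>b\<in>B. c b *\<^sub>R b) \<in> X}"
    by (subst coord_lborel_emeasure) auto
  also have "{c \<in> space ?P. t *\<^sub>R (\<Sum>b\<in>B. c b *\<^sub>R b) \<in> X} = {c \<in> space ?P. (\<lambda>i\<in>B. t * c i) \<in> ?X}"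
    by (auto simp: space_PiM scaleR_sum_right)
  also have "emeasure ?P \<dots> = ennreal (\<Prod>i\<in>B. 1 / t) * emeasure ?P ?X"
    using t by (intro PiM_scale_preimage B X')
  finally show ?thesis using coord_lborel_emeasure[OF X] by (simp only: prod_constant)
qed

lemma coord_lborel_cball_finite:
  fixes B :: "'a::euclidean_space set"
  assumes B: "orthonormal_basis_of V B"
  shows "emeasure (coord_lborel B) (cball 0 r) < \<infinity>"
proof -
  note D = orthonormal_basis_ofD[OF B]
  let ?P = "\<Pi>\<^sub>M i\<in>B. (lborel :: real measure)"
  have "emeasure (coord_lborel B) (cball 0 r) = emeasure ?P {c \<in> space ?P. (\<Sum>b\<in>B. c b *\<^sub>R b) \<in> cball 0 r}"
    by (rule coord_lborel_emeasure) simp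
  also have "\<dots> \<le> emeasure ?P (Pi\<^sub>E B (\<lambda>_. {-r..r}))"
  proof (rule emeasure_mono)
    show "{c \<in> space ?P. (\<Sum>b\<in>B. c b *\<^sub>R b) \<in> cball 0 r} \<subseteq> Pi\<^sub>E B (\<lambda>_. {-r..r})"
    proof (rule subsetI)
      fix c assume "c \<in> {c \<in> space ?P. (\<Sum>b\<in>B. c b *\<^sub>R b) \<in> cball 0 r}"
      then have c: "c \<in> space ?P" "(\<Sum>b\<in>B. c b *\<^sub>R b) \<in> cball 0 r" by auto
      have "\<bar>c b\<bar> \<le> r" if "b \<in> B" for b
      proof -
        have "\<bar>c b\<bar> = \<bar>(\<Sum>b\<in>B. c b *\<^sub>R b) \<bullet> b\<bar>" using orthonormal_sum_inner[OF B that] by simp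
        also have "\<dots> \<le> norm (\<Sum>b\<in>B. c b *\<^sub>R b) * norm b" by (rule Cauchy_Schwarz_ineq2)
        also have "\<dots> \<le> r" using D(2)[OF that, folded norm_eq_1] c(2) by simp
        finally show ?thesis .
      qed
      then show "c \<in> Pi\<^sub>E B (\<lambda>_. {-r..r})" using c(1) by (auto simp: space_PiM PiE_iff abs_le_iff minus_le_iff)
    qed
    show "Pi\<^sub>E B (\<lambda>_. {-r..r}) \<in> sets ?P" using D by (intro sets_PiM_I_finite) auto
  qed
  also have "\<dots> = (\<Prod>i\<in>B. emeasure lborel {-r..r})"
    using D by (intro lborel_PiM.emeasure_PiM) auto
  also have "\<dots> < \<infinity>" by (simp add: emeasure_lborel_Icc_eq power_less_top_ennreal)
  finally show ?thesis .
qed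

lemma coord_lborel_cball_pos:
  fixes B :: "'a::euclidean_space set"
  assumes B: "orthonormal_basis_of V B"
  shows "emeasure (coord_lborel B) (cball 0 1) > 0"
proof -
  note D = orthonormal_basis_ofD[OF B]
  let ?P = "\<Pi>\<^sub>M i\<in>B. (lborel :: real measure)"
  let ?h = "1 / (real (card B) + 1)"
  have "0 < (\<Prod>i\<in>B. ennreal ?h)"
    by (subst prod_ennreal) (auto intro!: prod_pos)
  also have "\<dots> = (\<Prod>i\<in>B. emeasure lborel {0..?h})" by simp
  also have "\<dots> = emeasure ?P (Pi\<^sub>E B (\<lambda>_. {0..?h}))"
    using D by (intro lborel_PiM.emeasure_PiM[symmetric]) auto
  also have "\<dots> \<le> emeasure ?P {c \<in> space ?P. (\<Sum>b\<in>B. c b *\<^sub>R b) \<in> cball 0 1}"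
  proof (rule emeasure_mono)
    show "Pi\<^sub>E B (\<lambda>_. {0..?h}) \<subseteq> {c \<in> space ?P. (\<Sum>b\<in>B. c b *\<^sub>R b) \<in> cball 0 1}"
    proof safe
      fix c assume c: "c \<in> Pi\<^sub>E B (\<lambda>_. {0..?h})"
      then show "c \<in> space ?P" by (auto simp: space_PiM PiE_iff)
      have "norm (\<Sum>b\<in>B. c b *\<^sub>R b) \<le> (\<Sum>b\<in>B. norm (c b *\<^sub>R b))" by (rule norm_sum)
      also have "\<dots> \<le> (\<Sum>b\<in>B. ?h)"
        using c D by (intro sum_mono) (auto simp: PiE_iff norm_eq_1[THEN iffD2])
      also have "\<dots> \<le> 1" by (simp add: field_simps)
      finally show "(\<Sum>b\<in>B. c b *\<^sub>R b) \<in> cball 0 1" by simp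
    qed
    show "{c \<in> space ?P. (\<Sum>b\<in>B. c b *\<^sub>R b) \<in> cball 0 1} \<in> sets ?P"
      by (rule coord_sum_preimage) simp
  qed
  also have "\<dots> = emeasure (coord_lborel B) (cball 0 1)"
    by (rule coord_lborel_emeasure[symmetric]) simp
  finally show ?thesis .
qed

lemma sigma_finite_if_cballs_finite:
  fixes M :: "'a::euclidean_space measure"
  assumes "sets M = sets borel" "\<And>r. emeasure M (cball 0 r) < \<infinity>"
  shows "sigma_finite_measure M"
proof
  have sp: "space M = UNIV" using assms(1) sets_eq_imp_space_eq by fastforce
  have un: "(\<Union>n::nat. cball (0::'a) (real n)) = UNIV"
    by (auto simp: real_arch_simple)
  show "\<exists>A. countable A \<and> A \<subseteq> sets M \<and> \<Union>A = space M \<and> (\<forall>a\<in>A. emeasure M a \<noteq> \<infinity>)"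
    using assms un by (intro exI[of _ "range (\<lambda>n::nat. cball (0::'a) (real n))"])
      (auto simp: sp less_top)
qed

text \<open>The uniqueness argument for Haar measure: translate \<open>X\<close> by the points of \<open>Y\<close>, exchange the order of
integration, and translate \<open>Y\<close> by the points of \<open>X\<close>.\<close>

lemma translation_invariant_swap:
  fixes M1 M2 :: "'a::euclidean_space measure"
  assumes s1[measurable_cong]: "sets M1 = sets borel" and s2[measurable_cong]: "sets M2 = sets borel"
    and sf: "sigma_finite_measure M1" "sigma_finite_measure M2"
    and inv1: "\<And>v. v \<in> V \<Longrightarrow> distr M1 borel ((+) v) = M1"
    and inv2: "\<And>v. v \<in> V \<Longrightarrow> distr M2 borel ((+) v) = M2"
    and V1: "AE x in M1. x \<in> V" and V2: "AE x in M2. x \<in> V" and V: "subspace V"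
    and [measurable]: "X \<in> sets borel" "Y \<in> sets borel"
  shows "emeasure M1 X * emeasure M2 Y = emeasure M2 X * emeasure M1 (uminus -` Y)"
proof -
  interpret pair_sigma_finite M1 M2 using sf by (rule pair_sigma_finite.intro)
  have sp: "space M1 = UNIV" "space M2 = UNIV"
    using sets_eq_imp_space_eq[OF s1] sets_eq_imp_space_eq[OF s2] by auto
  have t1: "(\<integral>\<^sup>+x. f (v + x) \<partial>M1) = (\<integral>\<^sup>+x. f x \<partial>M1)" if "v \<in> V" and [measurable]: "f \<in> borel_measurable borel" for v f
  proof -
    have "(\<integral>\<^sup>+x. f x \<partial>M1) = (\<integral>\<^sup>+x. f x \<partial>distr M1 borel ((+) v))" using inv1[OF that(1)] by simp
    also have "\<dots> = (\<integral>\<^sup>+x. f (v + x) \<partial>M1)" by (subst nn_integral_distr) auto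
    finally show ?thesis by simp
  qed
  have t2: "(\<integral>\<^sup>+x. f (v + x) \<partial>M2) = (\<integral>\<^sup>+x. f x \<partial>M2)" if "v \<in> V" and [measurable]: "f \<in> borel_measurable borel" for v f
  proof -
    have "(\<integral>\<^sup>+x. f x \<partial>M2) = (\<integral>\<^sup>+x. f x \<partial>distr M2 borel ((+) v))" using inv2[OF that(1)] by simp
    also have "\<dots> = (\<integral>\<^sup>+x. f (v + x) \<partial>M2)" by (subst nn_integral_distr) auto
    finally show ?thesis by simp
  qed
  have "emeasure M1 X * emeasure M2 Y = (\<integral>\<^sup>+y. (\<integral>\<^sup>+x. indicator X x \<partial>M1) * indicator Y y \<partial>M2)"
    by (simp add: s1 s2 nn_integral_cmult)
  also have "\<dots> = (\<integral>\<^sup>+y. (\<integral>\<^sup>+x. indicator X (y + x) \<partial>M1) * indicator Y y \<partial>M2)"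
    using V2 by (intro nn_integral_cong_AE) (auto simp: t1[of _ "indicator X"])
  also have "\<dots> = (\<integral>\<^sup>+y. (\<integral>\<^sup>+x. indicator X (y + x) * indicator Y y \<partial>M1) \<partial>M2)"
    by (simp add: nn_integral_multc)
  also have "\<dots> = (\<integral>\<^sup>+x. (\<integral>\<^sup>+y. indicator X (y + x) * indicator Y y \<partial>M2) \<partial>M1)"
    by (rule Fubini') measurable
  also have "\<dots> = (\<integral>\<^sup>+x. (\<integral>\<^sup>+y. indicator X y * indicator Y (y - x) \<partial>M2) \<partial>M1)"
  proof (rule nn_integral_cong_AE, use V1 in eventually_elim)
    fix x assume x: "x \<in> V"
    show "(\<integral>\<^sup>+y. indicator X (y + x) * indicator Y y \<partial>M2) = (\<integral>\<^sup>+y. indicator X y * indicator Y (y - x) \<partial>M2)"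
      using t2[OF x, of "\<lambda>y. indicator X y * indicator Y (y - x)"] by (simp add: add.commute)
  qed
  also have "\<dots> = (\<integral>\<^sup>+y. (\<integral>\<^sup>+x. indicator X y * indicator Y (y - x) \<partial>M1) \<partial>M2)"
    by (rule Fubini'[symmetric]) measurable
  also have "\<dots> = (\<integral>\<^sup>+y. indicator X y * (\<integral>\<^sup>+x. indicator Y (y - x) \<partial>M1) \<partial>M2)"
    by (simp add: nn_integral_cmult)
  also have "\<dots> = (\<integral>\<^sup>+y. indicator X y * emeasure M1 (uminus -` Y) \<partial>M2)"
  proof (rule nn_integral_cong_AE, use V2 in eventually_elim)
    fix y assume y: "y \<in> V"
    have m: "uminus -` Y \<in> sets borel" 
      using measurable_sets[of uminus "borel :: 'a measure" borel Y] by simp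
    have "(\<integral>\<^sup>+x. indicator Y (y - x) \<partial>M1) = (\<integral>\<^sup>+x. indicator Y (- x) \<partial>M1)"
      using t1[OF y, of "\<lambda>x. indicator Y (y - x)"] by simp
    also have "\<dots> = (\<integral>\<^sup>+x. indicator (uminus -` Y) x \<partial>M1)" by (simp add: indicator_def)
    also have "\<dots> = emeasure M1 (uminus -` Y)" using m s1 by simp
    finally show "indicator X y * (\<integral>\<^sup>+x. indicator Y (y - x) \<partial>M1) = indicator X y * emeasure M1 (uminus -` Y)" by simp
  qed
  also have "\<dots> = emeasure M2 X * emeasure M1 (uminus -` Y)"
    by (simp add: nn_integral_multc s2)
  finally show ?thesis .
qed

text \<open>With the symmetric unit ball for \<open>Y\<close> in the preceding lemma, two bases of the same subspace give
measures that differ by a positive constant. A constant is enough where volumes are compared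
within one subspace or known up to a factor.\<close>

lemma coord_lborel_proportional:
  fixes B B' :: "'a::euclidean_space set"
  assumes B: "orthonormal_basis_of V B" and B': "orthonormal_basis_of V B'"
  obtains c :: real where "c > 0" "\<And>X. X \<in> sets borel \<Longrightarrow> emeasure (coord_lborel B) X = ennreal c * emeasure (coord_lborel B') X"
proof -
  let ?b = "cball (0::'a) 1"
  let ?p = "emeasure (coord_lborel B) ?b" and ?q = "emeasure (coord_lborel B') ?b"
  have V: "subspace V" using B by (auto simp: orthonormal_basis_of_def)
  have b: "uminus -` ?b = ?b" by auto
  have eq: "emeasure (coord_lborel B) X * ?q = emeasure (coord_lborel B') X * ?p" if "X \<in> sets borel" for X
    using translation_invariant_swap[OF sets_coord_lborel sets_coord_lborel
        sigma_finite_if_cballs_finite[OF sets_coord_lborel coord_lborel_cball_finite[OF B]]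
        sigma_finite_if_cballs_finite[OF sets_coord_lborel coord_lborel_cball_finite[OF B']]
        coord_lborel_translate[OF B] coord_lborel_translate[OF B']
        coord_lborel_concentrated[OF B] coord_lborel_concentrated[OF B'] V that, of ?b]
    by (simp add: b)
  obtain p where p: "?p = ennreal p" "p > 0"
    using coord_lborel_cball_finite[OF B, of 1] coord_lborel_cball_pos[OF B] by (cases ?p) auto
  obtain q where q: "?q = ennreal q" "q > 0"
    using coord_lborel_cball_finite[OF B', of 1] coord_lborel_cball_pos[OF B'] by (cases ?q) auto
  show thesis
  proof (rule that[of "p / q"])
    show "p / q > 0" using p q by simp
    fix X :: "'a set" assume X: "X \<in> sets borel"
    have "emeasure (coord_lborel B) X = emeasure (coord_lborel B) X * (ennreal q * ennreal (1 / q))"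
      using q by (simp add: ennreal_mult[symmetric])
    also have "\<dots> = emeasure (coord_lborel B') X * (ennreal p * ennreal (1 / q))"
      using eq[OF X] p q by (simp add: mult.assoc[symmetric])
    also have "\<dots> = ennreal (p / q) * emeasure (coord_lborel B') X"
      using p q by (simp add: ennreal_mult[symmetric] mult.commute)
    finally show "emeasure (coord_lborel B) X = ennreal (p / q) * emeasure (coord_lborel B') X" .
  qed
qed

section \<open>Integration in polar form\<close>

text \<open>Scaling of degree \<open>k\<close> and finiteness on bounded sets are the properties of \<open>k\<close>-dimensional Lebesgue
measure on which polar integration rests.\<close>

definition dilation_measure :: "nat \<Rightarrow> 'a::euclidean_space measure \<Rightarrow> bool" where
  "dilation_measure k M \<longleftrightarrow> sets M = sets borel \<and> (\<forall>r. emeasure M (cball 0 r) < \<infinity>) \<and>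
     (\<forall>t>0. \<forall>X\<in>sets borel. emeasure M ((\<lambda>x. t *\<^sub>R x) -` X) = ennreal ((1 / t) ^ k) * emeasure M X)"

lemma dilation_measureD:
  assumes "dilation_measure k M"
  shows "sets M = sets borel" "space M = UNIV" "sigma_finite_measure M"
    "\<And>X. bounded X \<Longrightarrow> emeasure M X < \<infinity>"
proof -
  show s: "sets M = sets borel" using assms by (simp add: dilation_measure_def)
  show "space M = UNIV" using sets_eq_imp_space_eq[OF s] by simp
  have c: "emeasure M (cball 0 r) < \<infinity>" for r using assms by (simp add: dilation_measure_def)
  show "sigma_finite_measure M" by (rule sigma_finite_if_cballs_finite[OF s c])
  fix X :: "'a set" assume "bounded X"
  then obtain r where "X \<subseteq> cball 0 r" by (metis bounded_iff mem_cball_0 subsetI)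
  then have "emeasure M X \<le> emeasure M (cball 0 r)" by (intro emeasure_mono) (auto simp: s)
  then show "emeasure M X < \<infinity>" using c[of r] by (rule le_less_trans)
qed

lemma dilation_measure_coord_lborel:
  assumes "orthonormal_basis_of V B"
  shows "dilation_measure (card B) (coord_lborel B)"
  unfolding dilation_measure_def
  by (intro conjI allI impI ballI sets_coord_lborel coord_lborel_cball_finite[OF assms]
        coord_lborel_dilate[OF orthonormal_basis_ofD(1)[OF assms]])

lemma orthonormal_basis_of_Basis: "orthonormal_basis_of UNIV (Basis :: 'a::euclidean_space set)"
  
  unfolding orthonormal_basis_of_def pairwise_def orthogonal_def
  by (simp add: inner_not_same_Basis)

lemma dilation_measure_lborel:
  "dilation_measure DIM('a) (lborel :: 'a::euclidean_space measure)"
proof -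
  have "coord_lborel Basis = (lborel :: 'a measure)"
    unfolding coord_lborel_def by (rule lborel_eq[symmetric])
  then show ?thesis
    using dilation_measure_coord_lborel[OF orthonormal_basis_of_Basis, where 'a='a] by simp
qed

lemma dilation_nn_integral:
  assumes M: "dilation_measure k M" and t: "t > 0" and [measurable]: "f \<in> borel_measurable borel"
  shows "(\<integral>\<^sup>+x. f (t *\<^sub>R x) \<partial>M) = ennreal ((1 / t) ^ k) * (\<integral>\<^sup>+x. f x \<partial>M)"
proof -
  note [measurable_cong] = dilation_measureD(1)[OF M]
  have "distr M borel (\<lambda>x. t *\<^sub>R x) = scale_measure (ennreal ((1 / t) ^ k)) M"
  proof (rule measure_eqI)
    fix X assume "X \<in> sets (distr M borel (\<lambda>x. t *\<^sub>R x))"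
    then show "emeasure (distr M borel (\<lambda>x. t *\<^sub>R x)) X = emeasure (scale_measure (ennreal ((1 / t) ^ k)) M) X"
      using M t by (simp add: emeasure_distr dilation_measure_def dilation_measureD(2)[OF M])
  qed (use dilation_measureD(1)[OF M] in simp)
  then have "(\<integral>\<^sup>+x. f x \<partial>distr M borel (\<lambda>x. t *\<^sub>R x)) = ennreal ((1 / t) ^ k) * (\<integral>\<^sup>+x. f x \<partial>M)"
    by (simp add: nn_integral_scale_measure)
  then show ?thesis by (subst (asm) nn_integral_distr) auto
qed

lemma dilation_null_zero:
  assumes M: "dilation_measure k M" and k: "k > 0"
  shows "AE x in M. x \<noteq> 0"
proof -
  have eq: "(\<lambda>x::'a. 2 *\<^sub>R x) -` {0} = {0}" by auto
  have fin: "emeasure M {0} < \<infinity>" by (rule dilation_measureD(4)[OF M]) simp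
  have "emeasure M ((\<lambda>x. 2 *\<^sub>R x) -` {0}) = ennreal ((1 / 2) ^ k) * emeasure M {0}"
    using M unfolding dilation_measure_def by (auto simp del: vimage_singleton_eq)
  then have 1: "emeasure M {0} = ennreal ((1 / 2) ^ k) * emeasure M {0}" unfolding eq .
  obtain m where m: "emeasure M {0} = ennreal m" "m \<ge> 0" using fin by (cases "emeasure M {0}") auto
  have "m = (1 / 2) ^ k * m" using 1 m by (simp add: ennreal_mult[symmetric])
  moreover have "(1 / 2 :: real) ^ k < 1" using k by (simp add: power_less_one_iff)
  ultimately have "m = 0" by auto
  then have "{0} \<in> null_sets M" using m dilation_measureD(1)[OF M] by (auto simp: null_sets_def)
  then show ?thesis by (rule AE_I') auto
qed

lemma nn_integral_exp_ray:
  fixes k :: real assumes k: "k > 0"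
  shows "(\<integral>\<^sup>+s. ennreal (exp (- k * s)) * indicator {0..} s \<partial>lborel) = ennreal (1 / k)"
proof -
  have "((\<lambda>s. - exp (- k * s) / k) \<longlongrightarrow> 0) at_top"
    using k by real_asymp
  moreover have "((\<lambda>s. - exp (- k * s) / k) has_real_derivative exp (- k * s)) (at s)" for s
    using k by (auto intro!: derivative_eq_intros)
  ultimately have "(\<integral>\<^sup>+s. ennreal (exp (- k * s)) * indicator {0..} s \<partial>lborel) = ennreal (0 - (- exp (- k * 0) / k))"
    by (intro nn_integral_FTC_atLeast) auto
  then show ?thesis by simp
qed

text \<open>The mass \<open>1/k\<close> of a ray with respect to \<open>r powr k\<close> times the scale-invariant measure \<open>dr/r\<close>, in the
variable \<open>s = ln r\<close>.\<close>

lemma nn_integral_log_section: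
  fixes k F :: real assumes k: "k > 0" and F: "F > 0"
  shows "(\<integral>\<^sup>+s. ennreal ((exp s * F) powr k) * indicator {s. exp s * F \<le> 1} s \<partial>lborel) = ennreal (1 / k)"
proof -
  have "(\<integral>\<^sup>+s. ennreal ((exp s * F) powr k) * indicator {s. exp s * F \<le> 1} s \<partial>lborel)
     = (\<integral>\<^sup>+s. ennreal ((exp (- ln F + (-1) * s) * F) powr k) * indicator {s. exp s * F \<le> 1} (- ln F + (-1) * s) \<partial>lborel)"
    by (subst nn_integral_real_affine[where c="-1" and t="- ln F"]) auto
  also have "\<dots> = (\<integral>\<^sup>+s. ennreal (exp (- k * s)) * indicator {0..} s \<partial>lborel)"
  proof (rule nn_integral_cong)
    fix s :: real
    have "exp (- ln F + (-1) * s) * F = exp (- s)" using F by (simp add: exp_diff exp_minus field_simps)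
    then show "ennreal ((exp (- ln F + (-1) * s) * F) powr k) * indicator {s. exp s * F \<le> 1} (- ln F + (-1) * s)
      = ennreal (exp (- k * s)) * indicator {0..} s"
      by (auto simp: indicator_def powr_def mult.commute)
  qed
  finally show ?thesis using nn_integral_exp_ray[OF k] by simp
qed

text \<open>Both sides evaluate the integral over \<open>x\<close> and \<open>s\<close> of \<open>exp (k * s)\<close> under the two conditions
\<open>F (exp s * x) \<le> 1\<close> and \<open>1 \<le> G x < exp 1\<close>. Integrating over \<open>s\<close> first yields \<open>F x powr -k / k\<close>. Taking
\<open>exp s * x\<close> as the new variable cancels \<open>exp (k * s)\<close> and moves \<open>s\<close> to the second condition; then
the integral over \<open>s\<close> is 1, because \<open>1 \<le> exp (- s) * G x < exp 1\<close> defines an interval of length 1.\<close>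

lemma polar_nn_integral:
  fixes F G :: "'a::euclidean_space \<Rightarrow> real"
  assumes M: "dilation_measure k M" and k: "k > 0"
    and Fm[measurable]: "F \<in> borel_measurable borel" and Gm[measurable]: "G \<in> borel_measurable borel"
    and Fh: "\<And>t x. t > 0 \<Longrightarrow> F (t *\<^sub>R x) = t * F x" and Gh: "\<And>t x. t > 0 \<Longrightarrow> G (t *\<^sub>R x) = t * G x"
    and Fp: "AE x in M. F x > 0" and Gp: "AE x in M. G x > 0"
  shows "emeasure M {x. F x \<le> 1} =
    ennreal (1 / k) * (\<integral>\<^sup>+x. ennreal (F x powr - real k) * indicator {x. 1 \<le> G x \<and> G x < exp 1} x \<partial>M)"
proof -
  note [measurable_cong] = dilation_measureD(1)[OF M]
  note sp = dilation_measureD(2)[OF M]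
  interpret pair_sigma_finite M lborel
    using dilation_measureD(3)[OF M] lborel.sigma_finite_measure_axioms by (rule pair_sigma_finite.intro)
  let ?C = "{x. 1 \<le> G x \<and> G x < exp 1}"
  let ?h = "\<lambda>s y. indicator {x. F x \<le> 1} y * indicator {s. 1 \<le> exp (- s) * G y \<and> exp (- s) * G y < exp 1} s :: ennreal"
  have "(\<integral>\<^sup>+x. ennreal (F x powr - real k) * indicator ?C x \<partial>M) * ennreal (1 / k)
     = (\<integral>\<^sup>+x. ennreal (F x powr - real k) * indicator ?C x * ennreal (1 / k) \<partial>M)"
    by (rule nn_integral_multc[symmetric]) measurable
  also have "\<dots> = (\<integral>\<^sup>+x. ennreal (F x powr - real k) * indicator ?C x *
       (\<integral>\<^sup>+s. ennreal ((exp s * F x) powr k) * indicator {s. exp s * F x \<le> 1} s \<partial>lborel) \<partial>M)"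
    using Fp k by (intro nn_integral_cong_AE, elim eventually_mono) (simp add: nn_integral_log_section)
  also have "\<dots> = (\<integral>\<^sup>+x. (\<integral>\<^sup>+s. ennreal (F x powr - real k) * indicator ?C x *
       (ennreal ((exp s * F x) powr k) * indicator {s. exp s * F x \<le> 1} s) \<partial>lborel) \<partial>M)"
    by (intro nn_integral_cong nn_integral_cmult[symmetric]) measurable
  also have "\<dots> = (\<integral>\<^sup>+x. (\<integral>\<^sup>+s. ennreal (exp s ^ k) * ?h s (exp s *\<^sub>R x) \<partial>lborel) \<partial>M)"
  proof (rule nn_integral_cong_AE, use Fp in eventually_elim, rule nn_integral_cong)
    fix x s assume F: "F x > 0"
    have 1: "(exp s * F x) powr k = exp s ^ k * F x powr k" using F by (simp add: powr_mult powr_realpow)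
    have "F x powr - real k * (exp s * F x) powr k = exp s ^ k"
      unfolding 1 using F by (simp add: powr_minus field_simps)
    then have 2: "ennreal (F x powr - real k) * ennreal ((exp s * F x) powr k) = ennreal (exp s ^ k)"
      by (simp add: ennreal_mult[symmetric] del: powr_mult)
    have "ennreal (F x powr - real k) * indicator ?C x * (ennreal ((exp s * F x) powr k) * indicator {s. exp s * F x \<le> 1} s)
       = (ennreal (F x powr - real k) * ennreal ((exp s * F x) powr k)) * (indicator ?C x * indicator {s. exp s * F x \<le> 1} s)"
      by (simp add: mult_ac)
    also have "\<dots> = ennreal (exp s ^ k) * ?h s (exp s *\<^sub>R x)"
      unfolding 2 by (auto simp: indicator_def Fh Gh mult.assoc[symmetric] exp_add[symmetric])
    finally show "ennreal (F x powr - real k) * indicator ?C x * (ennreal ((exp s * F x) powr k) * indicator {s. exp s * F x \<le> 1} s)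
       = ennreal (exp s ^ k) * ?h s (exp s *\<^sub>R x)" .
  qed
  also have "\<dots> = (\<integral>\<^sup>+s. (\<integral>\<^sup>+x. ennreal (exp s ^ k) * ?h s (exp s *\<^sub>R x) \<partial>M) \<partial>lborel)"
    by (rule Fubini'[symmetric]) measurable
  also have "\<dots> = (\<integral>\<^sup>+s. (\<integral>\<^sup>+x. ?h s x \<partial>M) \<partial>lborel)"
  proof (rule nn_integral_cong)
    fix s :: real
    have "(\<integral>\<^sup>+x. ennreal (exp s ^ k) * ?h s (exp s *\<^sub>R x) \<partial>M) = ennreal (exp s ^ k) * (\<integral>\<^sup>+x. ?h s (exp s *\<^sub>R x) \<partial>M)"
      by (rule nn_integral_cmult) measurable
    also have "\<dots> = ennreal (exp s ^ k) * (ennreal ((1 / exp s) ^ k) * (\<integral>\<^sup>+x. ?h s x \<partial>M))"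
      by (subst dilation_nn_integral[OF M]) auto
    also have "\<dots> = (\<integral>\<^sup>+x. ?h s x \<partial>M)"
      by (simp add: mult.assoc[symmetric] ennreal_mult[symmetric] power_mult_distrib[symmetric])
    finally show "(\<integral>\<^sup>+x. ennreal (exp s ^ k) * ?h s (exp s *\<^sub>R x) \<partial>M) = (\<integral>\<^sup>+x. ?h s x \<partial>M)" .
  qed
  also have "\<dots> = (\<integral>\<^sup>+x. (\<integral>\<^sup>+s. ?h s x \<partial>lborel) \<partial>M)"
    by (rule Fubini') measurable
  also have "\<dots> = (\<integral>\<^sup>+x. indicator {x. F x \<le> 1} x \<partial>M)"
  proof (rule nn_integral_cong_AE, use Gp in eventually_elim)
    fix x assume G: "G x > 0"
    have eq: "{s. 1 \<le> exp (- s) * G x \<and> exp (- s) * G x < exp 1} = {ln (G x) - 1 <.. ln (G x)}"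
    proof (rule set_eqI)
      fix s
      have "exp (- s) * G x = exp (ln (G x) - s)" using G by (simp add: exp_diff exp_minus field_simps)
      then show "s \<in> {s. 1 \<le> exp (- s) * G x \<and> exp (- s) * G x < exp 1} \<longleftrightarrow> s \<in> {ln (G x) - 1 <.. ln (G x)}"
        by auto
    qed
    show "(\<integral>\<^sup>+s. ?h s x \<partial>lborel) = indicator {x. F x \<le> 1} x"
      unfolding eq by (simp add: nn_integral_cmult)
  qed
  also have "\<dots> = emeasure M {x. F x \<le> 1}"
    by (rule nn_integral_indicator) (simp add: dilation_measureD(1)[OF M])
  finally show ?thesis by (simp add: mult.commute)
qed

definition shell :: "('a \<Rightarrow> real) \<Rightarrow> 'a set" where
  "shell \<gamma> = {x. 1 \<le> \<gamma> x \<and> \<gamma> x < exp 1}"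

text \<open>The form used below: \<open>W\<close> is a power of degree \<open>h\<close> of a gauge, bounded below so that its unit sublevel
set is bounded.\<close>

lemma polar_integral:
  fixes W G :: "'a::euclidean_space \<Rightarrow> real"
  assumes M: "dilation_measure k M" and k: "k > 0" and h: "h > 0" and c: "c > 0"
    and Wm[measurable]: "W \<in> borel_measurable borel" and Gm[measurable]: "G \<in> borel_measurable borel"
    and Wh: "\<And>t x. t > 0 \<Longrightarrow> W (t *\<^sub>R x) = t powr h * W x" and Gh: "\<And>t x. t > 0 \<Longrightarrow> G (t *\<^sub>R x) = t * G x"
    and Wl: "\<And>x. W x \<ge> c * norm x powr h" and Gp: "AE x in M. G x > 0"
  shows "integrable M (\<lambda>x. W x powr (- real k / h) * indicator (shell G) x)" (is ?int)
    and "measure M {x. W x \<le> 1} = (1 / k) * (\<integral>x. W x powr (- real k / h) * indicator (shell G) x \<partial>M)" (is ?eq)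
proof -
  note [measurable_cong] = dilation_measureD(1)[OF M]
  let ?F = "\<lambda>x. W x powr (1 / h)"
  have W0: "W x \<ge> 0" for x using Wl[of x] c by (smt (verit) mult_nonneg_nonneg powr_ge_zero)
  have W1: "W x > 0" if "x \<noteq> 0" for x using Wl[of x] c that by (smt (verit) mult_pos_pos powr_gt_zero zero_less_norm_iff norm_le_zero_iff)
  have set: "{x. ?F x \<le> 1} = {x. W x \<le> 1}"
  proof (intro Collect_cong)
    fix x
    show "?F x \<le> 1 \<longleftrightarrow> W x \<le> 1"
      using W0[of x] h powr_le1[of "1 / h" "W x"] gr_one_powr[of "W x" "1 / h"]
      by (cases "W x \<le> 1") (auto simp: not_le)
  qed
  have bd: "bounded {x. W x \<le> 1}"
  proof (rule boundedI)
    fix x assume "x \<in> {x. W x \<le> 1}"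
    then have "c * norm x powr h \<le> 1" using Wl[of x] by auto
    then have "norm x powr h \<le> 1 / c" using c by (simp add: field_simps)
    then have "(norm x powr h) powr (1 / h) \<le> (1 / c) powr (1 / h)" using h by (intro powr_mono2) auto
    then show "norm x \<le> (1 / c) powr (1 / h)" using h by (simp add: powr_powr)
  qed
  have fin: "emeasure M {x. W x \<le> 1} < \<infinity>" by (rule dilation_measureD(4)[OF M bd])
  have *: "emeasure M {x. W x \<le> 1} =
    ennreal (1 / k) * (\<integral>\<^sup>+x. ennreal (?F x powr - real k) * indicator {x. 1 \<le> G x \<and> G x < exp 1} x \<partial>M)"
    unfolding set[symmetric]
  proof (rule polar_nn_integral[OF M k _ Gm _ Gh _ Gp])
    show "?F (t *\<^sub>R x) = t * ?F x" if "t > 0" for t x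
      using that h W0[of x] by (simp add: Wh[OF that] powr_mult powr_powr)
    show "AE x in M. 0 < ?F x" using dilation_null_zero[OF M k] by eventually_elim (use W1 in force)
  qed auto
  also have "(\<lambda>x. ennreal (?F x powr - real k) * indicator {x. 1 \<le> G x \<and> G x < exp 1} x)
     = (\<lambda>x. ennreal (W x powr (- real k / h) * indicator (shell G) x))"
    using h by (auto simp: fun_eq_iff powr_powr indicator_def shell_def)
  finally have **: "emeasure M {x. W x \<le> 1} = ennreal (1 / k) * (\<integral>\<^sup>+x. ennreal (W x powr (- real k / h) * indicator (shell G) x) \<partial>M)" .
  have nfin: "(\<integral>\<^sup>+x. ennreal (W x powr (- real k / h) * indicator (shell G) x) \<partial>M) < \<infinity>"
    using fin k unfolding ** by (auto simp: ennreal_mult_less_top)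
  have [measurable]: "shell G \<in> sets borel" unfolding shell_def by measurable
  show ?int using nfin by (intro integrableI_nonneg) auto
  then have "(\<integral>\<^sup>+x. ennreal (W x powr (- real k / h) * indicator (shell G) x) \<partial>M) =
     ennreal (\<integral>x. W x powr (- real k / h) * indicator (shell G) x \<partial>M)"
    by (intro nn_integral_eq_integral) auto
  moreover have nn: "0 \<le> (\<integral>x. W x powr (- real k / h) * indicator (shell G) x \<partial>M)"
    by (intro integral_nonneg_AE) auto
  ultimately have "emeasure M {x. W x \<le> 1} =
     ennreal ((1 / k) * (\<integral>x. W x powr (- real k / h) * indicator (shell G) x \<partial>M))"
    unfolding ** by (subst ennreal_mult) simp_all
  then show ?eq
    by (rule measure_eq_emeasure_eq_ennreal[rotated]) (simp add: nn)
qed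

section \<open>Closure properties of smooth functions\<close>

lemma C_k_on_cong:
  assumes "open U" "\<And>x. x \<in> U \<Longrightarrow> f x = g x" "C_k_on k f U"
  shows "C_k_on k g U"
  using assms(2,3)
proof (induction k arbitrary: f g)
  case 0
  then show ?case using continuous_on_cong[of U U f g] by simp
next
  case (Suc k)
  have d: "f differentiable (at x)" if "x \<in> U" for x using Suc.prems that by simp
  have eq: "frechet_derivative f (at x) = frechet_derivative g (at x)" if "x \<in> U" for x
    using d[OF that] assms(1) that Suc.prems(1) by (rule frechet_derivative_transform_within_open)
  have "g differentiable (at x)" if "x \<in> U" for x
    using d[OF that] has_derivative_transform_within_open[of f _ x UNIV U g] assms(1) that Suc.prems(1)
    unfolding differentiable_def by blast
  moreover have "C_k_on k (\<lambda>x. frechet_derivative g (at x) v) U" for v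
    using Suc.IH[of "\<lambda>x. frechet_derivative f (at x) v" "\<lambda>x. frechet_derivative g (at x) v"] eq Suc.prems(2)
    by simp
  ultimately show ?case by simp
qed

lemma C_k_on_SucI:
  assumes U: "open U" and D: "\<And>x. x \<in> U \<Longrightarrow> (f has_derivative D x) (at x)"
    and C: "\<And>v. C_k_on k (\<lambda>x. D x v) U"
  shows "C_k_on (Suc k) f U"
proof -
  have "frechet_derivative f (at x) = D x" if "x \<in> U" for x
    using frechet_derivative_at[OF D[OF that]] by simp
  then have "C_k_on k (\<lambda>x. frechet_derivative f (at x) v) U" for v
    by (intro C_k_on_cong[OF U _ C[of v]]) simp
  then show ?thesis using D by (auto simp: differentiable_def)
qed

lemma C_k_on_SucD: "C_k_on (Suc k) f U \<Longrightarrow> C_k_on k f U"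
proof (induction k arbitrary: f)
  case 0
  then have "\<forall>x\<in>U. isCont f x" by (auto intro: differentiable_imp_continuous_within)
  then show ?case by (simp add: continuous_at_imp_continuous_on)
next
  case (Suc k)
  show ?case using Suc.prems Suc.IH by (simp only: C_k_on.simps(2)) blast
qed

lemma C_k_on_const: "open U \<Longrightarrow> C_k_on k (\<lambda>_. c) U"
proof (induction k arbitrary: c)
  case (Suc k)
  show ?case by (rule C_k_on_SucI[where D="\<lambda>_ _. 0"]) (use Suc in \<open>auto intro!: derivative_eq_intros\<close>)
qed simp

lemma C_k_on_inner: "open U \<Longrightarrow> C_k_on k (\<lambda>x. x \<bullet> b) U"
proof (cases k)
  case (Suc m)
  assume U: "open U"
  show ?thesis unfolding Suc
    by (rule C_k_on_SucI[OF U, where D="\<lambda>_ v. v \<bullet> b"])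
       (auto intro!: derivative_eq_intros C_k_on_const U)
qed (auto intro!: continuous_intros)

lemma C_k_on_add: "open U \<Longrightarrow> C_k_on k f U \<Longrightarrow> C_k_on k g U \<Longrightarrow> C_k_on k (\<lambda>x. f x + g x) U"
proof (induction k arbitrary: f g)
  case 0
  then show ?case by (auto intro!: continuous_intros)
next
  case (Suc k)
  show ?case
  proof (rule C_k_on_SucI[OF \<open>open U\<close>])
    show "((\<lambda>x. f x + g x) has_derivative (\<lambda>v. frechet_derivative f (at x) v + frechet_derivative g (at x) v)) (at x)"
      if "x \<in> U" for x
      using Suc.prems that by (intro has_derivative_add) (auto simp: frechet_derivative_works)
  qed (use Suc in auto)
qed

lemma C_k_on_mult: "open U \<Longrightarrow> C_k_on k f U \<Longrightarrow> C_k_on k g U \<Longrightarrow> C_k_on k (\<lambda>x. f x * g x) U"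
proof (induction k arbitrary: f g)
  case 0
  then show ?case by (auto intro!: continuous_intros)
next
  case (Suc k)
  show ?case
  proof (rule C_k_on_SucI[OF \<open>open U\<close>])
    show "((\<lambda>x. f x * g x) has_derivative (\<lambda>v. f x * frechet_derivative g (at x) v + frechet_derivative f (at x) v * g x)) (at x)"
      if "x \<in> U" for x
      using Suc.prems that by (intro has_derivative_mult) (auto simp: frechet_derivative_works)
    fix v
    show "C_k_on k (\<lambda>x. f x * frechet_derivative g (at x) v + frechet_derivative f (at x) v * g x) U"
      using Suc.prems C_k_on_SucD[OF Suc.prems(2)] C_k_on_SucD[OF Suc.prems(3)]
      by (intro C_k_on_add Suc.IH) auto
  qed
qed

lemma C_k_on_sum:
  "open U \<Longrightarrow> (\<And>i. i \<in> I \<Longrightarrow> C_k_on k (f i) U) \<Longrightarrow> C_k_on k (\<lambda>x. \<Sum>i\<in>I. f i x) U"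
  by (induction I rule: infinite_finite_induct) (auto intro!: C_k_on_add C_k_on_const)

text \<open>The derivative of \<open>f powr p\<close> contains \<open>f powr (p - 1)\<close>, so the induction on \<open>k\<close> is for all exponents at
once; real exponents cover quotients and roots as well.\<close>

lemma C_k_on_powr:
  "open U \<Longrightarrow> (\<And>x. x \<in> U \<Longrightarrow> f x > 0) \<Longrightarrow> C_k_on k f U \<Longrightarrow> C_k_on k (\<lambda>x. f x powr p) U"
proof (induction k arbitrary: p)
  case 0
  then show ?case by (fastforce intro!: continuous_intros)
next
  case (Suc k)
  show ?case
  proof (rule C_k_on_SucI[OF \<open>open U\<close>])
    show "((\<lambda>x. f x powr p) has_derivative (\<lambda>v. frechet_derivative f (at x) v * (p * f x powr (p - 1)))) (at x)"
      if "x \<in> U" for x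
    proof (rule DERIV_compose_FDERIV[where f="\<lambda>y. y powr p"])
      show "((\<lambda>y. y powr p) has_real_derivative p * f x powr (p - 1)) (at (f x))"
        using Suc.prems(2)[OF that] by (rule has_real_derivative_powr)
      show "(f has_derivative frechet_derivative f (at x)) (at x)"
        using Suc.prems that by (auto simp: frechet_derivative_works)
    qed
    fix v
    show "C_k_on k (\<lambda>x. frechet_derivative f (at x) v * (p * f x powr (p - 1))) U"
      using Suc.prems C_k_on_SucD[OF Suc.prems(3)]
      by (intro C_k_on_mult C_k_on_const Suc.IH) auto
  qed
qed

section \<open>Convexity of perturbed quartics\<close>

text \<open>For a subset \<open>T\<close> of \<open>Basis\<close>, the squared length of the orthogonal projection to the coordinate
subspace spanned by \<open>T\<close>.\<close>

definition block_sq :: "'a::euclidean_space set \<Rightarrow> 'a \<Rightarrow> real" where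
  "block_sq T x = (\<Sum>j\<in>T. (x \<bullet> j)\<^sup>2)"

lemma block_sq_nonneg[simp]: "block_sq T x \<ge> 0"
  by (simp add: block_sq_def sum_nonneg)

lemma block_sq_Basis: "block_sq Basis x = (norm x)\<^sup>2"
  by (simp add: block_sq_def norm_eq_sqrt_inner euclidean_inner[of x x] power2_eq_square sum_nonneg)

lemma block_sq_scaleR: "block_sq T (t *\<^sub>R x) = t\<^sup>2 * block_sq T x"
  by (simp add: block_sq_def power_mult_distrib sum_distrib_left)

lemma block_sq_borel[measurable]: "block_sq T \<in> borel_measurable borel"
  unfolding block_sq_def[abs_def] by measurable

lemma block_sq_split:
  assumes "S \<subseteq> Basis" shows "block_sq Basis x = block_sq (Basis - S) x + block_sq S x"
  unfolding block_sq_def using assms by (intro sum.subset_diff) auto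

text \<open>The functions \<open>f1\<close> and \<open>f2\<close> are the first and second derivatives of \<open>f\<close> in the direction \<open>v\<close>. The
bounds are those that a smooth homogeneous function of degree \<open>k\<close> satisfies away from the origin; in
contrast to homogeneity together with compactness of the sphere, they pass directly to products and powers.\<close>

definition symbol_bounds ::
  "real \<Rightarrow> ('a::euclidean_space \<Rightarrow> real) \<Rightarrow> real \<Rightarrow> ('a \<Rightarrow> 'a \<Rightarrow> real) \<Rightarrow> ('a \<Rightarrow> 'a \<Rightarrow> real) \<Rightarrow> bool" where
  "symbol_bounds k f C f1 f2 \<longleftrightarrow> C \<ge> 0 \<and> (\<forall>x v. x \<noteq> 0 \<longrightarrow>
     \<bar>f x\<bar> \<le> C * norm x powr k \<and>
     ((\<lambda>t. f (x + t *\<^sub>R v)) has_real_derivative f1 x v) (at 0) \<and>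
     \<bar>f1 x v\<bar> \<le> C * norm x powr (k - 1) * norm v \<and>
     ((\<lambda>t. f1 (x + t *\<^sub>R v) v) has_real_derivative f2 x v) (at 0) \<and>
     \<bar>f2 x v\<bar> \<le> C * norm x powr (k - 2) * (norm v)\<^sup>2)"

definition symbol_of_order :: "real \<Rightarrow> ('a::euclidean_space \<Rightarrow> real) \<Rightarrow> bool" where
  "symbol_of_order k f \<longleftrightarrow> (\<exists>C f1 f2. symbol_bounds k f C f1 f2)"

lemma symbol_boundsD:
  assumes "symbol_bounds k f C f1 f2"
  shows "C \<ge> 0" "\<And>x. x \<noteq> 0 \<Longrightarrow> \<bar>f x\<bar> \<le> C * norm x powr k"
    "\<And>x v. x \<noteq> 0 \<Longrightarrow> ((\<lambda>t. f (x + t *\<^sub>R v)) has_real_derivative f1 x v) (at 0)"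
    "\<And>x v. x \<noteq> 0 \<Longrightarrow> \<bar>f1 x v\<bar> \<le> C * norm x powr (k - 1) * norm v"
    "\<And>x v. x \<noteq> 0 \<Longrightarrow> ((\<lambda>t. f1 (x + t *\<^sub>R v) v) has_real_derivative f2 x v) (at 0)"
    "\<And>x v. x \<noteq> 0 \<Longrightarrow> \<bar>f2 x v\<bar> \<le> C * norm x powr (k - 2) * (norm v)\<^sup>2"
  using assms unfolding symbol_bounds_def by blast+

lemma symbol_of_orderI:
  assumes "C \<ge> 0" "\<And>x. x \<noteq> 0 \<Longrightarrow> \<bar>f x\<bar> \<le> C * norm x powr k"
    "\<And>x v. x \<noteq> 0 \<Longrightarrow> ((\<lambda>t. f (x + t *\<^sub>R v)) has_real_derivative f1 x v) (at 0)"
    "\<And>x v. x \<noteq> 0 \<Longrightarrow> \<bar>f1 x v\<bar> \<le> C * norm x powr (k - 1) * norm v"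
    "\<And>x v. x \<noteq> 0 \<Longrightarrow> ((\<lambda>t. f1 (x + t *\<^sub>R v) v) has_real_derivative f2 x v) (at 0)"
    "\<And>x v. x \<noteq> 0 \<Longrightarrow> \<bar>f2 x v\<bar> \<le> C * norm x powr (k - 2) * (norm v)\<^sup>2"
  shows "symbol_of_order k f"
  unfolding symbol_of_order_def symbol_bounds_def using assms by (intro exI[of _ C] exI[of _ f1] exI[of _ f2]) auto

lemma symbol_const: "symbol_of_order 0 (\<lambda>_. c)"
  by (rule symbol_of_orderI[of "\<bar>c\<bar>" _ _ "\<lambda>_ _. 0" "\<lambda>_ _. 0"]) auto

lemma symbol_inner: "symbol_of_order 1 (\<lambda>x. x \<bullet> b)"
proof (rule symbol_of_orderI[of "norm b" _ _ "\<lambda>_ v. v \<bullet> b" "\<lambda>_ _. 0"])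
  fix x v :: 'a assume "x \<noteq> 0"
  show "\<bar>x \<bullet> b\<bar> \<le> norm b * norm x powr 1" using Cauchy_Schwarz_ineq2[of x b] by (simp add: mult.commute)
  show "\<bar>v \<bullet> b\<bar> \<le> norm b * norm x powr (1 - 1) * norm v"
    using Cauchy_Schwarz_ineq2[of v b] \<open>x \<noteq> 0\<close> by (simp add: mult.commute)
qed (auto intro!: derivative_eq_intros simp: inner_add_left)

lemma symbol_add: 
  assumes f: "symbol_of_order k f" and g: "symbol_of_order k g" shows "symbol_of_order k (\<lambda>x. f x + g x)"
proof -
  from f obtain C f1 f2 where "symbol_bounds k f C f1 f2" unfolding symbol_of_order_def by blast
  note F = symbol_boundsD[OF this]
  from g obtain D g1 g2 where "symbol_bounds k g D g1 g2" unfolding symbol_of_order_def by blast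
  note G = symbol_boundsD[OF this]
  show ?thesis
  proof (rule symbol_of_orderI[of "C + D" _ _ "\<lambda>x v. f1 x v + g1 x v" "\<lambda>x v. f2 x v + g2 x v"])
    fix x v :: 'a assume x: "x \<noteq> 0"
    show "\<bar>f x + g x\<bar> \<le> (C + D) * norm x powr k"
      using F(2)[OF x] G(2)[OF x] by (simp add: distrib_right)
    show "\<bar>f1 x v + g1 x v\<bar> \<le> (C + D) * norm x powr (k - 1) * norm v"
      using F(4)[OF x, of v] G(4)[OF x, of v] by (simp add: distrib_right)
    show "\<bar>f2 x v + g2 x v\<bar> \<le> (C + D) * norm x powr (k - 2) * (norm v)\<^sup>2"
      using F(6)[OF x, of v] G(6)[OF x, of v] by (simp add: distrib_right)
  qed (use F(1) G(1) in \<open>auto intro!: DERIV_add F G\<close>)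
qed

lemma symbol_mult: 
  assumes f: "symbol_of_order k f" and g: "symbol_of_order l g" shows "symbol_of_order (k + l) (\<lambda>x. f x * g x)"
proof -
  from f obtain C f1 f2 where "symbol_bounds k f C f1 f2" unfolding symbol_of_order_def by blast
  note F = symbol_boundsD[OF this]
  from g obtain D g1 g2 where "symbol_bounds l g D g1 g2" unfolding symbol_of_order_def by blast
  note G = symbol_boundsD[OF this]
  show ?thesis
  proof (rule symbol_of_orderI[of "4 * (C * D)" _ _ "\<lambda>x v. f1 x v * g x + f x * g1 x v"
        "\<lambda>x v. f2 x v * g x + 2 * (f1 x v * g1 x v) + f x * g2 x v"])
    show "0 \<le> 4 * (C * D)" using F(1) G(1) by simp
    fix x v :: 'a assume x: "x \<noteq> 0"
    have CD: "C * D \<ge> 0" using F(1) G(1) by simp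
    have m: "\<bar>a * b\<bar> \<le> (C * norm x powr i * s) * (D * norm x powr j * t)"
      if "\<bar>a\<bar> \<le> C * norm x powr i * s" "\<bar>b\<bar> \<le> D * norm x powr j * t" for a b i j s t
      unfolding abs_mult using that by (intro mult_mono) auto
    have m': "\<bar>a * b\<bar> \<le> C * D * norm x powr (i + j) * (s * t)"
      if "\<bar>a\<bar> \<le> C * norm x powr i * s" "\<bar>b\<bar> \<le> D * norm x powr j * t" for a b i j s t
      using m[OF that] by (simp add: powr_add mult_ac)
    have "\<bar>f x * g x\<bar> \<le> C * D * norm x powr (k + l) * (1 * 1)"
      by (rule m') (use F(2)[OF x] G(2)[OF x] in auto)
    moreover have "0 \<le> C * D * norm x powr (k + l)" using CD by simp
    ultimately show "\<bar>f x * g x\<bar> \<le> 4 * (C * D) * norm x powr (k + l)" by linarith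
    have "\<bar>f1 x v * g x\<bar> \<le> C * D * norm x powr ((k - 1) + l) * (norm v * 1)"
      by (rule m') (use F(4)[OF x, of v] G(2)[OF x] in auto)
    moreover have "\<bar>f x * g1 x v\<bar> \<le> C * D * norm x powr (k + (l - 1)) * (1 * norm v)"
      by (rule m') (use F(2)[OF x] G(4)[OF x, of v] in auto)
    moreover have "(k - 1) + l = k + l - 1" "k + (l - 1) = k + l - 1" by auto
    moreover have "0 \<le> C * D * norm x powr (k + l - 1) * norm v" using CD by simp
    ultimately show "\<bar>f1 x v * g x + f x * g1 x v\<bar> \<le> 4 * (C * D) * norm x powr (k + l - 1) * norm v"
      unfolding mult.assoc[of 4] by (simp only: mult_1_right mult_1_left, linarith?)
    have "\<bar>f2 x v * g x\<bar> \<le> C * D * norm x powr ((k - 2) + l) * ((norm v)\<^sup>2 * 1)"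
      by (rule m') (use F(6)[OF x, of v] G(2)[OF x] in auto)
    moreover have "\<bar>f x * g2 x v\<bar> \<le> C * D * norm x powr (k + (l - 2)) * (1 * (norm v)\<^sup>2)"
      by (rule m') (use F(2)[OF x] G(6)[OF x, of v] in auto)
    moreover have "\<bar>f1 x v * g1 x v\<bar> \<le> C * D * norm x powr ((k - 1) + (l - 1)) * (norm v * norm v)"
      by (rule m') (use F(4)[OF x, of v] G(4)[OF x, of v] in auto)
    moreover have "(k - 2) + l = k + l - 2" "k + (l - 2) = k + l - 2" "(k - 1) + (l - 1) = k + l - 2" by auto
    ultimately show "\<bar>f2 x v * g x + 2 * (f1 x v * g1 x v) + f x * g2 x v\<bar> \<le> 4 * (C * D) * norm x powr (k + l - 2) * (norm v)\<^sup>2"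
      unfolding mult.assoc[of 4] power2_eq_square by (simp only: mult_1_right mult_1_left, linarith?)
    show "((\<lambda>t. f (x + t *\<^sub>R v) * g (x + t *\<^sub>R v)) has_real_derivative f1 x v * g x + f x * g1 x v) (at 0)"
      using DERIV_mult[OF F(3)[OF x, of v] G(3)[OF x, of v]] by (simp add: mult.commute)
    show "((\<lambda>t. f1 (x + t *\<^sub>R v) v * g (x + t *\<^sub>R v) + f (x + t *\<^sub>R v) * g1 (x + t *\<^sub>R v) v) has_real_derivative
         f2 x v * g x + 2 * (f1 x v * g1 x v) + f x * g2 x v) (at 0)"
      using DERIV_add[OF DERIV_mult[OF F(5)[OF x, of v] G(3)[OF x, of v]] DERIV_mult[OF F(3)[OF x, of v] G(5)[OF x, of v]]]
      by (simp add: algebra_simps)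
  qed
qed

lemma symbol_cmult: "symbol_of_order k f \<Longrightarrow> symbol_of_order k (\<lambda>x. c * f x)"
  using symbol_mult[OF symbol_const[of c], of k f] by simp

text \<open>The lower bound on \<open>f\<close> makes \<open>f powr q\<close> comparable to \<open>norm x powr (k * q)\<close> for every real \<open>q\<close>.\<close>

lemma symbol_powr:
  assumes f: "symbol_of_order k f" and c: "c > 0" and lower: "\<And>x. x \<noteq> 0 \<Longrightarrow> f x \<ge> c * norm x powr k"
  shows "symbol_of_order (k * p) (\<lambda>x. f x powr p)"
proof -
  from f obtain C f1 f2 where "symbol_bounds k f C f1 f2" unfolding symbol_of_order_def by blast
  note F = symbol_boundsD[OF this]
  define m where "m q = max (c powr q) (C powr q)" for q
  have m0: "m q \<ge> 0" for q by (simp add: m_def le_max_iff_disj)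
  have pos: "f x > 0" if "x \<noteq> 0" for x
    using lower[OF that] c that by (smt (verit) mult_pos_pos powr_gt_zero norm_eq_zero)
  have C: "C > 0" 
  proof -
    obtain x :: 'a where x: "x \<noteq> 0" using nonzero_Basis nonempty_Basis by blast
    show ?thesis using pos[OF x] F(1) F(2)[OF x] by (cases "C = 0") auto
  qed
  have pw: "\<bar>f x powr q\<bar> \<le> m q * norm x powr (k * q)" if x: "x \<noteq> 0" for x q
  proof (cases "q \<ge> 0")
    case True
    have "f x powr q \<le> (C * norm x powr k) powr q"
      using pos[OF x] F(2)[OF x] True by (intro powr_mono2) auto
    also have "\<dots> = C powr q * norm x powr (k * q)" using C by (simp add: powr_mult powr_powr)
    also have "\<dots> \<le> m q * norm x powr (k * q)" by (intro mult_right_mono) (auto simp: m_def)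
    finally show ?thesis by simp
  next
    case False
    have "f x powr q \<le> (c * norm x powr k) powr q"
      using lower[OF x] c x False by (intro powr_mono2') auto
    also have "\<dots> = c powr q * norm x powr (k * q)" using c by (simp add: powr_mult powr_powr)
    also have "\<dots> \<le> m q * norm x powr (k * q)" by (intro mult_right_mono) (auto simp: m_def)
    finally show ?thesis by simp
  qed
  let ?K = "m p + \<bar>p\<bar> * m (p - 1) * C + \<bar>p * (p - 1)\<bar> * m (p - 2) * C * C"
  show ?thesis
  proof (rule symbol_of_orderI[of ?K _ _ "\<lambda>x v. p * f x powr (p - 1) * f1 x v"
        "\<lambda>x v. p * (p - 1) * f x powr (p - 2) * f1 x v * f1 x v + p * f x powr (p - 1) * f2 x v"])
    have n: "\<bar>p\<bar> * m (p - 1) * C \<ge> 0" "\<bar>p * (p - 1)\<bar> * m (p - 2) * C * C \<ge> 0"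
      using m0 C by (auto intro!: mult_nonneg_nonneg)
    show "0 \<le> ?K" using m0 n by (auto intro!: add_nonneg_nonneg)
    fix x v :: 'a assume x: "x \<noteq> 0"
    have "m p * norm x powr (k * p) \<le> ?K * norm x powr (k * p)"
      using n by (intro mult_right_mono) auto
    then show "\<bar>f x powr p\<bar> \<le> ?K * norm x powr (k * p)" using pw[OF x, of p] by linarith
    have "\<bar>p * f x powr (p - 1) * f1 x v\<bar> = \<bar>p\<bar> * \<bar>f x powr (p - 1)\<bar> * \<bar>f1 x v\<bar>" by (simp add: abs_mult)
    also have "\<dots> \<le> \<bar>p\<bar> * (m (p - 1) * norm x powr (k * (p - 1))) * (C * norm x powr (k - 1) * norm v)"
      by (intro mult_mono mult_left_mono pw x F) (use m0 in auto)
    also have "\<dots> = \<bar>p\<bar> * m (p - 1) * C * norm x powr (k * (p - 1) + (k - 1)) * norm v"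
      by (simp only: powr_add mult_ac)
    also have "k * (p - 1) + (k - 1) = k * p - 1" by (simp add: algebra_simps)
    also have "\<bar>p\<bar> * m (p - 1) * C * norm x powr (k * p - 1) * norm v \<le> ?K * norm x powr (k * p - 1) * norm v"
      using n m0 by (intro mult_right_mono) auto
    finally show "\<bar>p * f x powr (p - 1) * f1 x v\<bar> \<le> ?K * norm x powr (k * p - 1) * norm v" .
    have "\<bar>p * (p - 1) * f x powr (p - 2) * f1 x v * f1 x v\<bar> = \<bar>p * (p - 1)\<bar> * \<bar>f x powr (p - 2)\<bar> * \<bar>f1 x v\<bar> * \<bar>f1 x v\<bar>"
      by (simp add: abs_mult)
    also have "\<dots> \<le> \<bar>p * (p - 1)\<bar> * (m (p - 2) * norm x powr (k * (p - 2))) * (C * norm x powr (k - 1) * norm v) * (C * norm x powr (k - 1) * norm v)"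
      by (intro mult_mono mult_left_mono pw x F) (use m0 C in auto)
    also have "\<dots> = \<bar>p * (p - 1)\<bar> * m (p - 2) * C * C * norm x powr (k * (p - 2) + (k - 1) + (k - 1)) * (norm v)\<^sup>2"
      by (simp only: powr_add mult_ac power2_eq_square)
    also have "k * (p - 2) + (k - 1) + (k - 1) = k * p - 2" by (simp add: algebra_simps)
    finally have 1: "\<bar>p * (p - 1) * f x powr (p - 2) * f1 x v * f1 x v\<bar> \<le> \<bar>p * (p - 1)\<bar> * m (p - 2) * C * C * (norm x powr (k * p - 2) * (norm v)\<^sup>2)"
      by (simp only: mult.assoc)
    have "\<bar>p * f x powr (p - 1) * f2 x v\<bar> = \<bar>p\<bar> * \<bar>f x powr (p - 1)\<bar> * \<bar>f2 x v\<bar>" by (simp add: abs_mult)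
    also have "\<dots> \<le> \<bar>p\<bar> * (m (p - 1) * norm x powr (k * (p - 1))) * (C * norm x powr (k - 2) * (norm v)\<^sup>2)"
      by (intro mult_mono mult_left_mono pw x F) (use m0 in auto)
    also have "\<dots> = \<bar>p\<bar> * m (p - 1) * C * norm x powr (k * (p - 1) + (k - 2)) * (norm v)\<^sup>2"
      by (simp only: powr_add mult_ac)
    also have "k * (p - 1) + (k - 2) = k * p - 2" by (simp add: algebra_simps)
    finally have 2: "\<bar>p * f x powr (p - 1) * f2 x v\<bar> \<le> \<bar>p\<bar> * m (p - 1) * C * (norm x powr (k * p - 2) * (norm v)\<^sup>2)"
      by (simp only: mult.assoc)
    have "\<bar>p * (p - 1) * f x powr (p - 2) * f1 x v * f1 x v + p * f x powr (p - 1) * f2 x v\<bar>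
      \<le> (\<bar>p\<bar> * m (p - 1) * C + \<bar>p * (p - 1)\<bar> * m (p - 2) * C * C) * (norm x powr (k * p - 2) * (norm v)\<^sup>2)"
      using 1 2 by (simp only: distrib_right, linarith?)
    also have "\<dots> \<le> ?K * (norm x powr (k * p - 2) * (norm v)\<^sup>2)"
      using m0 by (intro mult_right_mono) auto
    finally show "\<bar>p * (p - 1) * f x powr (p - 2) * f1 x v * f1 x v + p * f x powr (p - 1) * f2 x v\<bar>
      \<le> ?K * norm x powr (k * p - 2) * (norm v)\<^sup>2" by (simp only: mult.assoc)
    have D: "((\<lambda>t. f (x + t *\<^sub>R v) powr q) has_real_derivative q * f x powr (q - 1) * f1 x v) (at 0)" for q
      using DERIV_chain2[where f="\<lambda>y. y powr q" and g="\<lambda>t. f (x + t *\<^sub>R v)" and x=0, 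
          OF _ F(3)[OF x, of v]] has_real_derivative_powr[of "f x" q] pos[OF x] by simp
    show "((\<lambda>t. f (x + t *\<^sub>R v) powr p) has_real_derivative p * f x powr (p - 1) * f1 x v) (at 0)" by (rule D)
    show "((\<lambda>t. p * f (x + t *\<^sub>R v) powr (p - 1) * f1 (x + t *\<^sub>R v) v) has_real_derivative
         p * (p - 1) * f x powr (p - 2) * f1 x v * f1 x v + p * f x powr (p - 1) * f2 x v) (at 0)"
      using DERIV_mult[OF DERIV_cmult[OF D[of "p - 1"], of p] F(5)[OF x, of v]]
      by (simp add: algebra_simps)
  qed
qed

lemma symbol_block_sq: "symbol_of_order 2 (block_sq T :: 'a::euclidean_space \<Rightarrow> real)"
proof -
  have z: "symbol_of_order 2 (\<lambda>_::'a. 0::real)" by (rule symbol_of_orderI[of 0 _ _ "\<lambda>_ _. 0" "\<lambda>_ _. 0"]) auto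
  have s: "symbol_of_order 2 (\<lambda>x. (x \<bullet> j)\<^sup>2)" for j :: 'a
    using symbol_mult[OF symbol_inner[of j] symbol_inner[of j]] by (simp add: power2_eq_square)
  have "symbol_of_order 2 (\<lambda>x. \<Sum>j\<in>T. (x \<bullet> j)\<^sup>2)"
    by (induction T rule: infinite_finite_induct) (auto simp: z intro!: symbol_add s)
  then show ?thesis by (simp add: block_sq_def[abs_def])
qed

lemma DERIV_along_line:
  fixes x v :: "'a::real_vector"
  assumes "((\<lambda>s. f (x + t *\<^sub>R v + s *\<^sub>R v)) has_real_derivative D) (at 0)"
  shows "((\<lambda>s. f (x + s *\<^sub>R v)) has_real_derivative D) (at t)"
proof -
  have "((\<lambda>s. f (x + t *\<^sub>R v + (s + - t) *\<^sub>R v)) has_real_derivative D) (at t)"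
    using assms iffD1[OF DERIV_shift[where f="\<lambda>s. f (x + t *\<^sub>R v + s *\<^sub>R v)" and x=t and z="- t" and y=D]]
    by simp
  moreover have "x + t *\<^sub>R v + (s + - t) *\<^sub>R v = x + s *\<^sub>R v" for s by (simp add: algebra_simps)
  ultimately show ?thesis by (simp add: add.assoc)
qed

text \<open>A homogeneous function of this kind may fail to be differentiable at the origin. Segments that
avoid the origin are handled by the second derivative, and segments through it by star-shapedness.\<close>

lemma convex_sublevel_away_from_zero:
  fixes f :: "'a::euclidean_space \<Rightarrow> real"
  assumes d1: "\<And>x v. x \<noteq> 0 \<Longrightarrow> ((\<lambda>t. f (x + t *\<^sub>R v)) has_real_derivative f1 x v) (at 0)"
    and d2: "\<And>x v. x \<noteq> 0 \<Longrightarrow> ((\<lambda>t. f1 (x + t *\<^sub>R v) v) has_real_derivative f2 x v) (at 0)"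
    and f2: "\<And>x v. x \<noteq> 0 \<Longrightarrow> f2 x v \<ge> 0"
    and star: "\<And>x s. f x \<le> 1 \<Longrightarrow> 0 \<le> s \<Longrightarrow> s \<le> 1 \<Longrightarrow> f (s *\<^sub>R x) \<le> 1"
  shows "convex {x. f x \<le> 1}"
  unfolding convex_contains_segment
proof (intro ballI subsetI)
  fix x y z assume x: "x \<in> {x. f x \<le> 1}" and y: "y \<in> {x. f x \<le> 1}" and z: "z \<in> closed_segment x y"
  show "z \<in> {x. f x \<le> 1}"
  proof (cases "0 \<in> closed_segment x y")
    case True
    then have "z \<in> closed_segment 0 x \<or> z \<in> closed_segment 0 y"
      using z Un_closed_segment[OF True] by (auto simp: closed_segment_commute)
    then show ?thesis using star x y by (auto simp: closed_segment_def)
  next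
    case False
    let ?v = "y - x"
    obtain u where u: "0 \<le> u" "u \<le> 1" "z = x + u *\<^sub>R ?v"
      using z by (auto simp: closed_segment_def algebra_simps)
    have nz: "x + t *\<^sub>R ?v \<noteq> 0" if "t \<in> {0..1}" for t
    proof
      assume "x + t *\<^sub>R ?v = 0"
      then have "0 = (1 - t) *\<^sub>R x + t *\<^sub>R y" by (simp add: algebra_simps)
      then show False using False that unfolding closed_segment_def by auto
    qed
    have "convex_on {0..1} (\<lambda>t. f (x + t *\<^sub>R ?v))"
    proof (rule f''_ge0_imp_convex)
      show "((\<lambda>t. f (x + t *\<^sub>R ?v)) has_real_derivative f1 (x + t *\<^sub>R ?v) ?v) (at t)" if "t \<in> {0..1}" for t
        by (rule DERIV_along_line) (rule d1[OF nz[OF that]])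
      show "((\<lambda>t. f1 (x + t *\<^sub>R ?v) ?v) has_real_derivative f2 (x + t *\<^sub>R ?v) ?v) (at t)" if "t \<in> {0..1}" for t
        by (rule DERIV_along_line[where f="\<lambda>x. f1 x ?v"]) (rule d2[OF nz[OF that]])
      show "f2 (x + t *\<^sub>R ?v) ?v \<ge> 0" if "t \<in> {0..1}" for t using f2[OF nz[OF that]] .
    qed simp
    from convex_onD[OF this, of u 0 1] u have "f z \<le> (1 - u) * f x + u * f y" by simp
    also have "\<dots> \<le> (1 - u) * 1 + u * 1" using u x y by (intro add_mono mult_left_mono) auto
    finally show ?thesis by simp
  qed
qed

lemma DERIV_block_sq_line: "((\<lambda>t. block_sq T (x + t *\<^sub>R v)) has_real_derivative 2 * (\<Sum>j\<in>T. (x \<bullet> j) * (v \<bullet> j))) (at 0)"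
  unfolding block_sq_def sum_distrib_left
  by (auto intro!: derivative_eq_intros sum.cong simp: inner_add_left mult_ac)

lemma DERIV_block_sq_line': "((\<lambda>t. \<Sum>j\<in>T. ((x + t *\<^sub>R v) \<bullet> j) * (v \<bullet> j)) has_real_derivative block_sq T v) (at 0)"
  unfolding block_sq_def
  by (auto intro!: derivative_eq_intros sum.cong simp: inner_add_left power2_eq_square)

text \<open>Along a line with direction \<open>v\<close> the term \<open>\<eta> |x|^4\<close> contributes at least \<open>4 \<eta> |x|^2 |v|^2\<close> to the second
derivative and the other two quartics are convex, which leaves room for a small multiple of any
function of order 4.\<close>

lemma convex_quartic_perturbation:
  fixes q :: "'a::euclidean_space \<Rightarrow> real"
  assumes q: "symbol_of_order 4 q" and eta: "\<eta> > 0"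
    and qh: "\<And>t x. 0 \<le> t \<Longrightarrow> q (t *\<^sub>R x) = t ^ 4 * q x"
  shows "\<exists>\<epsilon>0>0. \<forall>\<epsilon>. \<bar>\<epsilon>\<bar> \<le> \<epsilon>0 \<longrightarrow>
    convex {x. (block_sq S x)\<^sup>2 + (block_sq T x)\<^sup>2 + \<eta> * (block_sq Basis x)\<^sup>2 + \<epsilon> * q x \<le> 1}"
proof -
  from q obtain C q1 q2 where "symbol_bounds 4 q C q1 q2" unfolding symbol_of_order_def by blast
  note Q = symbol_boundsD[OF this]
  define b where "b T x v = (\<Sum>j\<in>T. (x \<bullet> j) * (v \<bullet> j))" for T and x v :: 'a
  define s1 where "s1 T x v = 4 * block_sq T x * b T x v" for T and x v :: 'a
  define s2 where "s2 T x v = 8 * (b T x v)\<^sup>2 + 4 * block_sq T x * block_sq T v" for T and x v :: 'a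
  have bD: "((\<lambda>t. block_sq T (x + t *\<^sub>R v)) has_real_derivative 2 * b T x v) (at 0)"
    "((\<lambda>t. b T (x + t *\<^sub>R v) v) has_real_derivative block_sq T v) (at 0)" for T and x v :: 'a
    unfolding b_def by (rule DERIV_block_sq_line, rule DERIV_block_sq_line')
  have sD1: "((\<lambda>t. (block_sq T (x + t *\<^sub>R v))\<^sup>2) has_real_derivative s1 T x v) (at 0)" for T and x v :: 'a
    using DERIV_mult[OF bD(1)[of T x v] bD(1)[of T x v]] by (simp add: s1_def power2_eq_square algebra_simps)
  have sD2: "((\<lambda>t. s1 T (x + t *\<^sub>R v) v) has_real_derivative s2 T x v) (at 0)" for T and x v :: 'a
    unfolding s1_def using DERIV_cmult[OF DERIV_mult[OF bD(1)[of T x v] bD(2)[of T x v]], of 4]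
    by (simp add: s2_def power2_eq_square algebra_simps)
  have s2: "s2 T x v \<ge> 4 * block_sq T x * block_sq T v" "s2 T x v \<ge> 0" for T and x v :: 'a
    by (auto simp: s2_def)
  \<comment> \<open>\<open>C + 1\<close> instead of \<open>C\<close>, which may be zero\<close>
  define \<epsilon>0 where "\<epsilon>0 = 4 * \<eta> / (C + 1)"
  have e0: "\<epsilon>0 > 0" "\<epsilon>0 * C \<le> 4 * \<eta>" using eta Q(1) by (auto simp: \<epsilon>0_def field_simps)
  show ?thesis
  proof (intro exI[of _ \<epsilon>0] conjI allI impI e0)
    fix \<epsilon> :: real assume eps: "\<bar>\<epsilon>\<bar> \<le> \<epsilon>0"
    let ?f = "\<lambda>x. (block_sq S x)\<^sup>2 + (block_sq T x)\<^sup>2 + \<eta> * (block_sq Basis x)\<^sup>2 + \<epsilon> * q x"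
    let ?f1 = "\<lambda>x v. s1 S x v + s1 T x v + \<eta> * s1 Basis x v + \<epsilon> * q1 x v"
    let ?f2 = "\<lambda>x v. s2 S x v + s2 T x v + \<eta> * s2 Basis x v + \<epsilon> * q2 x v"
    show "convex {x. ?f x \<le> 1}"
    proof (rule convex_sublevel_away_from_zero[where ?f1.0="?f1" and ?f2.0="?f2"])
      fix x v :: 'a assume x: "x \<noteq> 0"
      show "((\<lambda>t. ?f (x + t *\<^sub>R v)) has_real_derivative ?f1 x v) (at 0)"
        by (intro DERIV_add DERIV_cmult sD1 Q x)
      show "((\<lambda>t. ?f1 (x + t *\<^sub>R v) v) has_real_derivative ?f2 x v) (at 0)"
        by (intro DERIV_add DERIV_cmult sD2 Q x)
      have "\<bar>\<epsilon> * q2 x v\<bar> \<le> \<epsilon>0 * (C * norm x powr (4 - 2) * (norm v)\<^sup>2)"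
        unfolding abs_mult using eps Q(6)[OF x, of v] e0 by (intro mult_mono) auto
      also have "\<dots> = \<epsilon>0 * C * ((norm x)\<^sup>2 * (norm v)\<^sup>2)"
        using x by (simp add: powr_numeral)
      also have "\<dots> \<le> 4 * \<eta> * ((norm x)\<^sup>2 * (norm v)\<^sup>2)"
        using e0 by (intro mult_right_mono) auto
      also have "\<dots> = \<eta> * (4 * block_sq Basis x * block_sq Basis v)" by (simp add: block_sq_Basis)
      also have "\<dots> \<le> \<eta> * s2 Basis x v" using eta s2(1)[where T=Basis] by (intro mult_left_mono) auto
      finally show "?f2 x v \<ge> 0" using s2(2)[of S x v] s2(2)[of T x v] by linarith
    next
      fix x and s :: real assume x: "?f x \<le> 1" and s: "0 \<le> s" "s \<le> 1"
      have "?f (s *\<^sub>R x) = s ^ 4 * ?f x"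
        by (simp add: block_sq_scaleR qh[OF s(1)] algebra_simps power_mult_distrib)
      also have "\<dots> \<le> s ^ 4 * 1" using x s by (intro mult_left_mono) auto
      also have "\<dots> \<le> 1" using s by (simp add: power_le_one)
      finally show "?f (s *\<^sub>R x) \<le> 1" .
    qed
  qed
qed

section \<open>Bodies given by quartic gauges\<close>

text \<open>The radial function of the sublevel set of a quartic gauge \<open>W\<close> is \<open>W powr (-1/4)\<close>.\<close>

lemma sublevel_body:
  fixes W :: "'a::euclidean_space \<Rightarrow> real"
  assumes c: "c > 0" and lower: "\<And>x. W x \<ge> c * (norm x) ^ 4" and upper: "\<And>x. \<bar>W x\<bar> \<le> C * (norm x) ^ 4"
    and hom: "\<And>t x. 0 \<le> t \<Longrightarrow> W (t *\<^sub>R x) = t ^ 4 * W x"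
    and Ck: "\<And>k. C_k_on k W (- {0})" and conv: "convex {x. W x \<le> 1}"
  shows "infinitely_smooth_body {x. W x \<le> 1}" "convex_body {x. W x \<le> 1}"
proof -
  have pos: "W x > 0" if "x \<noteq> 0" for x using lower[of x] c that by (smt (verit) mult_pos_pos zero_less_norm_iff zero_less_power)
  have W0: "W 0 = 0" using upper[of 0] by simp
  have rad: "radial {x. W x \<le> 1} \<theta> = W \<theta> powr (- 1 / 4)" if \<theta>: "\<theta> \<noteq> 0" for \<theta>
  proof -
    let ?r = "W \<theta> powr (- 1 / 4)"
    have r4: "?r ^ 4 * W \<theta> = 1"
    proof -
      have "?r ^ 4 = ?r powr real 4" by (rule powr_realpow[symmetric]) (use pos[OF \<theta>] in simp)
      also have "\<dots> = W \<theta> powr (- 1)" by (simp only: powr_powr) simp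
      also have "\<dots> = 1 / W \<theta>" using pos[OF \<theta>] by (simp add: powr_minus_divide)
      finally show ?thesis using pos[OF \<theta>] by simp
    qed
    have "{l. 0 \<le> l \<and> l *\<^sub>R \<theta> \<in> {x. W x \<le> 1}} = {0..?r}"
    proof (rule set_eqI)
      fix l :: real
      have "l ^ 4 * W \<theta> \<le> 1 \<longleftrightarrow> l \<le> ?r" if "l \<ge> 0"
      proof -
        have "l ^ 4 * W \<theta> \<le> 1 \<longleftrightarrow> l ^ 4 * W \<theta> \<le> ?r ^ 4 * W \<theta>" by (simp only: r4)
        also have "\<dots> \<longleftrightarrow> l ^ 4 \<le> ?r ^ 4" using pos[OF \<theta>] by simp
        also have "\<dots> \<longleftrightarrow> l \<le> ?r" using that by (simp add: power_mono_iff)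
        finally show ?thesis .
      qed
      then show "l \<in> {l. 0 \<le> l \<and> l *\<^sub>R \<theta> \<in> {x. W x \<le> 1}} \<longleftrightarrow> l \<in> {0..?r}" by (auto simp: hom)
    qed
    then show ?thesis unfolding radial_def by simp
  qed
  have "open (- {0::'a})" by auto
  then show "infinitely_smooth_body {x. W x \<le> 1}"
    unfolding infinitely_smooth_body_def C_infinity_on_def
    by (intro ballI exI[of _ "- {0}"] exI[of _ "\<lambda>x. W x powr (- 1 / 4)"])
       (auto intro!: C_k_on_powr Ck pos simp: rad)
  have "continuous_on (- {0}) W" using Ck[of 0] by simp
  then have c1: "isCont W x" if "x \<noteq> 0" for x
    using continuous_on_eq_continuous_at[OF \<open>open (- {0::'a})\<close>, of W] that by simp
  have c0: "isCont W 0"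
    unfolding isCont_def W0
  proof (rule Lim_null_comparison)
    show "\<forall>\<^sub>F x in at 0. norm (W x) \<le> C * (norm x) ^ 4" using upper by simp
    show "((\<lambda>x::'a. C * (norm x) ^ 4) \<longlongrightarrow> 0) (at 0)"
      by (auto intro!: tendsto_eq_intros)
  qed
  have "isCont W x" for x using c0 c1 by (cases "x = 0") auto
  then have cont: "continuous_on UNIV W" by (simp add: continuous_at_imp_continuous_on)
  have "closed {x. W x \<le> 1}" using cont by (intro closed_Collect_le) auto
  moreover have "bounded {x. W x \<le> 1}"
  proof (rule boundedI)
    fix x assume "x \<in> {x. W x \<le> 1}"
    then have "c * norm x ^ 4 \<le> 1" using lower[of x] by simp
    then have "norm x ^ 4 \<le> 1 / c" using c by (simp add: field_simps)
    moreover have "norm x \<le> 1 + norm x ^ 4"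
    proof (cases "norm x \<le> 1")
      case False
      then have "norm x ^ 1 \<le> norm x ^ 4" by (intro power_increasing) auto
      then show ?thesis by simp
    qed (simp add: add_increasing2)
    ultimately show "norm x \<le> 1 + 1 / c" by simp
  qed
  ultimately have "compact {x. W x \<le> 1}" by (simp add: compact_eq_bounded_closed)
  moreover have "interior {x. W x \<le> 1} \<noteq> {}"
  proof -
    have "open {x. W x < 1}" using cont by (intro open_Collect_less) auto
    then have "{x. W x < 1} \<subseteq> interior {x. W x \<le> 1}" by (intro interior_maximal) auto
    moreover have "0 \<in> {x. W x < 1}" by (simp add: W0)
    ultimately show ?thesis by auto
  qed
  ultimately show "convex_body {x. W x \<le> 1}" using conv by (simp add: convex_body_def)
qed

section \<open>Inequalities for real powers\<close>

text \<open>Bernoulli's inequality for negative exponents.\<close>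

lemma one_minus_powr_le:
  fixes a y :: real
  assumes "a \<ge> 0" "y > -1"
  shows "1 - a * y \<le> (1 + y) powr (- a)"
proof -
  have "ln (1 + y) \<le> y" using assms by (intro ln_add_one_self_le_self2) auto
  then have "1 - a * y \<le> 1 + (- a * ln (1 + y))" using assms by (simp add: mult_left_mono)
  also have "\<dots> \<le> exp (- a * ln (1 + y))" by (rule exp_ge_add_one_self)
  also have "\<dots> = (1 + y) powr (- a)" using assms by (simp add: powr_def)
  finally show ?thesis .
qed

text \<open>A quadratic upper bound to complement Bernoulli: the difference of the two sides is convex on the interval and
touches zero to first order at \<open>y = 0\<close>.\<close>

lemma powr_taylor_upper:
  fixes a :: real
  assumes a: "a > 0"
  obtains C where "C > 0" "\<And>y. \<bar>y\<bar> \<le> 1/2 \<Longrightarrow> (1 + y) powr (- a) \<le> 1 - a * y + C * y\<^sup>2"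
proof
  define C where "C = a * (a + 1) * (1/2) powr (- a - 2) / 2"
  show "C > 0" using a by (simp add: C_def)
  fix y :: real assume y: "\<bar>y\<bar> \<le> 1/2"
  let ?f = "\<lambda>y. 1 - a * y + C * y\<^sup>2 - (1 + y) powr (- a)"
  let ?f1 = "\<lambda>y. - a + 2 * C * y + a * (1 + y) powr (- a - 1)"
  let ?f2 = "\<lambda>y. 2 * C - a * (a + 1) * (1 + y) powr (- a - 2)"
  have P: "((\<lambda>y. (1 + y) powr q) has_real_derivative q * (1 + y) powr (q - 1)) (at y)" if "y \<in> {-1/2..1/2}" for q y
  proof -
    have "((\<lambda>z. z powr q) has_real_derivative q * (1 + y) powr (q - 1)) (at (1 + y))"
      using that by (intro has_real_derivative_powr) auto
    moreover have "((\<lambda>y. 1 + y) has_real_derivative 1) (at y)"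
      by (auto intro!: derivative_eq_intros)
    ultimately have "((\<lambda>y. (1 + y) powr q) has_real_derivative q * (1 + y) powr (q - 1) * 1) (at y)"
      by (rule DERIV_chain2[where f="\<lambda>z. z powr q" and g="\<lambda>y. 1 + y"])
    then show ?thesis by simp
  qed
  have d1: "(?f has_real_derivative ?f1 y) (at y)" if "y \<in> {-1/2..1/2}" for y
  proof -
    have "((\<lambda>y. 1 - a * y + C * y\<^sup>2) has_real_derivative - a + 2 * C * y) (at y)"
      by (auto intro!: derivative_eq_intros)
    from DERIV_diff[OF this P[OF that, of "- a"]] show ?thesis by simp
  qed
  have "convex_on {-1/2..1/2} ?f"
  proof (rule f''_ge0_imp_convex)
    show "(?f has_real_derivative ?f1 y) (at y)" if "y \<in> {-1/2..1/2}" for y by (rule d1[OF that])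
    show "(?f1 has_real_derivative ?f2 y) (at y)" if "y \<in> {-1/2..1/2}" for y
    proof -
      have "((\<lambda>y. - a + 2 * C * y) has_real_derivative 2 * C) (at y)"
        by (auto intro!: derivative_eq_intros)
      from DERIV_add[OF this DERIV_cmult[OF P[OF that, of "- a - 1"], of a]] show ?thesis
        by (simp add: algebra_simps)
    qed
    show "?f2 y \<ge> 0" if "y \<in> {-1/2..1/2}" for y
    proof -
      have "(1 + y) powr (- a - 2) \<le> (1/2) powr (- a - 2)"
        using that a by (intro powr_mono2') auto
      then have "a * (a + 1) * (1 + y) powr (- a - 2) \<le> a * (a + 1) * (1/2) powr (- a - 2)"
        using a by (intro mult_left_mono) auto
      then show ?thesis by (simp add: C_def)
    qed
  qed simp
  then have "?f y - ?f 0 \<ge> ?f1 0 * (y - 0)"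
    by (rule convex_on_imp_above_tangent)
       (use y d1[of 0] in \<open>auto simp: interior_cbox[of "-1/2" "1/2::real", unfolded box_real] intro: connected_Icc has_field_derivative_at_within\<close>)
  then show "(1 + y) powr (- a) \<le> 1 - a * y + C * y\<^sup>2" by simp
qed

text \<open>This is the section transform of \<open>T\<close> as a function of \<open>x = m + \<tau>\<close>, multiplied by \<open>x powr e\<close> and up to the
constant \<open>c\<close>. The first term increases and the second decreases; the second wins because
\<open>x + m \<le> 2 x\<close> and \<open>k = 2 powr (e + 1)\<close>.\<close>

lemma ratio_powr_antimono:
  fixes e k m x y :: real
  assumes e: "e > 0" and m: "0 < m" "m \<le> 1" and k: "k = 2 powr (e + 1)" and xy: "m \<le> x" "x \<le> y"
  shows "(y / (y + (1 - m))) powr e + k / m * (1 - (y / (y + m)) powr e)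
       \<le> (x / (x + (1 - m))) powr e + k / m * (1 - (x / (x + m)) powr e)"
proof -
  let ?f = "\<lambda>h x. (x / (x + h)) powr e"
  let ?f1 = "\<lambda>h x. e * h * x powr (e - 1) * (x + h) powr (- e - 1)"
  have d: "(?f h has_real_derivative ?f1 h x) (at x)" if "x > 0" "h \<ge> 0" for x h :: real
  proof -
    have "(?f h has_real_derivative e * (x / (x + h)) powr (e - 1) * ((1 * (x + h) - x * 1) / ((x + h) * (x + h)))) (at x)"
      using that by (intro derivative_eq_intros DERIV_chain2[where f="\<lambda>y. y powr e"]) auto
    also have "e * (x / (x + h)) powr (e - 1) * ((1 * (x + h) - x * 1) / ((x + h) * (x + h))) = ?f1 h x"
    proof -
      have "- e - 1 = - ((e - 1) + 2)" by simp
      then have "(x + h) powr (- e - 1) = 1 / (x + h) powr ((e - 1) + 2)"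
        by (simp only: powr_minus_divide)
      also have "\<dots> = 1 / ((x + h) powr (e - 1) * ((x + h) * (x + h)))"
        using that by (simp only: powr_add) (simp add: power2_eq_square)
      finally show ?thesis using that by (simp add: powr_divide)
    qed
    finally show ?thesis .
  qed
  let ?F = "\<lambda>x. ?f (1 - m) x + k / m * (1 - ?f m x)"
  show ?thesis
  proof (rule DERIV_nonpos_imp_nonincreasing[OF xy(2)])
    fix z assume z: "x \<le> z" "z \<le> y"
    then have z0: "z > 0" "m \<le> z" using m xy by auto
    have D: "(?F has_real_derivative ?f1 (1 - m) z + k / m * (0 - ?f1 m z)) (at z)"
      by (intro DERIV_add DERIV_cmult DERIV_diff DERIV_const d) (use m z0 in auto)
    have "(1 - m) * (z + (1 - m)) powr (- e - 1) \<le> 1 * z powr (- e - 1)"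
      using m z0 e by (intro mult_mono powr_mono2') auto
    also have "\<dots> = k * (2 * z) powr (- e - 1)"
      using z0 by (simp add: k powr_mult powr_add[symmetric] mult.assoc[symmetric])
    also have "\<dots> \<le> k * (z + m) powr (- e - 1)"
      using m z0 e by (intro mult_left_mono powr_mono2') (auto simp: k)
    finally have *: "(1 - m) * (z + (1 - m)) powr (- e - 1) \<le> k * (z + m) powr (- e - 1)" .
    have "?f1 (1 - m) z + k / m * (0 - ?f1 m z)
       = e * z powr (e - 1) * ((1 - m) * (z + (1 - m)) powr (- e - 1) - k * (z + m) powr (- e - 1))"
      using m by (simp add: field_simps)
    also have "\<dots> \<le> 0" using * e by (intro mult_nonneg_nonpos) auto
    finally show "\<exists>d. (?F has_real_derivative d) (at z) \<and> d \<le> 0" using D by blast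
  qed
qed

text \<open>The constant \<open>c\<close> is the one for which the expression at \<open>\<tau> = 1\<close> equals \<open>\<delta> * (1 + m) powr -e\<close>, where
\<open>\<delta>\<close> can be chosen as small as needed.\<close>

lemma section_transform_lower_bound:
  fixes e k m c \<tau> \<delta> :: real
  assumes e: "e > 0" and m: "0 < m" "m \<le> 1" and k: "k = 2 powr (e + 1)" and t: "0 \<le> \<tau>" "\<tau> \<le> 1"
    and d: "\<delta> > 0"
    and c: "c = ((1 + m) / 2) powr e + k / m * (1 - ((1 + m) / (1 + 2 * m)) powr e) - \<delta>"
  shows "(1 + \<tau>) powr (- e) - c * (m + \<tau>) powr (- e) + k / m * ((m + \<tau>) powr (- e) - (2 * m + \<tau>) powr (- e))
       \<ge> \<delta> * 2 powr (- e)"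
proof -
  let ?x = "\<tau> + m"
  let ?b = "\<lambda>x. (x / (x + (1 - m))) powr e + k / m * (1 - (x / (x + m)) powr e)"
  have x: "?x > 0" using m t by simp
  have "?b (1 + m) \<le> ?b ?x" by (rule ratio_powr_antimono[OF e m k]) (use t in auto)
  moreover have "?b (1 + m) = c + \<delta>" unfolding c by (simp add: add.assoc)
  ultimately have 1: "\<delta> \<le> ?b ?x - c" by simp
  have p: "?x powr (- e) * (?x / z) powr e = z powr (- e)" if "z > 0" for z
    using x that by (simp add: powr_divide powr_minus field_simps)
  have "\<delta> * 2 powr (- e) \<le> \<delta> * ?x powr (- e)"
    using d m t e x by (intro mult_left_mono powr_mono2') auto
  also have "\<dots> \<le> (?b ?x - c) * ?x powr (- e)" using 1 by (intro mult_right_mono) auto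
  also have "\<dots> = ?x powr (- e) * (?x / (?x + (1 - m))) powr e - c * ?x powr (- e)
      + k / m * (?x powr (- e) - ?x powr (- e) * (?x / (?x + m)) powr e)"
    by (simp add: algebra_simps)
  also have "\<dots> = (?x + (1 - m)) powr (- e) - c * ?x powr (- e) + k / m * (?x powr (- e) - (?x + m) powr (- e))"
    using m x by (subst (1 2) p) auto
  finally show ?thesis by (simp add: add.commute[of _ \<tau>] add.assoc)
qed

section \<open>The block decomposition and the tail estimate\<close>

definition block_scale :: "'a::euclidean_space set \<Rightarrow> real \<Rightarrow> 'a \<Rightarrow> 'a" where
  "block_scale S \<sigma> x = (\<Sum>j\<in>Basis. ((if j \<in> S then \<sigma> else 1) * (x \<bullet> j)) *\<^sub>R j)"

lemma block_scale_borel[measurable]: "block_scale S \<sigma> \<in> borel_measurable borel"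
  unfolding block_scale_def[abs_def] by measurable

lemma block_sq_block_scale:
  assumes "S \<subseteq> Basis"
  shows "block_sq S (block_scale S \<sigma> x) = \<sigma>\<^sup>2 * block_sq S x" "block_sq (Basis - S) (block_scale S \<sigma> x) = block_sq (Basis - S) x"
proof -
  have i: "block_scale S \<sigma> x \<bullet> j = (if j \<in> S then \<sigma> else 1) * (x \<bullet> j)" if "j \<in> Basis" for j
    unfolding block_scale_def by (rule inner_sum_left_Basis[OF that])
  show "block_sq S (block_scale S \<sigma> x) = \<sigma>\<^sup>2 * block_sq S x"
    unfolding block_sq_def sum_distrib_left using assms by (intro sum.cong) (auto simp: i power_mult_distrib)
  show "block_sq (Basis - S) (block_scale S \<sigma> x) = block_sq (Basis - S) x"
    unfolding block_sq_def using assms by (intro sum.cong) (auto simp: i)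
qed

lemma lborel_block_scale:
  assumes S: "S \<subseteq> (Basis :: 'a::euclidean_space set)" and \<sigma>: "\<sigma> > 0"
  shows "(lborel :: 'a measure) = density (distr lborel borel (block_scale S \<sigma>)) (\<lambda>_. ennreal (\<sigma> ^ card S))"
proof -
  have "(\<Prod>j\<in>(Basis::'a set). \<bar>if j \<in> S then \<sigma> else 1\<bar>) = (\<Prod>j\<in>S. \<sigma>)"
    using S \<sigma> by (intro prod.mono_neutral_cong_right) auto
  then have p: "(\<Prod>j\<in>(Basis::'a set). \<bar>if j \<in> S then \<sigma> else 1\<bar>) = \<sigma> ^ card S" by simp
  have f: "block_scale S \<sigma> = (\<lambda>x. 0 + (\<Sum>j\<in>Basis. ((if j \<in> S then \<sigma> else 1) * (x \<bullet> j)) *\<^sub>R j))"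
    by (auto simp: fun_eq_iff block_scale_def)
  show ?thesis
    using lborel_affine_euclidean[where c="\<lambda>j::'a. if j \<in> S then \<sigma> else 1" and t=0] \<sigma>
    unfolding p f by auto
qed

lemma emeasure_block_scale:
  assumes S: "S \<subseteq> (Basis :: 'a::euclidean_space set)" and \<sigma>: "\<sigma> > 0" and X: "X \<in> sets borel"
  shows "emeasure lborel X = ennreal (\<sigma> ^ card S) * emeasure lborel (block_scale S \<sigma> -` X)"
  by (subst lborel_block_scale[OF S \<sigma>]) (use X in \<open>simp add: emeasure_density_const emeasure_distr\<close>)

lemma integral_block_scale:
  fixes f :: "'a::euclidean_space \<Rightarrow> real"
  assumes S: "S \<subseteq> Basis" and \<sigma>: "\<sigma> > 0" and [measurable]: "f \<in> borel_measurable borel"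
  shows "(\<integral>x. f x \<partial>lborel) = \<sigma> ^ card S * (\<integral>x. f (block_scale S \<sigma> x) \<partial>lborel)"
  by (subst lborel_block_scale[OF S \<sigma>]) (use \<sigma> in \<open>simp add: integral_density integral_distr\<close>)

text \<open>The set \<open>S\<close> is the standard basis of the distinguished block, so \<open>card S\<close> is \<open>d\<close> and \<open>DIM('a)\<close> is \<open>N\<close>.\<close>

locale block_split =
  fixes S :: "'a::euclidean_space set"
  assumes S: "S \<subseteq> Basis" "S \<noteq> {}" and dim: "2 * card S + 2 < DIM('a)"
begin

definition A :: "'a \<Rightarrow> real" where "A = block_sq (Basis - S)"
definition B :: "'a \<Rightarrow> real" where "B = block_sq S"
definition R :: "'a \<Rightarrow> real" where "R x = A x + B x"
definition e :: real where "e = real (card S) / 2"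
definition p :: real where "p = (real DIM('a) - real (card S)) / 2"
text \<open>Polar integration over the whole space uses the gauge \<open>sqrt A\<close>, because its level sets are invariant
under rescaling of the block. It vanishes on a null set, and the tube is unbounded.\<close>

definition tube :: "'a set" where "tube = shell (\<lambda>x. sqrt (A x))"

lemma AB_borel[measurable]: "A \<in> borel_measurable borel" "B \<in> borel_measurable borel" "R \<in> borel_measurable borel"
  unfolding A_def B_def R_def[abs_def] by measurable

lemma tube_borel[measurable]: "tube \<in> sets borel"
  unfolding tube_def shell_def by measurable

lemma A_nonneg[simp]: "A x \<ge> 0" and B_nonneg[simp]: "B x \<ge> 0" and R_nonneg[simp]: "R x \<ge> 0"
  by (auto simp: A_def B_def R_def)

lemma R_eq: "R x = (norm x)\<^sup>2"
  using block_sq_split[OF S(1), of x] by (simp add: R_def A_def B_def block_sq_Basis)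

lemma R_pos: "x \<noteq> 0 \<Longrightarrow> R x > 0"
  by (simp add: R_eq)

lemma AB_scaleR: "A (t *\<^sub>R x) = t\<^sup>2 * A x" "B (t *\<^sub>R x) = t\<^sup>2 * B x" "R (t *\<^sub>R x) = t\<^sup>2 * R x"
  by (auto simp: A_def B_def R_def block_sq_scaleR algebra_simps)

lemma AB_block_scale: "A (block_scale S \<sigma> x) = A x" "B (block_scale S \<sigma> x) = \<sigma>\<^sup>2 * B x"
  "R (block_scale S \<sigma> x) = A x + \<sigma>\<^sup>2 * B x"
  by (auto simp: A_def B_def R_def block_sq_block_scale[OF S(1)])

lemma e_p_bounds: "e > 0" "p - 1 > e" "p > 0"
proof -
  have "card S > 0" using S finite_subset[OF S(1)] by (simp add: card_gt_0_iff)
  then show "e > 0" by (simp add: e_def)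
  show 1: "p - 1 > e" using dim by (simp add: e_def p_def field_simps)
  show "p > 0" using 1 \<open>e > 0\<close> by simp
qed

lemma tubeD: "x \<in> tube \<Longrightarrow> A x \<ge> 1" "x \<in> tube \<Longrightarrow> R x \<ge> 1" "x \<in> tube \<Longrightarrow> A x < exp 2" "x \<in> tube \<Longrightarrow> x \<noteq> 0"
proof -
  assume x: "x \<in> tube"
  then show 1: "A x \<ge> 1" by (simp add: tube_def shell_def)
  then show "R x \<ge> 1" using B_nonneg[of x] by (simp add: R_def del: B_nonneg)
  then show "x \<noteq> 0" by (auto simp: R_eq)
  have "sqrt (A x) < exp 1" using x by (simp add: tube_def shell_def)
  then have "(sqrt (A x))\<^sup>2 < (exp 1)\<^sup>2" by (intro power_strict_mono) auto
  then show "A x < exp 2" by (simp add: power2_eq_square exp_add[symmetric])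
qed

lemma AE_A_pos: "AE x in lborel. sqrt (A x) > 0"
proof -
  have "\<not> Basis \<subseteq> S"
    using dim S(1) card_mono[OF finite_subset[OF S(1) finite_Basis], of Basis] by auto
  then obtain j where j: "j \<in> Basis - S" by auto
  have "negligible {x::'a. x \<bullet> j = 0}" using j by (intro negligible_standard_hyperplane) auto
  then have "{x. x \<bullet> j = 0} \<in> null_sets lborel"
    unfolding negligible_iff_null_sets null_sets_completion_iff
    by (subst (asm) null_sets_completion_iff) auto
  then show ?thesis
  proof (rule AE_I', safe)
    fix x assume "\<not> 0 < sqrt (A x)"
    then have "A x = 0" using A_nonneg[of x] by (simp del: A_nonneg)
    then show "x \<bullet> j = 0" using j by (auto simp: A_def block_sq_def sum_nonneg_eq_0_iff)
  qed
qed

abbreviation tail :: "'a \<Rightarrow> real" where "tail x \<equiv> R x powr - (p - 1) * indicator tube x"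

text \<open>The part of the tube where \<open>R\<close> is about \<open>4^j\<close> has volume of order \<open>4 powr (j * e)\<close>, while the integrand
is about \<open>4 powr (- j * (p - 1))\<close> there. The geometric series converges because \<open>p - 1 > e\<close>, which
is the dimension condition.\<close>

lemma integrable_tail: "integrable lborel tail"
proof -
  define D where "D j = {x \<in> tube. B x < 4 ^ j}" for j :: nat
  have [measurable]: "D j \<in> sets borel" for j unfolding D_def by measurable
  \<comment> \<open>\<open>D j\<close> is the image of \<open>D 0\<close> when the block is stretched by \<open>2 ^ j\<close>\<close>
  define v where "v = measure lborel (D 0)"
  have "bounded (D 0)"
  proof (rule boundedI)
    fix x assume "x \<in> D 0"
    then have "(norm x)\<^sup>2 \<le> exp 2 + 1" using tubeD(3)[of x] by (auto simp: D_def R_eq[symmetric] R_def)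
    then show "norm x \<le> sqrt (exp 2 + 1)" by (rule real_le_rsqrt)
  qed
  then have fin0: "emeasure lborel (D 0) = ennreal v" unfolding v_def
    by (intro emeasure_eq_ennreal_measure) (use emeasure_bounded_finite in force)
  have eD: "emeasure lborel (D j) = ennreal ((2 ^ j) ^ card S * v)" for j
  proof -
    have "block_scale S (2 ^ j) -` D j = D 0"
      by (auto simp: D_def tube_def shell_def AB_block_scale power_mult_distrib power2_eq_square power_mult[symmetric]
          simp flip: power_mult_distrib)
    then show ?thesis using emeasure_block_scale[OF S(1), of "2 ^ j" "D j"]
      by (simp add: fin0 ennreal_mult v_def)
  qed
  define c where "c j = 4 powr (p - 1) * 4 powr (- real j * (p - 1))" for j
  have bound: "ennreal (tail x) \<le> (\<Sum>j. ennreal (c j) * indicator (D j) x)" for x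
  proof (cases "x \<in> tube")
    case True
    have "\<exists>j. B x < 4 ^ j" using real_arch_pow[of 4 "B x"] by auto
    define j where "j = (LEAST j. B x < 4 ^ j)"
    have j: "B x < 4 ^ j" unfolding j_def by (rule LeastI_ex) fact
    have least: "\<not> B x < 4 ^ i" if "i < j" for i
      using that unfolding j_def by (rule not_less_Least)
    have R: "R x \<ge> 4 powr (real j - 1)"
    proof (cases j)
      case 0
      have "(4::real) powr (-1) \<le> 4 powr 0" by (intro powr_mono) auto
      then show ?thesis using tubeD(2)[OF True] 0 by simp
    next
      case (Suc i)
      then have "B x \<ge> 4 ^ i" using least[of i] by simp
      then have "R x \<ge> 4 ^ i" using A_nonneg[of x] by (simp add: R_def del: A_nonneg)
      then show ?thesis by (simp add: Suc powr_realpow)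
    qed
    have "R x powr - (p - 1) \<le> (4 powr (real j - 1)) powr - (p - 1)"
      using R e_p_bounds by (intro powr_mono2') auto
    also have "\<dots> = c j" by (simp add: c_def powr_powr powr_add[symmetric] algebra_simps)
    finally have "ennreal (tail x) \<le> ennreal (c j) * indicator (D j) x"
      using True j by (simp add: D_def ennreal_leI)
    also have "\<dots> \<le> (\<Sum>j. ennreal (c j) * indicator (D j) x)"
    proof -
      define f where "f j = ennreal (c j) * indicator (D j) x" for j
      have "sum f {j} \<le> suminf f" by (intro sum_le_suminf) auto
      then have "f j \<le> suminf f" by simp
      then show ?thesis unfolding f_def .
    qed
    finally show ?thesis .
  qed simp
  have "(\<integral>\<^sup>+x. ennreal (tail x) \<partial>lborel)
      \<le> (\<integral>\<^sup>+x. (\<Sum>j. ennreal (c j) * indicator (D j) x) \<partial>lborel)"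
    by (intro nn_integral_mono bound)
  also have "\<dots> = (\<Sum>j. ennreal (c j) * emeasure lborel (D j))"
    by (subst nn_integral_suminf) (auto simp: nn_integral_cmult)
  also have "\<dots> = (\<Sum>j. ennreal (c j * ((2 ^ j) ^ card S * v)))"
    by (simp add: eD ennreal_mult v_def c_def)
  also have "(\<lambda>j. c j * ((2 ^ j) ^ card S * v)) = (\<lambda>j. (4 powr (p - 1) * v) * (4 powr (e - (p - 1))) ^ j)"
  proof
    fix j
    have "((2::real) ^ j) ^ card S = 2 powr (real j * real (card S))"
      by (simp add: powr_realpow[symmetric] powr_powr)
    also have "real j * real (card S) = 2 * (real j * e)" by (simp add: e_def)
    also have "2 powr (2 * (real j * e)) = (2 powr 2) powr (real j * e)" by (simp only: powr_powr)
    also have "(2::real) powr 2 = 4" by simp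
    finally have 1: "((2::real) ^ j) ^ card S = 4 powr (real j * e)" .
    have "4 powr (- real j * (p - 1)) * 4 powr (real j * e) = 4 powr ((e - (p - 1)) * real j)"
      by (simp add: powr_add[symmetric] algebra_simps)
    also have "\<dots> = (4 powr (e - (p - 1))) ^ j" by (simp add: powr_powr[symmetric] powr_realpow)
    finally show "c j * ((2 ^ j) ^ card S * v) = (4 powr (p - 1) * v) * (4 powr (e - (p - 1))) ^ j"
      by (simp add: c_def 1 mult_ac)
  qed
  also have "(\<Sum>j. ennreal ((4 powr (p - 1) * v) * (4 powr (e - (p - 1))) ^ j)) < \<infinity>"
  proof -
    have "(4::real) powr (e - (p - 1)) < 4 powr 0" using e_p_bounds by (intro powr_less_mono) auto
    then have "summable (\<lambda>j. (4 powr (p - 1) * v) * (4 powr (e - (p - 1))) ^ j)"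
      by (intro summable_mult summable_geometric) auto
    then have "(\<Sum>j. ennreal ((4 powr (p - 1) * v) * (4 powr (e - (p - 1))) ^ j)) \<noteq> top"
      by (rule ennreal_suminf_neq_top) (auto simp: v_def)
    then show ?thesis by (simp add: less_top)
  qed
  finally show ?thesis by (intro integrableI_nonneg) auto
qed

section \<open>Comparison of a flat body with the cylinder\<close>

lemma R_powr_mono: "x \<in> tube \<Longrightarrow> q \<ge> p - 1 \<Longrightarrow> R x powr - q \<le> R x powr - (p - 1)"
  using tubeD(2)[of x] by (intro powr_mono) auto

text \<open>The integrand that remains of \<open>g \<mu> * (A\<^sup>2 + B\<^sup>2) powr (-e/2)\<close> after the distinguished block is rescaled
so that \<open>\<mu> R + B\<close> turns into \<open>\<mu> R\<close>; then \<open>t = \<mu> / (1 + \<mu>)\<close>. For \<open>t = 0\<close> it belongs to the cylinder.\<close>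

definition J_density :: "real \<Rightarrow> 'a \<Rightarrow> real" where
  "J_density t x = R x powr - p * ((A x)\<^sup>2 + t\<^sup>2 * (B x)\<^sup>2) powr (- e / 2) * indicator tube x"

definition J :: "real \<Rightarrow> real" where "J t = (\<integral>x. J_density t x \<partial>lborel)"

lemma J_density_borel[measurable]: "J_density t \<in> borel_measurable borel"
  unfolding J_density_def[abs_def] by measurable

lemma J_density_nonneg: "J_density t x \<ge> 0" by (simp add: J_density_def)

lemma J_density_antimono: "0 \<le> s \<Longrightarrow> s \<le> t \<Longrightarrow> J_density t x \<le> J_density s x"
proof (cases "x \<in> tube")
  assume st: "0 \<le> s" "s \<le> t" and x: "x \<in> tube"
  have "(A x)\<^sup>2 + s\<^sup>2 * (B x)\<^sup>2 \<le> (A x)\<^sup>2 + t\<^sup>2 * (B x)\<^sup>2"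
    using st by (intro add_left_mono mult_right_mono power_mono) auto
  moreover have "0 < (A x)\<^sup>2 + s\<^sup>2 * (B x)\<^sup>2"
    using tubeD(1)[OF x] by (intro add_pos_nonneg) auto
  ultimately show ?thesis unfolding J_density_def using e_p_bounds
    by (intro mult_right_mono mult_left_mono powr_mono2') auto
qed (simp add: J_density_def)

lemma J_density_le: "J_density t x \<le> tail x"
proof (cases "x \<in> tube")
  assume x: "x \<in> tube"
  have A: "1 \<le> (A x)\<^sup>2" using tubeD(1)[OF x] by simp
  have "((A x)\<^sup>2 + t\<^sup>2 * (B x)\<^sup>2) powr (- e / 2) \<le> 1 powr (- e / 2)"
    using e_p_bounds A by (intro powr_mono2') (auto intro: add_increasing2)
  then have "J_density t x \<le> R x powr - p * 1"
    unfolding J_density_def using x by (simp add: mult_left_le)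
  also have "\<dots> \<le> R x powr - (p - 1)" using R_powr_mono[OF x, of p] by simp
  finally show ?thesis using x by simp
qed (simp add: J_density_def)

lemma J_density_integrable: "integrable lborel (J_density t)"
  
proof (rule Bochner_Integration.integrable_bound[OF integrable_tail])
  show "AE x in lborel. norm (J_density t x) \<le> norm (tail x)"
    by (intro AE_I2) (simp only: real_norm_def abs_of_nonneg[OF J_density_nonneg], rule order_trans[OF J_density_le abs_ge_self])
qed measurable

lemma J_antimono: "0 \<le> s \<Longrightarrow> s \<le> t \<Longrightarrow> J t \<le> J s"
  unfolding J_def by (intro integral_mono J_density_integrable J_density_antimono)

lemma J_nonneg: "J t \<ge> 0"
  unfolding J_def by (intro integral_nonneg_AE) (simp add: J_density_nonneg)

lemma J_strict: "J (1/2) < J 0"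
proof -
  let ?f = "\<lambda>x. J_density 0 x - J_density (1/2) x"
  have int: "integrable lborel ?f" by (intro Bochner_Integration.integrable_diff J_density_integrable)
  have nn: "0 \<le> ?f x" for x using J_density_antimono[of 0 "1/2" x] by simp
  have "integral\<^sup>L lborel ?f \<noteq> 0"
  proof
    assume "integral\<^sup>L lborel ?f = 0"
    then have ae: "AE x in lborel. ?f x = 0"
      using integral_nonneg_eq_0_iff_AE[OF int] nn by simp
    let ?U = "{x. 1 < A x \<and> A x < exp 2 \<and> 0 < B x}"
    have cont: "continuous_on UNIV A" "continuous_on UNIV B"
      unfolding A_def B_def block_sq_def by (auto intro!: continuous_intros)
    have op: "open ?U"
      unfolding Collect_conj_eq using cont by (intro open_Int open_Collect_less continuous_intros) auto
    have ne: "?U \<noteq> {}"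
    proof -
      have "\<not> Basis \<subseteq> S"
        using dim S(1) card_mono[OF finite_subset[OF S(1) finite_Basis], of Basis] by auto
      then obtain j where j: "j \<in> Basis" "j \<notin> S" by auto
      obtain i where i: "i \<in> S" using S by auto
      then have iB: "i \<in> Basis" using S by auto
      let ?x = "(3/2) *\<^sub>R j + i"
      have ij: "i \<noteq> j" using i j by auto
      have x: "?x \<bullet> l = (if l = j then 3/2 else if l = i then 1 else 0)" if "l \<in> Basis" for l
        using that j iB ij by (auto simp: inner_add_left inner_Basis)
      have "A ?x = (\<Sum>l\<in>Basis - S. if l = j then 9/4 else 0)"
        unfolding A_def block_sq_def using i by (intro sum.cong) (auto simp: x power2_eq_square)
      also have "\<dots> = 9/4" using j by simp
      finally have a: "A ?x = 9/4" .
      have "B ?x = (\<Sum>l\<in>S. if l = i then 1 else 0)"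
        unfolding B_def block_sq_def using j S by (intro sum.cong) (auto simp: x subset_eq)
      also have "\<dots> = 1" using i finite_subset[OF S(1)] by simp
      finally have b: "B ?x = 1" .
      have "(9/4::real) < exp 2" using exp_ge_add_one_self[of "2::real"] by linarith
      then have "?x \<in> ?U" using a b by simp
      then show ?thesis by blast
    qed
    have U: "?f x \<noteq> 0" if "x \<in> ?U" for x
    proof -
      have "sqrt (A x) < exp 1"
      proof (rule real_less_lsqrt)
        show "A x < (exp 1)\<^sup>2" using that by (simp add: power2_eq_square exp_add[symmetric])
      qed auto
      then have C: "x \<in> tube" using that by (auto simp: tube_def shell_def)
      have "((A x)\<^sup>2 + (1/2)\<^sup>2 * (B x)\<^sup>2) powr (- e / 2) < ((A x)\<^sup>2 + 0\<^sup>2 * (B x)\<^sup>2) powr (- e / 2)"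
        using that e_p_bounds by (intro powr_less_mono2_neg) auto
      then have "J_density (1/2) x < J_density 0 x"
        unfolding J_density_def using C tubeD(4)[OF C] R_pos[of x] by (auto intro!: mult_strict_left_mono)
      then show ?thesis by simp
    qed
    have "AE x in lborel. x \<notin> ?U" using ae by eventually_elim (use U in blast)
    then have "emeasure lborel ?U = 0" using op by (subst (asm) AE_iff_measurable[of ?U]) auto
    then have "negligible ?U" using op
      by (simp add: negligible_iff_null_sets null_setsI[of lborel] null_sets_completionI)
    then show False using open_not_negligible[OF op ne] by simp
  qed
  moreover have "integral\<^sup>L lborel ?f \<ge> 0" using nn by (intro integral_nonneg_AE) auto
  moreover have "integral\<^sup>L lborel ?f = J 0 - J (1/2)"
    unfolding J_def by (intro Bochner_Integration.integral_diff J_density_integrable)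
  ultimately show ?thesis by simp
qed

text \<open>Two bounds for \<open>1 - (1 + y\<^sup>2) powr (-e/2)\<close> with \<open>y = t B / A\<close>: the linear one gives an integrable
majorant of the difference quotient, the quadratic one its pointwise limit.\<close>

lemma J_density_difference:
  assumes x: "x \<in> tube" and t: "t > 0"
  shows "J_density 0 x - J_density t x \<le> t * ((1 + e) * R x powr - (p - 1))"
    and "J_density 0 x - J_density t x \<le> t\<^sup>2 * (e / 2 * (B x / A x)\<^sup>2)"
proof -
  define y where "y = t * (B x / A x)"
  have A: "A x \<ge> 1" by (rule tubeD(1)[OF x])
  have y0: "y \<ge> 0" using t A by (simp add: y_def)
  have R1: "R x \<ge> 1" by (rule tubeD(2)[OF x])
  have "(A x)\<^sup>2 + t\<^sup>2 * (B x)\<^sup>2 = (A x)\<^sup>2 * (1 + y\<^sup>2)"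
    using A by (simp add: y_def field_simps power2_eq_square)
  then have jt: "J_density t x = R x powr - p * ((A x)\<^sup>2 powr (- e / 2) * (1 + y\<^sup>2) powr (- (e / 2)))"
    using x by (simp add: J_density_def powr_mult)
  have j0: "J_density 0 x = R x powr - p * ((A x)\<^sup>2 powr (- e / 2))"
    using x by (simp add: J_density_def)
  define w where "w = 1 - (1 + y\<^sup>2) powr (- (e / 2))"
  have "(1 + y\<^sup>2) powr (- (e / 2)) \<le> 1 powr (- (e / 2))" using e_p_bounds by (intro powr_mono2') auto
  then have w0: "w \<ge> 0" by (simp add: w_def)
  have w1: "w \<le> 1" by (simp add: w_def)
  have w2: "w \<le> e / 2 * y\<^sup>2" using one_minus_powr_le[of "e / 2" "y\<^sup>2"] e_p_bounds less_le_trans[of "-1" 0 "y\<^sup>2"]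
    by (simp add: w_def)
  have w3: "w \<le> (1 + e) * y"
  proof (cases "y \<le> 1")
    case True
    then have "y\<^sup>2 \<le> y" using y0 by (simp add: power2_eq_square mult_left_le)
    then have "e / 2 * y\<^sup>2 \<le> e / 2 * y" using e_p_bounds by (intro mult_left_mono) auto
    also have "\<dots> \<le> (1 + e) * y" using e_p_bounds y0 by (intro mult_right_mono) auto
    finally show ?thesis using w2 by linarith
  next
    case False
    then have "1 * 1 \<le> (1 + e) * y" using e_p_bounds by (intro mult_mono) auto
    then show ?thesis using w1 by linarith
  qed
  have Ae: "(A x)\<^sup>2 powr (- e / 2) \<le> 1"
    using powr_mono2'[of "- e / 2" 1 "(A x)\<^sup>2"] A e_p_bounds by simp
  have d: "J_density 0 x - J_density t x = R x powr - p * ((A x)\<^sup>2 powr (- e / 2) * w)"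
    unfolding jt j0 w_def by (simp add: algebra_simps)
  also have "\<dots> \<le> R x powr - p * (1 * w)"
    using Ae w0 by (intro mult_left_mono mult_right_mono) auto
  finally have d': "J_density 0 x - J_density t x \<le> R x powr - p * w" by simp
  have "B x / A x \<le> B x" using A B_nonneg[of x] by (simp add: divide_le_eq mult_left_le_one_le mult_le_cancel_left1 del: B_nonneg)
  also have "\<dots> \<le> R x" by (simp add: R_def)
  finally have BA: "B x / A x \<le> R x" .
  have "R x powr - p * w \<le> R x powr - p * ((1 + e) * (t * R x))"
  proof (intro mult_left_mono order_trans[OF w3])
    show "y \<le> t * R x" using BA t by (simp add: y_def mult_left_mono del: times_divide_eq_right)
  qed (use e_p_bounds in auto)
  also have "\<dots> = t * ((1 + e) * (R x powr - p * R x powr 1))" using R1 by simp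
  also have "R x powr - p * R x powr 1 = R x powr - (p - 1)" by (simp only: powr_add[symmetric]) simp
  finally show "J_density 0 x - J_density t x \<le> t * ((1 + e) * R x powr - (p - 1))" using d' by linarith
  have "R x powr - p \<le> 1" using powr_mono2'[of "- p" 1 "R x"] R1 e_p_bounds by simp
  then have "R x powr - p * w \<le> 1 * w" using w0 by (intro mult_right_mono) auto
  also have "\<dots> \<le> e / 2 * y\<^sup>2" using w2 by simp
  also have "\<dots> = t\<^sup>2 * (e / 2 * (B x / A x)\<^sup>2)" by (simp only: y_def power_mult_distrib mult.left_commute)
  finally show "J_density 0 x - J_density t x \<le> t\<^sup>2 * (e / 2 * (B x / A x)\<^sup>2)" using d' by linarith
qed

text \<open>This expresses that the body \<open>A\<^sup>2 + B\<^sup>2 \<le> 1\<close> and the cylinder \<open>A \<le> 1\<close> agree to first order in \<open>B\<close>.\<close>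

lemma J_flat: "(\<lambda>n. (J 0 - J (1 / real (Suc n))) / (1 / real (Suc n))) \<longlonglongrightarrow> 0"
proof -
  let ?t = "\<lambda>n. 1 / real (Suc n)"
  let ?f = "\<lambda>n x. (J_density 0 x - J_density (?t n) x) / ?t n"
  have "(\<lambda>n. integral\<^sup>L lborel (?f n)) \<longlonglongrightarrow> integral\<^sup>L lborel (\<lambda>_::'a. 0)"
  proof (rule integral_dominated_convergence[where w="\<lambda>x. (1 + e) * (tail x)"])
    show "integrable lborel (\<lambda>x. (1 + e) * (tail x))"
      using integrable_tail by (rule integrable_mult_right)
    show "AE x in lborel. (\<lambda>n. ?f n x) \<longlonglongrightarrow> 0"
    proof (rule AE_I2)
      fix x
      show "(\<lambda>n. ?f n x) \<longlonglongrightarrow> 0"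
      proof (cases "x \<in> tube")
        case True
        let ?c = "e / 2 * (B x / A x)\<^sup>2"
        show ?thesis
        proof (rule tendsto_sandwich[where f="\<lambda>_. 0" and h="\<lambda>n. ?t n * ?c"])
          show "\<forall>\<^sub>F n in sequentially. 0 \<le> ?f n x"
            using J_density_antimono[of 0] by (intro always_eventually allI divide_nonneg_pos) auto
          show "\<forall>\<^sub>F n in sequentially. ?f n x \<le> ?t n * ?c"
          proof (intro always_eventually allI)
            fix n
            have gen: "X / t \<le> t * c" if "t > 0" "X \<le> t\<^sup>2 * c" for X t c :: real
              using that by (simp add: divide_le_eq power2_eq_square mult_ac)
            show "?f n x \<le> ?t n * ?c" by (rule gen) (simp, rule J_density_difference(2)[OF True], simp)
          qed
          show "(\<lambda>n. ?t n * ?c) \<longlonglongrightarrow> 0"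
          proof (rule tendsto_mult_left_zero)
            show "?t \<longlonglongrightarrow> 0" using LIMSEQ_inverse_real_of_nat by (simp add: divide_inverse)
          qed
        qed simp
      qed (simp add: J_density_def)
    qed
    show "AE x in lborel. norm (?f n x) \<le> (1 + e) * (tail x)" for n
    proof (rule AE_I2)
      fix x
      have gen: "norm ((J_density 0 x - J_density t x) / t) \<le> (1 + e) * (tail x)" if t: "t > 0" for t
      proof -
        have "0 \<le> (J_density 0 x - J_density t x) / t" using J_density_antimono[of 0 t x] t by simp
        moreover have "(J_density 0 x - J_density t x) / t \<le> (1 + e) * (tail x)"
          using J_density_difference(1)[OF _ t, of x] t
          by (cases "x \<in> tube") (simp_all add: divide_le_eq mult.commute[of t] J_density_def)
        ultimately show ?thesis by simp
      qed
      show "norm (?f n x) \<le> (1 + e) * (tail x)" by (rule gen) simp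
    qed
  qed measurable
  then show ?thesis
    by (simp add: J_def Bochner_Integration.integral_diff J_density_integrable del: of_nat_Suc)
qed

section \<open>Ellipsoidal test functions\<close>

definition E :: "real \<Rightarrow> 'a \<Rightarrow> real" where "E \<mu> x = \<mu> * R x + B x"
definition g :: "real \<Rightarrow> 'a \<Rightarrow> real" where "g \<mu> x = \<mu> powr (p - e) * E \<mu> x powr - p"
definition P :: "real \<Rightarrow> 'a \<Rightarrow> real" where "P \<eta> x = (A x)\<^sup>2 + (B x)\<^sup>2 + \<eta> * (R x)\<^sup>2"
text \<open>The integral over directions of \<open>g \<mu>\<close> against the weight that the first variation of the volume
produces at the body \<open>P \<eta> \<le> 1\<close>.\<close>

definition D :: "real \<Rightarrow> real \<Rightarrow> real" where
  "D \<eta> \<mu> = (\<integral>x. g \<mu> x * P \<eta> x powr (- e / 2) * indicator tube x \<partial>lborel)"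

lemma EgP_borel[measurable]: "E \<mu> \<in> borel_measurable borel" "g \<mu> \<in> borel_measurable borel"
    "P \<eta> \<in> borel_measurable borel"
  unfolding E_def[abs_def] g_def[abs_def] P_def[abs_def] by measurable

text \<open>Rescaling the block by the square root of \<open>\<mu> / (1 + \<mu>)\<close> turns \<open>\<mu> R + B = \<mu> A + (1 + \<mu>) B\<close> into \<open>\<mu> R\<close>.\<close>

lemma D_cylinder: 
  assumes \<mu>: "\<mu> > 0"
  shows "D 0 \<mu> = (1 + \<mu>) powr - e * J (\<mu> / (1 + \<mu>))"
proof -
  let ?n = "\<mu> / (1 + \<mu>)"
  let ?s = "sqrt ?n"
  have n: "?n > 0" using \<mu> by simp
  have s: "?s > 0" "?s\<^sup>2 = ?n" using n by auto
  have "D 0 \<mu> = ?s ^ card S * (\<integral>x. g \<mu> (block_scale S ?s x) * P 0 (block_scale S ?s x) powr (- e / 2) * indicator tube (block_scale S ?s x) \<partial>lborel)"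
    unfolding D_def by (rule integral_block_scale[OF S(1) s(1)]) measurable
  also have "(\<lambda>x. g \<mu> (block_scale S ?s x) * P 0 (block_scale S ?s x) powr (- e / 2) * indicator tube (block_scale S ?s x))
     = (\<lambda>x. \<mu> powr - e * J_density ?n x)"
  proof
    fix x
    have alg: "\<mu> * (a + n * b) + n * b = \<mu> * a + (1 + \<mu>) * (n * b)" for a b n :: real by algebra
    have "E \<mu> (block_scale S ?s x) = \<mu> * A x + (1 + \<mu>) * (?n * B x)"
      by (simp only: E_def AB_block_scale s(2) alg)
    also have "(1 + \<mu>) * (?n * B x) = \<mu> * B x" using \<mu> by simp
    also have "\<mu> * A x + \<mu> * B x = \<mu> * R x" by (simp add: R_def algebra_simps)
    finally have 1: "E \<mu> (block_scale S ?s x) = \<mu> * R x" .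
    have "g \<mu> (block_scale S ?s x) = \<mu> powr (p - e) * \<mu> powr - p * R x powr - p"
      using \<mu> by (simp add: g_def 1 powr_mult)
    also have "\<mu> powr (p - e) * \<mu> powr - p = \<mu> powr - e" by (simp add: powr_add[symmetric])
    finally have 2: "g \<mu> (block_scale S ?s x) = \<mu> powr - e * R x powr - p" .
    have 3: "P 0 (block_scale S ?s x) = (A x)\<^sup>2 + ?n\<^sup>2 * (B x)\<^sup>2"
      by (simp only: P_def AB_block_scale s(2) power_mult_distrib mult_zero_left add_0_right)
    have 4: "indicator tube (block_scale S ?s x) = (indicator tube x :: real)"
      by (simp add: indicator_def tube_def shell_def AB_block_scale)
    show "g \<mu> (block_scale S ?s x) * P 0 (block_scale S ?s x) powr (- e / 2) * indicator tube (block_scale S ?s x)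
      = \<mu> powr - e * J_density ?n x"
      unfolding 2 3 4 J_density_def by (simp only: mult.assoc)
  qed
  also have "(\<integral>x. \<mu> powr - e * J_density ?n x \<partial>lborel) = \<mu> powr - e * J ?n" by (simp add: J_def)
  also have "?s ^ card S = ?n powr e"
  proof -
    have "?s ^ card S = ?s powr real (card S)" using s by (simp add: powr_realpow)
    also have "\<dots> = (?n powr (1/2)) powr real (card S)" using n by (simp add: powr_half_sqrt)
    also have "\<dots> = ?n powr e" by (simp add: powr_powr e_def)
    finally show ?thesis .
  qed
  also have "?n powr e * (\<mu> powr - e * J ?n) = (1 + \<mu>) powr - e * J ?n"
    using \<mu> by (simp add: powr_divide powr_minus field_simps)
  finally show ?thesis .
qed

lemma gP_bound:
  assumes "\<mu> > 0" "\<eta> \<ge> 0" "x \<in> tube"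
  shows "0 \<le> g \<mu> x * P \<eta> x powr (- e / 2)" "g \<mu> x * P \<eta> x powr (- e / 2) \<le> \<mu> powr - e * R x powr - (p - 1)"
proof -
  have A: "A x \<ge> 1" and R: "R x \<ge> 1" using tubeD assms(3) by auto
  show "0 \<le> g \<mu> x * P \<eta> x powr (- e / 2)" by (simp add: g_def)
  have "1 \<le> (A x)\<^sup>2" using A by simp
  then have "P \<eta> x \<ge> 1" using assms(2) by (simp add: P_def add_increasing2)
  then have 1: "P \<eta> x powr (- e / 2) \<le> 1" using powr_mono2'[of "- e / 2" 1 "P \<eta> x"] e_p_bounds by simp
  have "E \<mu> x powr - p \<le> (\<mu> * R x) powr - p"
    using assms R e_p_bounds by (intro powr_mono2') (auto simp: E_def)
  then have "g \<mu> x \<le> \<mu> powr (p - e) * (\<mu> * R x) powr - p"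
    unfolding g_def by (intro mult_left_mono) auto
  also have "\<dots> = (\<mu> powr (p - e) * \<mu> powr - p) * R x powr - p" using assms by (simp add: powr_mult)
  also have "\<mu> powr (p - e) * \<mu> powr - p = \<mu> powr - e" by (simp add: powr_add[symmetric])
  also have "\<mu> powr - e * R x powr - p \<le> \<mu> powr - e * R x powr - (p - 1)"
    using R_powr_mono[OF assms(3), of p] by (intro mult_left_mono) auto
  finally have 2: "g \<mu> x \<le> \<mu> powr - e * R x powr - (p - 1)" .
  have "g \<mu> x * P \<eta> x powr (- e / 2) \<le> (\<mu> powr - e * R x powr - (p - 1)) * 1"
    using 1 2 by (intro mult_mono) (auto simp: g_def)
  then show "g \<mu> x * P \<eta> x powr (- e / 2) \<le> \<mu> powr - e * R x powr - (p - 1)" by simp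
qed

lemma gP_integrable:
  assumes "\<mu> > 0" "\<eta> \<ge> 0"
  shows "integrable lborel (\<lambda>x. g \<mu> x * P \<eta> x powr (- e / 2) * indicator tube x)"
proof (rule Bochner_Integration.integrable_bound[OF integrable_mult_right[OF integrable_tail, of "\<mu> powr - e"]])
  show "AE x in lborel. norm (g \<mu> x * P \<eta> x powr (- e / 2) * indicator tube x) \<le> norm (\<mu> powr - e * (tail x))"
    using gP_bound[OF assms] by (intro AE_I2) (auto simp: indicator_def)
qed measurable

lemma D_tendsto:
  assumes "\<mu> > 0"
  shows "(\<lambda>n. D (1 / real (Suc n)) \<mu>) \<longlonglongrightarrow> D 0 \<mu>"
  unfolding D_def
proof (rule integral_dominated_convergence[where w="\<lambda>x. \<mu> powr - e * (tail x)"])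
  show "integrable lborel (\<lambda>x. \<mu> powr - e * (tail x))"
    using integrable_tail by (rule integrable_mult_right)
  show "AE x in lborel. (\<lambda>n. g \<mu> x * P (1 / real (Suc n)) x powr (- e / 2) * indicator tube x) \<longlonglongrightarrow> g \<mu> x * P 0 x powr (- e / 2) * indicator tube x"
  proof (rule AE_I2)
    fix x
    show "(\<lambda>n. g \<mu> x * P (1 / real (Suc n)) x powr (- e / 2) * indicator tube x) \<longlonglongrightarrow> g \<mu> x * P 0 x powr (- e / 2) * indicator tube x"
    proof (cases "x \<in> tube")
      case True
      have "(\<lambda>n. P (1 / real (Suc n)) x) \<longlonglongrightarrow> P 0 x"
      proof -
        have "(\<lambda>n. 1 / real (Suc n)) \<longlonglongrightarrow> 0"
          using LIMSEQ_inverse_real_of_nat by (simp add: divide_inverse)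
        then show ?thesis unfolding P_def by (intro tendsto_intros)
      qed
      moreover have "P 0 x \<noteq> 0" using tubeD(1)[OF True] by (simp add: P_def add_nonneg_eq_0_iff)
      ultimately show ?thesis by (intro tendsto_intros) auto
    qed simp
  qed
  show "AE x in lborel. norm (g \<mu> x * P (1 / real (Suc n)) x powr (- e / 2) * indicator tube x) \<le> \<mu> powr - e * (tail x)" for n
    using gP_bound[OF assms, of "1 / real (Suc n)"] by (intro AE_I2) (auto simp: indicator_def)
qed measurable

definition \<kappa> :: real where "\<kappa> = 2 powr (e + 1)"

text \<open>The numbers are chosen in this order: \<open>m\<close> small enough that \<open>(J 0 - J (2 m)) / (2 m)\<close> is small against
the loss \<open>J 0 - J (1/2)\<close>, then \<open>c\<close> so that the section transform is barely positive at \<open>\<tau> = 1\<close>, and finally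
\<open>\<eta>\<close> by continuity of \<open>D\<close> at \<open>\<eta> = 0\<close>.\<close>

lemma exists_constants:
  obtains m c \<delta> \<eta> where "0 < m" "m \<le> 1" "\<delta> > 0" "\<eta> > 0"
    "\<And>\<tau>. 0 \<le> \<tau> \<Longrightarrow> \<tau> \<le> 1 \<Longrightarrow>
      (1 + \<tau>) powr (- e) - c * (m + \<tau>) powr (- e) + \<kappa> / m * ((m + \<tau>) powr (- e) - (2 * m + \<tau>) powr (- e)) \<ge> \<delta>"
    "D \<eta> 1 - c * D \<eta> m + \<kappa> / m * (D \<eta> m - D \<eta> (2 * m)) < 0"
proof -
  define \<Delta> where "\<Delta> = 2 powr - e * (J 0 - J (1/2))"
  have \<Delta>: "\<Delta> > 0" using J_strict by (simp add: \<Delta>_def)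
  have \<kappa>: "\<kappa> > 0" by (simp add: \<kappa>_def)
  \<comment> \<open>Half of the loss \<open>\<Delta>\<close> pays for the error terms, one quarter for \<open>z\<close> and one for \<open>\<delta>\<close>.\<close>
  define z where "z = \<Delta> / (4 * (1 + \<kappa> * e + 2 * \<kappa>))"
  have den: "1 + \<kappa> * e + 2 * \<kappa> > 0" using \<kappa> e_p_bounds by (auto intro!: add_pos_pos mult_pos_pos)
  have z: "z > 0" using \<Delta> den by (simp add: z_def)
  have zz: "(1 + \<kappa> * e + 2 * \<kappa>) * z = \<Delta> / 4" 
  proof -
    have "K * (\<Delta> / (4 * K)) = \<Delta> / 4" if "K > 0" for K using that by simp
    then show ?thesis unfolding z_def using den by blast
  qed
  obtain n where n: "(J 0 - J (1 / real (Suc n))) / (1 / real (Suc n)) < z"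
    using eventually_happens'[OF sequentially_bot order_tendstoD(2)[OF J_flat z]] by blast
  define t where "t = 1 / real (Suc n)"
  have t: "0 < t" "t \<le> 1" by (auto simp: t_def)
  define w where "w = J 0 - J t"
  have w0: "w \<ge> 0" using J_antimono[of 0 t] t by (simp add: w_def)
  have wt: "w / t < z" using n by (simp add: t_def w_def)
  have "w \<le> w / t" using t w0 by (simp add: le_divide_eq mult_left_le)
  then have wz: "w < z" using wt by simp
  define m where "m = t / 2"
  have m: "0 < m" "m \<le> 1" "2 * m = t" using t by (auto simp: m_def)
  define \<delta> where "\<delta> = \<Delta> / (4 * (J 0 + 1))"
  have C1: "J 0 + 1 > 0" using J_nonneg[of 0] by simp
  have \<delta>: "\<delta> > 0" using \<Delta> C1 by (simp add: \<delta>_def)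
  have C\<delta>: "J 0 * \<delta> \<le> \<Delta> / 4"
  proof -
    have "J 0 * \<delta> \<le> (J 0 + 1) * \<delta>" using \<delta> by simp
    also have "\<dots> = \<Delta> / 4"
    proof -
      have "K * (\<Delta> / (4 * K)) = \<Delta> / 4" if "K > 0" for K using that by simp
      then show ?thesis unfolding \<delta>_def using C1 by blast
    qed
    finally show ?thesis .
  qed
  define c where "c = ((1 + m) / 2) powr e + \<kappa> / m * (1 - ((1 + m) / (1 + 2 * m)) powr e) - \<delta>"
  have c_le: "c \<le> 1 + \<kappa> * e"
  proof -
    have "((1 + m) / 2) powr e \<le> 1 powr e" using m e_p_bounds by (intro powr_mono2) auto
    moreover have "\<kappa> / m * (1 - ((1 + m) / (1 + 2 * m)) powr e) \<le> \<kappa> / m * (e * m)"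
    proof (rule mult_left_mono)
      have eq: "(1 + m) / (1 + 2 * m) = 1 / (1 + m / (1 + m))" using m by (simp add: field_simps)
      have "1 - e * (m / (1 + m)) \<le> (1 + m / (1 + m)) powr - e"
        using m e_p_bounds less_le_trans[of "-1" 0 "m / (1 + m)"] by (intro one_minus_powr_le) auto
      also have "\<dots> = ((1 + m) / (1 + 2 * m)) powr e" unfolding eq using m by (simp add: powr_divide powr_minus field_simps)
      finally have "1 - ((1 + m) / (1 + 2 * m)) powr e \<le> e * (m / (1 + m))" by simp
      also have "\<dots> \<le> e * m" using m e_p_bounds by (intro mult_left_mono) (auto simp: divide_le_eq mult_le_cancel_left1)
      finally show "1 - ((1 + m) / (1 + 2 * m)) powr e \<le> e * m" .
    qed (use \<kappa> m in auto)
    ultimately show ?thesis using m \<delta> by (simp add: c_def)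
  qed
  let ?T = "\<lambda>f. f 1 - c * f m + \<kappa> / m * (f m - f (2 * m)) :: real"
  have trans: "\<delta> * 2 powr (- e) \<le> (1 + \<tau>) powr (- e) - c * (m + \<tau>) powr (- e) + \<kappa> / m * ((m + \<tau>) powr (- e) - (2 * m + \<tau>) powr (- e))"
    if "0 \<le> \<tau>" "\<tau> \<le> 1" for \<tau>
    by (rule section_transform_lower_bound[OF e_p_bounds(1) m(1,2) \<kappa>_def that \<delta> c_def])
  have T1: "?T (\<lambda>\<mu>. (1 + \<mu>) powr - e) = \<delta> * (1 + m) powr - e"
  proof -
    have q: "(1 + m) powr - e * ((1 + m) / u) powr e = u powr - e" if "u > 0" for u
      using m that by (simp add: powr_divide powr_minus field_simps)
    have "2 powr - e + \<kappa> / m * ((1 + m) powr - e - (1 + 2 * m) powr - e) =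
       (1 + m) powr - e * (((1 + m) / 2) powr e + \<kappa> / m * (1 - ((1 + m) / (1 + 2 * m)) powr e))"
      using q[of 2] q[of "1 + 2 * m"] m by (simp add: algebra_simps)
    also have "\<dots> = (1 + m) powr - e * (c + \<delta>)" by (simp add: c_def)
    finally show ?thesis by (simp add: algebra_simps)
  qed
  have D0: "?T (D 0) \<le> - \<Delta> / 4"
  proof -
    have le1: "(1 + \<mu>) powr - e \<le> 1" if "\<mu> > 0" for \<mu>
      using powr_mono2'[of "- e" 1 "1 + \<mu>"] that e_p_bounds by simp
    have Jw: "0 \<le> J 0 - J (\<mu> / (1 + \<mu>))" "J 0 - J (\<mu> / (1 + \<mu>)) \<le> w" if "0 < \<mu>" "\<mu> \<le> t" for \<mu>
    proof -
      have "\<mu> / (1 + \<mu>) \<le> \<mu>" using that by (simp add: divide_le_eq mult_le_cancel_left1)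
      then have "\<mu> / (1 + \<mu>) \<le> t" using that by simp
      then show "J 0 - J (\<mu> / (1 + \<mu>)) \<le> w" using J_antimono[of "\<mu> / (1 + \<mu>)" t] that by (simp add: w_def)
      show "0 \<le> J 0 - J (\<mu> / (1 + \<mu>))" using J_antimono[of 0 "\<mu> / (1 + \<mu>)"] that by simp
    qed
    \<comment> \<open>the deficit of the body with respect to the cylinder\<close>
    define h where "h \<mu> = (1 + \<mu>) powr - e * (J 0 - J (\<mu> / (1 + \<mu>)))" for \<mu>
    have h: "0 \<le> h \<mu>" "h \<mu> \<le> w" if "0 < \<mu>" "\<mu> \<le> t" for \<mu>
    proof -
      show "0 \<le> h \<mu>" unfolding h_def using Jw(1)[OF that] by simp
      have "h \<mu> \<le> 1 * w" unfolding h_def using Jw[OF that] le1[OF that(1)] by (intro mult_mono) auto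
      then show "h \<mu> \<le> w" by simp
    qed
    have h1: "h 1 = \<Delta>" by (simp add: h_def \<Delta>_def)
    have Dh: "D 0 \<mu> = J 0 * (1 + \<mu>) powr - e - h \<mu>" if "\<mu> > 0" for \<mu>
      unfolding D_cylinder[OF that] h_def by (simp add: algebra_simps)
    have "?T (D 0) = J 0 * ?T (\<lambda>\<mu>. (1 + \<mu>) powr - e) - (h 1 - c * h m + \<kappa> / m * (h m - h (2 * m)))"
      using m by (simp add: Dh algebra_simps diff_divide_distrib)
    also have "\<dots> = J 0 * \<delta> * (1 + m) powr - e - \<Delta> + c * h m - \<kappa> / m * h m + \<kappa> / m * h (2 * m)"
      unfolding T1 h1 by (simp add: algebra_simps)
    also have "\<dots> \<le> J 0 * \<delta> * 1 - \<Delta> + (1 + \<kappa> * e) * w - 0 + \<kappa> / m * w"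
    proof (intro add_mono diff_mono)
      show "J 0 * \<delta> * (1 + m) powr - e \<le> J 0 * \<delta> * 1"
        using J_nonneg[of 0] \<delta> le1[OF m(1)] by (intro mult_left_mono) auto
      have "c * h m \<le> (1 + \<kappa> * e) * h m" using c_le h(1)[of m] m t by (intro mult_right_mono) (auto simp: m_def)
      also have "\<dots> \<le> (1 + \<kappa> * e) * w" using \<kappa> e_p_bounds h(2)[of m] m t by (intro mult_left_mono) (auto simp: m_def)
      finally show "c * h m \<le> (1 + \<kappa> * e) * w" .
      show "0 \<le> \<kappa> / m * h m" using \<kappa> h(1)[of m] m t by (auto simp: m_def)
      show "\<kappa> / m * h (2 * m) \<le> \<kappa> / m * w" using \<kappa> h(2)[of "2 * m"] m t by (intro mult_left_mono) auto
    qed simp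
    also have "\<kappa> / m * w = 2 * \<kappa> * (w / t)" by (simp add: m_def)
    also have "(1 + \<kappa> * e) * w \<le> (1 + \<kappa> * e) * z" using wz \<kappa> e_p_bounds by (intro mult_left_mono) auto
    also have "2 * \<kappa> * (w / t) \<le> 2 * \<kappa> * z" using wt \<kappa> by (intro mult_left_mono) auto
    finally have "?T (D 0) \<le> J 0 * \<delta> - \<Delta> + (1 + \<kappa> * e + 2 * \<kappa>) * z"
      by (simp add: algebra_simps)
    then show ?thesis using C\<delta> zz \<Delta> by linarith
  qed
  have "(\<lambda>n. ?T (D (1 / real (Suc n)))) \<longlonglongrightarrow> ?T (D 0)"
    using m by (intro tendsto_intros D_tendsto) auto
  then have "\<forall>\<^sub>F n in sequentially. ?T (D (1 / real (Suc n))) < 0"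
    using D0 \<Delta> by (intro order_tendstoD(2)) auto
  then obtain n where "?T (D (1 / real (Suc n))) < 0"
    using eventually_happens'[OF sequentially_bot] by blast
  then show thesis
    using that[of m "\<delta> * 2 powr - e" "1 / real (Suc n)" c] m \<delta> trans by simp
qed

section \<open>Measures with the sections of an ellipsoid\<close>

text \<open>What has to be known about Lebesgue measure on \<open>H\<^sub>\<theta>\<close>: it scales with the right degree, and the
ellipsoids \<open>E \<mu> x \<le> 1\<close> have the volumes that the coordinates of \<open>adapted_basis\<close> give. The factor \<open>\<omega>\<close>
is the volume of the unit ball.\<close>

definition section_measure :: "real \<Rightarrow> 'a measure \<Rightarrow> bool" where
  "section_measure \<tau> M \<longleftrightarrow> dilation_measure (DIM('a) - card S) M \<and>
     (\<exists>\<omega>\<ge>0. measure M {x. R x \<le> 1} = \<omega> \<and>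
        (\<forall>\<mu>>0. measure M {x. E \<mu> x \<le> 1} = \<omega> * \<mu> powr - (p - e) * (\<mu> + \<tau>) powr - e))"

abbreviation "annulus \<equiv> shell (norm :: 'a \<Rightarrow> real)"

lemma codim: "DIM('a) - card S > 0" "real (DIM('a) - card S) = 2 * p"
  using dim by (auto simp: p_def of_nat_diff)

lemma powr_2_norm: "norm (x::'a) powr 2 = R x"
  by (simp add: R_eq powr_numeral)

lemma section_integrals:
  assumes M: "section_measure \<tau> M"
  obtains w where "w \<ge> 0"
    "integrable M (\<lambda>x. R x powr - p * indicator annulus x)" "(\<integral>x. R x powr - p * indicator annulus x \<partial>M) = w"
    "\<And>\<mu>. \<mu> > 0 \<Longrightarrow> integrable M (\<lambda>x. g \<mu> x * indicator annulus x)"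
    "\<And>\<mu>. \<mu> > 0 \<Longrightarrow> (\<integral>x. g \<mu> x * indicator annulus x \<partial>M) = w * (\<mu> + \<tau>) powr - e"
proof -
  from M obtain \<omega> where dm: "dilation_measure (DIM('a) - card S) M" and \<omega>: "\<omega> \<ge> 0"
    "measure M {x. R x \<le> 1} = \<omega>"
    "\<And>\<mu>. \<mu> > 0 \<Longrightarrow> measure M {x. E \<mu> x \<le> 1} = \<omega> * \<mu> powr - (p - e) * (\<mu> + \<tau>) powr - e"
    unfolding section_measure_def by blast
  have np: "AE x in M. norm x > 0" using dilation_null_zero[OF dm codim(1)] by simp
  have polar: "integrable M (\<lambda>x. W x powr - p * indicator annulus x)"
     "(\<integral>x. W x powr - p * indicator annulus x \<partial>M) = 2 * p * measure M {x. W x \<le> 1}"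
    if "W \<in> borel_measurable borel" "\<And>t x. W (t *\<^sub>R x) = t\<^sup>2 * W x" "c > 0" "\<And>x. W x \<ge> c * R x" for W c
  proof -
    note pol = polar_integral[OF dm codim(1), of 2 c W norm]
    have W: "W (t *\<^sub>R x) = t powr 2 * W x" if "t > 0" for t x using that \<open>\<And>t x. W (t *\<^sub>R x) = t\<^sup>2 * W x\<close> by (simp add: powr_numeral)
    have l: "c * norm x powr 2 \<le> W x" for x using that(4)[of x] by (simp add: powr_2_norm)
    have q: "- real (DIM('a) - card S) / 2 = - p" by (simp add: codim(2))
    show "integrable M (\<lambda>x. W x powr - p * indicator annulus x)"
      using pol(1) that(1,3) W l np unfolding q by simp
    have "measure M {x. W x \<le> 1} = 1 / real (DIM('a) - card S) * (\<integral>x. W x powr - p * indicator annulus x \<partial>M)"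
      using pol(2) that(1,3) W l np unfolding q by simp
    then show "(\<integral>x. W x powr - p * indicator annulus x \<partial>M) = 2 * p * measure M {x. W x \<le> 1}"
      using e_p_bounds by (simp add: codim(2))
  qed
  show thesis
  proof (rule that[of "2 * p * \<omega>"])
    show "0 \<le> 2 * p * \<omega>" using \<omega> e_p_bounds by simp
    show "integrable M (\<lambda>x. R x powr - p * indicator annulus x)"
      by (rule polar(1)[of R 1]) (auto simp: AB_scaleR)
    show "(\<integral>x. R x powr - p * indicator annulus x \<partial>M) = 2 * p * \<omega>"
      using polar(2)[of R 1] by (auto simp: AB_scaleR \<omega>)
    fix \<mu> :: real assume \<mu>: "\<mu> > 0"
    have i: "integrable M (\<lambda>x. E \<mu> x powr - p * indicator annulus x)"
      by (rule polar(1)[of _ \<mu>]) (use \<mu> in \<open>auto simp: AB_scaleR E_def algebra_simps\<close>)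
    have v: "(\<integral>x. E \<mu> x powr - p * indicator annulus x \<partial>M) = 2 * p * measure M {x. E \<mu> x \<le> 1}"
      by (rule polar(2)[of _ \<mu>]) (use \<mu> in \<open>auto simp: AB_scaleR E_def algebra_simps\<close>)
    have gE: "(\<lambda>x. g \<mu> x * indicator annulus x) = (\<lambda>x. \<mu> powr (p - e) * (E \<mu> x powr - p * indicator annulus x))"
      by (simp add: fun_eq_iff g_def)
    show "integrable M (\<lambda>x. g \<mu> x * indicator annulus x)"
      unfolding gE using i by (rule integrable_mult_right)
    have "\<mu> powr (p - e) * \<mu> powr - (p - e) = 1" using \<mu> by (simp only: powr_add[symmetric]) simp
    then show "(\<integral>x. g \<mu> x * indicator annulus x \<partial>M) = 2 * p * \<omega> * (\<mu> + \<tau>) powr - e"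
    proof -
      assume 1: "\<mu> powr (p - e) * \<mu> powr - (p - e) = 1"
      have "a * (2 * p * (\<omega> * b * c)) = 2 * p * \<omega> * c" if "a * b = 1" for a b c
        using that by algebra
      from this[OF 1] show ?thesis
        unfolding gE integral_mult_right_zero v \<omega>(3)[OF \<mu>] .
    qed
  qed
qed

text \<open>In these coordinates \<open>E \<mu>\<close> is a diagonal quadratic form with \<open>d\<close> coefficients \<open>\<mu> + \<tau>\<close> and \<open>N - 2 d\<close>
coefficients \<open>\<mu>\<close>, so the ellipsoid is a scaled unit ball.\<close>

lemma section_measure_coord_lborel:
  assumes B: "orthonormal_basis_of V U" and card: "card U = DIM('a) - card S"
    and Y: "Y \<subseteq> U" "card Y = card S" and \<tau>: "\<tau> \<ge> 0"
    and form: "\<And>c. block_sq S (\<Sum>b\<in>U. c b *\<^sub>R b) = \<tau> * (\<Sum>b\<in>Y. (c b)\<^sup>2)"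
  shows "section_measure \<tau> (coord_lborel U)"
proof -
  note D = orthonormal_basis_ofD[OF B]
  let ?P = "\<Pi>\<^sub>M b\<in>U. (lborel :: real measure)"
  let ?\<Sigma> = "\<lambda>c. \<Sum>b\<in>U. c b *\<^sub>R b"
  let ?\<omega> = "measure (coord_lborel U) {x. R x \<le> 1}"
  have R: "R (?\<Sigma> c) = (\<Sum>b\<in>U. (c b)\<^sup>2)" for c
    using orthonormal_sum_norm[OF B, of c] by (simp add: R_eq power2_norm_eq_inner)
  have "measure (coord_lborel U) {x. E \<mu> x \<le> 1} = ?\<omega> * \<mu> powr - (p - e) * (\<mu> + \<tau>) powr - e"
    if \<mu>: "\<mu> > 0" for \<mu>
  proof -
    \<comment> \<open>the reciprocal semi-axes of the ellipsoid\<close>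
    define l where "l b = sqrt (if b \<in> Y then \<mu> + \<tau> else \<mu>)" for b
    have l: "l b > 0" for b using \<mu> \<tau> by (simp add: l_def)
    have l2: "(l b)\<^sup>2 = (if b \<in> Y then \<mu> + \<tau> else \<mu>)" for b using \<mu> \<tau> by (simp add: l_def)
    have E: "E \<mu> (?\<Sigma> c) = R (?\<Sigma> (\<lambda>b\<in>U. l b * c b))" for c
    proof -
      have "(\<Sum>b\<in>U. (l b * c b)\<^sup>2) = (\<Sum>b\<in>U. \<mu> * (c b)\<^sup>2 + (if b \<in> Y then \<tau> * (c b)\<^sup>2 else 0))"
        by (intro sum.cong refl) (simp add: power_mult_distrib l2 distrib_right)
      also have "\<dots> = \<mu> * (\<Sum>b\<in>U. (c b)\<^sup>2) + \<tau> * (\<Sum>b\<in>Y. (c b)\<^sup>2)"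
        using D(1) Y(1) by (simp add: sum.distrib sum_distrib_left sum.If_cases Int_absorb1)
      also have "\<dots> = E \<mu> (?\<Sigma> c)" by (simp add: E_def R form B_def)
      finally show ?thesis by (simp add: R cong: sum.cong)
    qed
    let ?X = "{c \<in> space ?P. ?\<Sigma> c \<in> {x. R x \<le> 1}}"
    have X: "?X \<in> sets ?P" by (rule coord_sum_preimage) measurable
    have "emeasure (coord_lborel U) {x. E \<mu> x \<le> 1} = emeasure ?P {c \<in> space ?P. ?\<Sigma> c \<in> {x. E \<mu> x \<le> 1}}"
      by (rule coord_lborel_emeasure) measurable
    also have "{c \<in> space ?P. ?\<Sigma> c \<in> {x. E \<mu> x \<le> 1}} = {c \<in> space ?P. (\<lambda>b\<in>U. l b * c b) \<in> ?X}"
      unfolding mem_Collect_eq E by (auto simp: space_PiM)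
    also have "emeasure ?P \<dots> = ennreal (\<Prod>b\<in>U. 1 / l b) * emeasure ?P ?X"
      by (rule PiM_scale_preimage[OF D(1) l X])
    also have "emeasure ?P ?X = emeasure (coord_lborel U) {x. R x \<le> 1}"
      by (rule coord_lborel_emeasure[symmetric]) measurable
    finally have "measure (coord_lborel U) {x. E \<mu> x \<le> 1} = (\<Prod>b\<in>U. 1 / l b) * ?\<omega>"
      using l by (simp add: measure_def enn2real_mult prod_nonneg less_imp_le)
    also have "(\<Prod>b\<in>U. 1 / l b) = (\<Prod>b\<in>U. if b \<in> Y then (\<mu> + \<tau>) powr (- 1 / 2) else \<mu> powr (- 1 / 2))"
      using \<mu> \<tau> by (intro prod.cong) (auto simp: l_def powr_minus_divide powr_half_sqrt)
    also have "\<dots> = ((\<mu> + \<tau>) powr (- 1 / 2)) ^ card Y * (\<mu> powr (- 1 / 2)) ^ card (U - Y)"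
      using D(1) Y(1) by (simp add: prod.If_cases Int_absorb1 Diff_eq)
    also have "((\<mu> + \<tau>) powr (- 1 / 2)) ^ card Y = (\<mu> + \<tau>) powr - e"
      using \<mu> \<tau> by (simp add: powr_powr e_def Y(2) flip: powr_realpow[of "_ powr _"])
    also have "(\<mu> powr (- 1 / 2)) ^ card (U - Y) = \<mu> powr - (p - e)"
    proof -
      have "real (card (U - Y)) = 2 * (p - e)"
        using card_Diff_subset[OF finite_subset[OF Y(1) D(1)] Y(1)] card Y(2) dim
        by (simp add: p_def e_def of_nat_diff field_simps)
      then have "(\<mu> powr (- 1 / 2)) ^ card (U - Y) = \<mu> powr (- 1 / 2 * (2 * (p - e)))"
        using \<mu> by (simp add: powr_powr flip: powr_realpow[of "_ powr _"])
      also have "- 1 / 2 * (2 * (p - e)) = - (p - e)" by (simp add: field_simps)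
      finally show ?thesis .
    qed
    finally show ?thesis by (simp add: mult_ac)
  qed
  moreover have "dilation_measure (DIM('a) - card S) (coord_lborel U)"
    using dilation_measure_coord_lborel[OF B] card by simp
  ultimately show ?thesis unfolding section_measure_def by (intro conjI exI[of _ ?\<omega>]) auto
qed

text \<open>The basis inside \<open>subspace_lborel\<close> is an unspecified choice, whereas the preceding lemma
needs a particular one.\<close>

lemma section_measure_basis_independent:
  assumes B: "orthonormal_basis_of V U" and B': "orthonormal_basis_of V U'"
    and s: "section_measure \<tau> (coord_lborel U)"
  shows "section_measure \<tau> (coord_lborel U')"
proof -
  obtain k where k: "k > 0" "\<And>X. X \<in> sets borel \<Longrightarrow> emeasure (coord_lborel U') X = ennreal k * emeasure (coord_lborel U) X"
    using coord_lborel_proportional[OF B' B] by blast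
  have m: "measure (coord_lborel U') X = k * measure (coord_lborel U) X" if "X \<in> sets borel" for X
    using k(1) by (simp add: measure_def k(2)[OF that] enn2real_mult)
  from s obtain \<omega> where \<omega>: "\<omega> \<ge> 0" "measure (coord_lborel U) {x. R x \<le> 1} = \<omega>"
    "\<And>\<mu>. \<mu> > 0 \<Longrightarrow> measure (coord_lborel U) {x. E \<mu> x \<le> 1} = \<omega> * \<mu> powr - (p - e) * (\<mu> + \<tau>) powr - e"
    and dm: "dilation_measure (DIM('a) - card S) (coord_lborel U)"
    unfolding section_measure_def by blast
  have "dilation_measure (DIM('a) - card S) (coord_lborel U')"
    unfolding dilation_measure_def
  proof (intro conjI allI impI ballI)
    show "emeasure (coord_lborel U') (cball 0 r) < \<infinity>" for r by (rule coord_lborel_cball_finite[OF B'])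
    fix t :: real and X :: "'a set" assume t: "0 < t" and X: "X \<in> sets borel"
    have X': "(\<lambda>x. t *\<^sub>R x) -` X \<in> sets borel"
      using measurable_sets[of "\<lambda>x. t *\<^sub>R x" borel borel X] X by simp
    have "emeasure (coord_lborel U) ((\<lambda>x. t *\<^sub>R x) -` X) = ennreal ((1 / t) ^ (DIM('a) - card S)) * emeasure (coord_lborel U) X"
      using dm t X unfolding dilation_measure_def by blast
    then show "emeasure (coord_lborel U') ((\<lambda>x. t *\<^sub>R x) -` X) = ennreal ((1 / t) ^ (DIM('a) - card S)) * emeasure (coord_lborel U') X"
      by (simp only: k(2)[OF X] k(2)[OF X'] mult.left_commute)
  qed simp
  moreover have "{x. R x \<le> 1} \<in> sets borel" "{x. E \<mu> x \<le> 1} \<in> sets borel" for \<mu> by measurable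
  ultimately show ?thesis
    unfolding section_measure_def using k(1) \<omega>
    by (intro conjI exI[of _ "k * \<omega>"]) (auto simp: m)
qed

section \<open>The two bodies\<close>

lemma symbol_E: "symbol_of_order 2 (E \<mu>)"
  unfolding E_def[abs_def] R_def A_def B_def by (intro symbol_add symbol_cmult symbol_block_sq)

lemma symbol_g:
  assumes "\<mu> > 0" shows "symbol_of_order (- 2 * p) (g \<mu>)"
proof -
  have "symbol_of_order (2 * - p) (\<lambda>x. E \<mu> x powr - p)"
    by (rule symbol_powr[OF symbol_E assms]) (simp add: powr_2_norm E_def)
  then show ?thesis unfolding g_def[abs_def] by (simp add: symbol_cmult)
qed

lemma symbol_P: "symbol_of_order 4 (P \<eta>)"
proof -
  have "symbol_of_order (2 + 2) (P \<eta>)"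
    unfolding P_def[abs_def] power2_eq_square R_def A_def B_def
    by (intro symbol_add symbol_cmult symbol_mult symbol_block_sq)
  then show ?thesis by simp
qed

lemma P_lower: "P \<eta> x \<ge> \<eta> * (R x)\<^sup>2"
  by (simp add: P_def)

lemma R_sq: "(R x)\<^sup>2 = norm x ^ 4"
  by (simp add: R_eq)

lemma C_k_on_block_sq: "open U \<Longrightarrow> C_k_on k (block_sq T) U"
  unfolding block_sq_def[abs_def] power2_eq_square by (intro C_k_on_sum C_k_on_mult C_k_on_inner)

lemma C_k_on_R: "open U \<Longrightarrow> C_k_on k R U"
  unfolding R_def[abs_def] A_def B_def by (intro C_k_on_add C_k_on_block_sq)

lemma C_k_on_g: "\<mu> > 0 \<Longrightarrow> C_k_on k (g \<mu>) (- {0})"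
  unfolding g_def[abs_def] E_def B_def
  by (intro C_k_on_mult C_k_on_const C_k_on_powr C_k_on_add C_k_on_R C_k_on_block_sq)
     (auto intro!: add_pos_nonneg mult_pos_pos R_pos)

lemma C_k_on_P: "open U \<Longrightarrow> C_k_on k (P \<eta>) U"
  unfolding P_def[abs_def] A_def B_def power2_eq_square
  by (intro C_k_on_mult C_k_on_const C_k_on_add C_k_on_R C_k_on_block_sq)

text \<open>The first variation. Writing \<open>F \<epsilon> = P * (1 + \<epsilon> * Q / P)\<close> with \<open>Q = P powr (p/2 + 1) * T\<close>, the
Bernoulli inequality bounds the volume of \<open>{F \<epsilon> \<le> 1}\<close> from below for every admissible \<open>\<epsilon>\<close>, and the
quadratic upper bound controls the sections uniformly in \<open>\<tau>\<close>, because the integral of \<open>T\<close>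
over a section is at least \<open>\<delta>\<close> times that of \<open>R powr -p\<close>, a multiple of which bounds the error.\<close>

theorem counterexample_bodies:
  "\<exists>K L. infinitely_smooth_body K \<and> convex_body K \<and> infinitely_smooth_body L \<and> convex_body L \<and>
     (\<forall>x y. block_sq S x = block_sq S y \<longrightarrow> norm x = norm y \<longrightarrow> (x \<in> K \<longleftrightarrow> y \<in> K) \<and> (x \<in> L \<longleftrightarrow> y \<in> L)) \<and>
     (\<forall>\<tau> M. 0 \<le> \<tau> \<longrightarrow> \<tau> \<le> 1 \<longrightarrow> section_measure \<tau> M \<longrightarrow> measure M K \<le> measure M L) \<and>
     measure lborel L < measure lborel K"
proof -
  obtain m c \<delta> \<eta> where m: "0 < m" "m \<le> 1" and \<delta>: "\<delta> > 0" and \<eta>: "\<eta> > 0"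
    and tr: "\<And>\<tau>. 0 \<le> \<tau> \<Longrightarrow> \<tau> \<le> 1 \<Longrightarrow>
      (1 + \<tau>) powr (- e) - c * (m + \<tau>) powr (- e) + \<kappa> / m * ((m + \<tau>) powr (- e) - (2 * m + \<tau>) powr (- e)) \<ge> \<delta>"
    and neg: "D \<eta> 1 - c * D \<eta> m + \<kappa> / m * (D \<eta> m - D \<eta> (2 * m)) < 0"
    by (rule exists_constants) blast
  define T where "T x = g 1 x + (- c) * g m x + \<kappa> / m * (g m x + (- 1) * g (2 * m) x)" for x
  define Q where "Q x = P \<eta> x powr (p / 2 + 1) * T x" for x
  define F where "F \<epsilon> x = P \<eta> x + \<epsilon> * Q x" for \<epsilon> x
  have [measurable]: "T \<in> borel_measurable borel" unfolding T_def[abs_def] by measurable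
  have [measurable]: "Q \<in> borel_measurable borel" unfolding Q_def[abs_def] by measurable
  have [measurable]: "F \<epsilon> \<in> borel_measurable borel" for \<epsilon> unfolding F_def[abs_def] by measurable
  have n4: "norm x powr 4 = norm x ^ 4" for x :: 'a by (simp add: powr_numeral)
  have Pl: "P \<eta> x \<ge> \<eta> * norm x ^ 4" for x using P_lower[of \<eta> x] by (simp add: R_sq)
  have Ppos: "P \<eta> x > 0" if "x \<noteq> 0" for x
    using less_le_trans[OF _ Pl[of x]] \<eta> that by simp
  have Pnn: "P \<eta> x \<ge> 0" for x using \<eta> by (simp add: P_def)
  have P0: "P \<eta> 0 = 0" by (simp add: P_def R_def A_def B_def block_sq_def)
  have Q0: "Q 0 = 0" by (simp add: Q_def P0)
  have sT: "symbol_of_order (- 2 * p) T"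
    unfolding T_def[abs_def] using m by (intro symbol_add symbol_cmult symbol_g) auto
  have "symbol_of_order (4 * (p / 2 + 1)) (\<lambda>x. P \<eta> x powr (p / 2 + 1))"
    by (rule symbol_powr[OF symbol_P \<eta>]) (simp add: n4 Pl)
  from symbol_mult[OF this sT] have sQ: "symbol_of_order 4 Q"
    unfolding Q_def[abs_def] by (simp add: algebra_simps)
  obtain CQ where CQ: "CQ \<ge> 0" "\<bar>Q x\<bar> \<le> CQ * norm x ^ 4" for x
  proof -
    from sQ obtain C where C: "C \<ge> 0" "\<And>x. x \<noteq> 0 \<Longrightarrow> \<bar>Q x\<bar> \<le> C * norm x powr 4"
      unfolding symbol_of_order_def symbol_bounds_def by blast
    show thesis
    proof (rule that[OF C(1)])
      show "\<bar>Q x\<bar> \<le> C * norm x ^ 4" for x using C(2)[of x] by (cases "x = 0") (auto simp: Q0 n4)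
    qed
  qed
  obtain CP where CP: "CP \<ge> 0" "\<bar>P \<eta> x\<bar> \<le> CP * norm x ^ 4" for x
  proof -
    from symbol_P[of \<eta>] obtain C where C: "C \<ge> 0" "\<And>x. x \<noteq> 0 \<Longrightarrow> \<bar>P \<eta> x\<bar> \<le> C * norm x powr 4"
      unfolding symbol_of_order_def symbol_bounds_def by blast
    show thesis
    proof (rule that[OF C(1)])
      show "\<bar>P \<eta> x\<bar> \<le> C * norm x ^ 4" for x using C(2)[of x] by (cases "x = 0") (auto simp: P0 n4)
    qed
  qed
  have Ph: "P \<eta> (t *\<^sub>R x) = t ^ 4 * P \<eta> x" for t x
    by (simp add: P_def AB_scaleR power_mult_distrib algebra_simps)
  have gh: "g \<mu> (t *\<^sub>R x) = t powr (- 2 * p) * g \<mu> x" if "t > 0" for t \<mu> x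
  proof -
    have "E \<mu> (t *\<^sub>R x) = t powr 2 * E \<mu> x" using that by (simp add: E_def AB_scaleR powr_numeral algebra_simps)
    then have "E \<mu> (t *\<^sub>R x) powr - p = t powr (2 * - p) * E \<mu> x powr - p" by (simp only: powr_mult powr_powr)
    then show ?thesis by (simp add: g_def)
  qed
  have Qh: "Q (t *\<^sub>R x) = t ^ 4 * Q x" if "t \<ge> 0" for t x
  proof (cases "t = 0")
    case False
    then have t: "t > 0" using that by simp
    have "T (t *\<^sub>R x) = t powr (- 2 * p) * T x" unfolding T_def gh[OF t] by (simp add: algebra_simps)
    moreover have "P \<eta> (t *\<^sub>R x) powr (p / 2 + 1) = t powr (4 * (p / 2 + 1)) * P \<eta> x powr (p / 2 + 1)"
    proof -
      have "P \<eta> (t *\<^sub>R x) = t powr 4 * P \<eta> x" using t by (simp add: Ph powr_numeral)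
      then show ?thesis by (simp only: powr_mult powr_powr)
    qed
    ultimately have "Q (t *\<^sub>R x) = (t powr (4 * (p / 2 + 1)) * t powr (- 2 * p)) * Q x"
      by (simp add: Q_def mult_ac)
    also have "t powr (4 * (p / 2 + 1)) * t powr (- 2 * p) = t powr 4"
      by (simp add: powr_add[symmetric] algebra_simps)
    finally show ?thesis using t by (simp add: powr_numeral)
  qed (simp add: Q0)
  have RB: "R x = block_sq Basis x" for x by (simp add: R_eq block_sq_Basis)
  obtain \<epsilon>0 where e0: "\<epsilon>0 > 0" "\<And>\<epsilon>. \<bar>\<epsilon>\<bar> \<le> \<epsilon>0 \<Longrightarrow> convex {x. F \<epsilon> x \<le> 1}"
    using convex_quartic_perturbation[OF sQ \<eta> Qh, of "Basis - S" S]
    unfolding F_def P_def A_def B_def RB by blast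
  define a where "a = p / 2"
  have a: "a > 0" using e_p_bounds by (simp add: a_def)
  obtain C2 where C2: "C2 > 0" "\<And>y. \<bar>y\<bar> \<le> 1/2 \<Longrightarrow> (1 + y) powr (- a) \<le> 1 - a * y + C2 * y\<^sup>2"
    using powr_taylor_upper[OF a] by blast
  define Z where "Z = CQ / \<eta> + 1"
  have Z: "Z > 0" using CQ \<eta> by (simp add: Z_def add_nonneg_pos)
  have QZ: "\<bar>Q x\<bar> \<le> Z * P \<eta> x" for x
  proof -
    have "\<bar>Q x\<bar> \<le> CQ / \<eta> * (\<eta> * norm x ^ 4)" using CQ(2)[of x] \<eta> by simp
    also have "\<dots> \<le> CQ / \<eta> * P \<eta> x" using Pl CQ \<eta> by (intro mult_left_mono) auto
    also have "\<dots> \<le> Z * P \<eta> x"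
      using Pnn[of x] by (intro mult_right_mono) (auto simp: Z_def)
    finally show ?thesis .
  qed
  define W where "W = C2 * Z\<^sup>2 * \<eta> powr - a"
  have W: "W > 0" using C2 Z \<eta> by (simp add: W_def)
  \<comment> \<open>bounds for convexity, for positivity of \<open>F \<epsilon>\<close> and for the quadratic error in the sections\<close>
  define \<epsilon> where "\<epsilon> = min \<epsilon>0 (min (1 / (2 * Z)) (a * \<delta> / W))"
  have eps: "\<epsilon> > 0" "\<epsilon> \<le> \<epsilon>0" "\<epsilon> \<le> 1 / (2 * Z)" "\<epsilon> \<le> a * \<delta> / W"
    using e0 Z a \<delta> W by (auto simp: \<epsilon>_def)
  have eZ: "\<epsilon> * Z \<le> 1 / 2" using eps(3) Z by (simp add: field_simps)
  have eW: "\<epsilon> * W \<le> a * \<delta>" using eps(4) W by (simp add: field_simps)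
  have small: "\<bar>s * Q x\<bar> \<le> P \<eta> x / 2" if "\<bar>s\<bar> \<le> \<epsilon>" for s x
  proof -
    have "\<bar>s * Q x\<bar> \<le> \<epsilon> * (Z * P \<eta> x)" unfolding abs_mult using that QZ[of x] by (intro mult_mono) auto
    also have "\<dots> = (\<epsilon> * Z) * P \<eta> x" by simp
    also have "\<dots> \<le> 1 / 2 * P \<eta> x" using eZ Pnn[of x] by (intro mult_right_mono)
    finally show ?thesis by simp
  qed
  have Fl: "F s x \<ge> \<eta> / 2 * norm x ^ 4" if "\<bar>s\<bar> \<le> \<epsilon>" for s x
    using small[OF that, of x] Pl[of x] by (simp add: F_def)
  have Fh: "F s (t *\<^sub>R x) = t ^ 4 * F s x" if "0 \<le> t" for s t x
    by (simp add: F_def Ph Qh[OF that] algebra_simps)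
  have CkF: "C_k_on k (F s) (- {0})" for k s
  proof -
    have "open (- {0::'a})" by auto
    then show ?thesis unfolding F_def[abs_def] Q_def T_def using m
      by (intro C_k_on_add C_k_on_mult C_k_on_const C_k_on_powr C_k_on_P C_k_on_g) (auto intro: Ppos)
  qed
  have body: "infinitely_smooth_body {x. F s x \<le> 1}" "convex_body {x. F s x \<le> 1}" if "\<bar>s\<bar> \<le> \<epsilon>" for s
  proof -
    have up: "\<bar>F s x\<bar> \<le> (CP + \<epsilon> * CQ) * norm x ^ 4" for x
    proof -
      have "\<bar>s * Q x\<bar> \<le> \<epsilon> * (CQ * norm x ^ 4)" unfolding abs_mult using that CQ(2)[of x] by (intro mult_mono) auto
      then show ?thesis using CP(2)[of x] by (simp add: F_def algebra_simps)
    qed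
    have "\<bar>s\<bar> \<le> \<epsilon>0" using that eps by simp
    note sublevel_body[of "\<eta> / 2" "F s", OF _ Fl[OF that] up Fh CkF e0(2)[OF this]]
    then show "infinitely_smooth_body {x. F s x \<le> 1}" "convex_body {x. F s x \<le> 1}" using \<eta> by auto
  qed
  have polar: "integrable M (\<lambda>x. F s x powr (- (real k / 4)) * indicator (shell \<gamma>) x)"
    "measure M {x. F s x \<le> 1} = 1 / k * (\<integral>x. F s x powr (- (real k / 4)) * indicator (shell \<gamma>) x \<partial>M)"
    if s: "\<bar>s\<bar> \<le> \<epsilon>" and M: "dilation_measure k M" "k > 0" and [measurable]: "\<gamma> \<in> borel_measurable borel"
      and \<gamma>: "\<And>t x. t > 0 \<Longrightarrow> \<gamma> (t *\<^sub>R x) = t * \<gamma> x" "AE x in M. \<gamma> x > 0" for s k M \<gamma>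
  proof -
    have h: "F s (t *\<^sub>R x) = t powr 4 * F s x" if "t > 0" for t x
      using that Fh[of t s x] by (simp add: powr_numeral)
    have l: "\<eta> / 2 * norm x powr 4 \<le> F s x" for x using Fl[OF s, of x] by (simp add: n4)
    note pi = polar_integral[OF M, of 4 "\<eta> / 2" "F s" \<gamma>, OF _ _ _ _ h \<gamma>(1) l \<gamma>(2)]
    show "integrable M (\<lambda>x. F s x powr (- (real k / 4)) * indicator (shell \<gamma>) x)"
      using pi(1) \<eta> by simp
    show "measure M {x. F s x \<le> 1} = 1 / k * (\<integral>x. F s x powr (- (real k / 4)) * indicator (shell \<gamma>) x \<partial>M)"
      using pi(2) \<eta> by simp
  qed
  have z: "F \<epsilon> x powr - b = P \<eta> x powr - b * (1 + \<epsilon> * (Q x / P \<eta> x)) powr - b"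
    "\<bar>\<epsilon> * (Q x / P \<eta> x)\<bar> \<le> 1 / 2" if "x \<noteq> 0" for x b
  proof -
    have Pp: "P \<eta> x > 0" by (rule Ppos[OF that])
    have "F \<epsilon> x = P \<eta> x * (1 + \<epsilon> * (Q x / P \<eta> x))" using Pp by (simp add: F_def field_simps)
    then show "F \<epsilon> x powr - b = P \<eta> x powr - b * (1 + \<epsilon> * (Q x / P \<eta> x)) powr - b" by (simp add: powr_mult)
    show "\<bar>\<epsilon> * (Q x / P \<eta> x)\<bar> \<le> 1 / 2"
      using small[of \<epsilon> x] eps Pp by (simp add: abs_mult field_simps)
  qed
  have F0: "F 0 x = P \<eta> x" for x by (simp add: F_def)
  have volume: "measure lborel {x. F 0 x \<le> 1} < measure lborel {x. F \<epsilon> x \<le> 1}"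
  proof -
    let ?b = "real DIM('a) / 4"
    let ?t = "\<lambda>x. T x * P \<eta> x powr (- e / 2) * indicator tube x"
    let ?f = "\<lambda>s x. F s x powr - ?b * indicator tube x"
    have b: "?b = (p + e) / 2" by (simp add: p_def e_def field_simps)
    have bpos: "?b > 0" by simp
    have G: "sqrt (A (t *\<^sub>R x)) = t * sqrt (A x)" if "t > 0" for t x
      using that by (simp add: AB_scaleR real_sqrt_mult)
    have pol: "integrable lborel (?f s)"
      "measure lborel {x. F s x \<le> 1} = 1 / DIM('a) * (\<integral>x. ?f s x \<partial>lborel)"
      if "\<bar>s\<bar> \<le> \<epsilon>" for s
      unfolding tube_def using polar[OF that dilation_measure_lborel DIM_positive _ G AE_A_pos] by auto
    have intT: "integrable lborel ?t"
      "(\<integral>x. ?t x \<partial>lborel) = D \<eta> 1 - c * D \<eta> m + \<kappa> / m * (D \<eta> m - D \<eta> (2 * m))"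
    proof -
      have i: "integrable lborel (\<lambda>x. g \<mu> x * P \<eta> x powr (- e / 2) * indicator tube x)" if "\<mu> > 0" for \<mu>
        by (rule gP_integrable) (use that \<eta> in auto)
      let ?i = "\<lambda>\<mu> x. g \<mu> x * P \<eta> x powr (- e / 2) * indicator tube x"
      have eq: "?t
         = (\<lambda>x. ?i 1 x - c * ?i m x + \<kappa> / m * (?i m x - ?i (2 * m) x))"
        by (simp add: fun_eq_iff T_def algebra_simps)
      show "integrable lborel ?t" unfolding eq
        using m by (intro Bochner_Integration.integrable_add Bochner_Integration.integrable_diff integrable_mult_right i) auto
      show "(\<integral>x. ?t x \<partial>lborel) = D \<eta> 1 - c * D \<eta> m + \<kappa> / m * (D \<eta> m - D \<eta> (2 * m))"
        unfolding eq D_def using m i[of 1] i[of m] i[of "2 * m"]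
        by (simp add: Bochner_Integration.integral_add Bochner_Integration.integral_diff)
    qed
    have pw: "P \<eta> x powr - ?b * indicator tube x - ?b * \<epsilon> * (?t x) \<le> ?f \<epsilon> x" for x
    proof (cases "x \<in> tube")
      case True
      then have x: "x \<noteq> 0" by (rule tubeD(4))
      let ?y = "\<epsilon> * (Q x / P \<eta> x)"
      have Pp: "P \<eta> x > 0" by (rule Ppos[OF x])
      have y: "?y > -1" using z(2)[OF x] by linarith
      have "P \<eta> x powr - ?b * (1 - ?b * ?y) \<le> F \<epsilon> x powr - ?b"
        unfolding z(1)[OF x] using y bpos by (intro mult_left_mono one_minus_powr_le) auto
      moreover have alg: "u * (1 - b * (s * q)) = u - b * s * (u * q)" for u b s q :: real by algebra
      moreover have "P \<eta> x powr - ?b * (Q x / P \<eta> x) = T x * P \<eta> x powr (- e / 2)"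
      proof -
        have "P \<eta> x powr - ?b * (Q x / P \<eta> x) = T x * (P \<eta> x powr - ?b * P \<eta> x powr (p / 2 + 1) * P \<eta> x powr - 1)"
          using Pp by (simp add: Q_def powr_minus_divide)
        also have "P \<eta> x powr - ?b * P \<eta> x powr (p / 2 + 1) * P \<eta> x powr - 1 = P \<eta> x powr (- e / 2)"
          unfolding b powr_add[symmetric] by (rule arg_cong[where f="\<lambda>q. P \<eta> x powr q"]) (simp add: field_simps)
        finally show ?thesis .
      qed
      ultimately have "P \<eta> x powr - ?b - ?b * \<epsilon> * (T x * P \<eta> x powr (- e / 2)) \<le> F \<epsilon> x powr - ?b" by metis
      then show ?thesis using True by simp
    qed simp
    have "(\<integral>x. P \<eta> x powr - ?b * indicator tube x - ?b * \<epsilon> * (?t x) \<partial>lborel)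
        \<le> (\<integral>x. ?f \<epsilon> x \<partial>lborel)"
      using pol(1)[of 0] pol(1)[of \<epsilon>] eps intT(1) pw
      by (intro integral_mono Bochner_Integration.integrable_diff integrable_mult_right) (auto simp: F0)
    also have "(\<integral>x. P \<eta> x powr - ?b * indicator tube x - ?b * \<epsilon> * (?t x) \<partial>lborel)
       = (\<integral>x. ?f 0 x \<partial>lborel) - ?b * \<epsilon> * (\<integral>x. ?t x \<partial>lborel)"
      using pol(1)[of 0] eps intT(1) by (subst Bochner_Integration.integral_diff) (auto simp: F0)
    finally have le: "(\<integral>x. ?f 0 x \<partial>lborel) - ?b * \<epsilon> * (\<integral>x. ?t x \<partial>lborel)
        \<le> (\<integral>x. ?f \<epsilon> x \<partial>lborel)" .
    have "?b * \<epsilon> * (\<integral>x. ?t x \<partial>lborel) < 0"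
      unfolding intT(2) using neg eps bpos by (intro mult_pos_neg) auto
    then have "(\<integral>x. ?f 0 x \<partial>lborel) < (\<integral>x. ?f \<epsilon> x \<partial>lborel)"
      using le by linarith
    then show ?thesis using pol(2)[of 0] pol(2)[of \<epsilon>] eps
      by (simp add: divide_strict_right_mono)
  qed
  have sections: "measure M {x. F \<epsilon> x \<le> 1} \<le> measure M {x. F 0 x \<le> 1}"
    if \<tau>: "0 \<le> \<tau>" "\<tau> \<le> 1" and M: "section_measure \<tau> M" for \<tau> M
  proof -
    let ?t = "\<lambda>x. T x * indicator annulus x"
    let ?r = "\<lambda>x. R x powr - p * indicator annulus x"
    let ?f = "\<lambda>s x. F s x powr - a * indicator annulus x"
    have dm: "dilation_measure (DIM('a) - card S) M" using M by (simp add: section_measure_def)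
    have np: "AE x in M. norm x > 0" using dilation_null_zero[OF dm codim(1)] by simp
    have ka: "real (DIM('a) - card S) / 4 = a" by (simp add: codim(2) a_def)
    have pol: "integrable M (?f s)"
      "measure M {x. F s x \<le> 1} = 1 / (2 * p) * (\<integral>x. ?f s x \<partial>M)"
      if "\<bar>s\<bar> \<le> \<epsilon>" for s
      using polar[OF that dm codim(1) _ _ np, unfolded ka, unfolded codim(2)] by simp_all
    obtain w where w: "w \<ge> 0"
      "integrable M ?r" "(\<integral>x. ?r x \<partial>M) = w"
      "\<And>\<mu>. \<mu> > 0 \<Longrightarrow> integrable M (\<lambda>x. g \<mu> x * indicator annulus x)"
      "\<And>\<mu>. \<mu> > 0 \<Longrightarrow> (\<integral>x. g \<mu> x * indicator annulus x \<partial>M) = w * (\<mu> + \<tau>) powr - e"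
      using section_integrals[OF M] by blast
    let ?i = "\<lambda>\<mu> x. g \<mu> x * indicator annulus x"
    have eq: "?t = (\<lambda>x. ?i 1 x - c * ?i m x + \<kappa> / m * (?i m x - ?i (2 * m) x))"
      by (simp add: fun_eq_iff T_def algebra_simps)
    have Ti: "integrable M ?t" unfolding eq
      using m by (intro Bochner_Integration.integrable_add Bochner_Integration.integrable_diff integrable_mult_right w(4)) auto
    have "(\<integral>x. ?t x \<partial>M) = w * ((1 + \<tau>) powr (- e) - c * (m + \<tau>) powr (- e) + \<kappa> / m * ((m + \<tau>) powr (- e) - (2 * m + \<tau>) powr (- e)))"
      unfolding eq using m w(4)[of 1] w(4)[of m] w(4)[of "2 * m"] w(5)[of 1] w(5)[of m] w(5)[of "2 * m"]
      by (simp add: Bochner_Integration.integral_add Bochner_Integration.integral_diff algebra_simps)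
    also have "\<dots> \<ge> w * \<delta>" using tr[OF \<tau>] w(1) by (intro mult_left_mono)
    finally have TI: "w * \<delta> \<le> (\<integral>x. ?t x \<partial>M)" .
    let ?V = "\<epsilon>\<^sup>2 * W"
    have pw: "?f \<epsilon> x \<le>
       P \<eta> x powr - a * indicator annulus x - a * \<epsilon> * (?t x) + ?V * (?r x)" for x
    proof (cases "x \<in> annulus")
      case True
      then have x: "x \<noteq> 0" by (auto simp: shell_def)
      let ?q = "Q x / P \<eta> x"
      have Pp: "P \<eta> x > 0" by (rule Ppos[OF x])
      have "F \<epsilon> x powr - a \<le> P \<eta> x powr - a * (1 - a * (\<epsilon> * ?q) + C2 * (\<epsilon> * ?q)\<^sup>2)"
        unfolding z(1)[OF x] using z(2)[OF x] by (intro mult_left_mono C2) auto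
      also have "\<dots> = P \<eta> x powr - a - a * \<epsilon> * (P \<eta> x powr - a * ?q) + \<epsilon>\<^sup>2 * C2 * (P \<eta> x powr - a * ?q\<^sup>2)"
      proof -
        have "u * (1 - a * (\<epsilon> * q) + C2 * (\<epsilon> * q)\<^sup>2) = u - a * \<epsilon> * (u * q) + \<epsilon>\<^sup>2 * C2 * (u * q\<^sup>2)" for u q
          by algebra
        then show ?thesis .
      qed
      also have "P \<eta> x powr - a * ?q = T x"
      proof -
        have "P \<eta> x powr - a * ?q = T x * (P \<eta> x powr - a * P \<eta> x powr (p / 2 + 1) * P \<eta> x powr - 1)"
          using Pp by (simp add: Q_def powr_minus_divide)
        also have "P \<eta> x powr - a * P \<eta> x powr (p / 2 + 1) * P \<eta> x powr - 1 = P \<eta> x powr 0"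
          unfolding powr_add[symmetric] a_def by (rule arg_cong[where f="\<lambda>q. P \<eta> x powr q"]) simp
        finally show ?thesis using Pp by simp
      qed
      also have "\<epsilon>\<^sup>2 * C2 * (P \<eta> x powr - a * ?q\<^sup>2) \<le> \<epsilon>\<^sup>2 * C2 * ((\<eta> powr - a * R x powr - p) * Z\<^sup>2)"
      proof (intro mult_left_mono mult_mono)
        have "P \<eta> x powr - a \<le> (\<eta> * (R x)\<^sup>2) powr - a"
          using P_lower[of \<eta> x] \<eta> a R_pos[OF x] by (intro powr_mono2') auto
        also have "\<dots> = \<eta> powr - a * (R x powr 2) powr - a"
          using R_pos[OF x] by (simp add: powr_mult powr_numeral)
        also have "(R x powr 2) powr - a = R x powr - p" by (simp only: powr_powr a_def) simp
        finally show "P \<eta> x powr - a \<le> \<eta> powr - a * R x powr - p" .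
        have "\<bar>?q\<bar> \<le> Z" using QZ[of x] Pp by (simp add: divide_le_eq)
        then show "?q\<^sup>2 \<le> Z\<^sup>2" using Z by (simp add: abs_le_square_iff[symmetric])
      qed (use C2 in auto)
      also have "\<epsilon>\<^sup>2 * C2 * ((\<eta> powr - a * R x powr - p) * Z\<^sup>2) = ?V * R x powr - p" by (simp add: W_def)
      finally show ?thesis using True by simp
    qed simp
    have "(\<integral>x. ?f \<epsilon> x \<partial>M) \<le>
       (\<integral>x. P \<eta> x powr - a * indicator annulus x - a * \<epsilon> * (?t x) + ?V * (?r x) \<partial>M)"
      using pol(1)[of 0] pol(1)[of \<epsilon>] eps Ti w(2) pw
      by (intro integral_mono Bochner_Integration.integrable_add Bochner_Integration.integrable_diff integrable_mult_right) (auto simp: F0)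
    also have "\<dots> = (\<integral>x. ?f 0 x \<partial>M) - a * \<epsilon> * (\<integral>x. ?t x \<partial>M) + ?V * w"
      using pol(1)[of 0] eps Ti w(2,3) by (simp add: F0 Bochner_Integration.integral_add Bochner_Integration.integral_diff)
    also have "\<dots> \<le> (\<integral>x. ?f 0 x \<partial>M)"
    proof -
      have "?V * w = \<epsilon> * w * (\<epsilon> * W)" by (simp add: power2_eq_square)
      also have "\<dots> \<le> \<epsilon> * w * (a * \<delta>)" using eW eps w(1) by (intro mult_left_mono) auto
      also have "\<dots> = a * \<epsilon> * (w * \<delta>)" by simp
      also have "\<dots> \<le> a * \<epsilon> * (\<integral>x. ?t x \<partial>M)" using TI a eps by (intro mult_left_mono) auto
      finally show ?thesis by simp
    qed
    finally show ?thesis using pol(2)[of 0] pol(2)[of \<epsilon>] eps e_p_bounds by (simp add: divide_right_mono)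
  qed
  have inv: "F s x = F s y" if "block_sq S x = block_sq S y" "norm x = norm y" for s x y
  proof -
    have B: "B x = B y" and R: "R x = R y" using that by (auto simp: B_def R_eq)
    then have A: "A x = A y" by (simp add: R_def)
    have g: "g \<mu> x = g \<mu> y" for \<mu> by (simp add: g_def E_def B R)
    show ?thesis by (simp add: F_def Q_def T_def P_def A B R g)
  qed
  show ?thesis
  proof (rule exI[of _ "{x. F \<epsilon> x \<le> 1}"], rule exI[of _ "{x. F 0 x \<le> 1}"], intro conjI allI impI)
    show "infinitely_smooth_body {x. F \<epsilon> x \<le> 1}" "convex_body {x. F \<epsilon> x \<le> 1}" using body[of \<epsilon>] eps by auto
    show "infinitely_smooth_body {x. F 0 x \<le> 1}" "convex_body {x. F 0 x \<le> 1}" using body[of 0] eps by auto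
    show "measure M {x. F \<epsilon> x \<le> 1} \<le> measure M {x. F 0 x \<le> 1}" if "0 \<le> \<tau>" "\<tau> \<le> 1" "section_measure \<tau> M" for \<tau> M
      by (rule sections[OF that])
    show "measure lborel {x. F 0 x \<le> 1} < measure lborel {x. F \<epsilon> x \<le> 1}" by (rule volume)
    fix x y assume "block_sq S x = block_sq S y" "norm x = norm y"
    then show "(x \<in> {x. F \<epsilon> x \<le> 1}) = (y \<in> {x. F \<epsilon> x \<le> 1})"
      "(x \<in> {x. F 0 x \<le> 1}) = (y \<in> {x. F 0 x \<le> 1})"
      using inv[of x y] by simp_all
  qed
qed

end

section \<open>The group and the subspaces\<close>

definition blk :: "'n \<Rightarrow> real^('n::finite \<times> 'd::finite) \<Rightarrow> real^'d" where
  "blk k x = (\<chi> i. x $ (k, i))"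

definition block_basis :: "'n \<Rightarrow> (real^('n::finite \<times> 'd::finite)) set" where
  "block_basis k = (\<lambda>i. axis (k, i) 1) ` UNIV"

lemma linear_blk: "linear (blk k)"
  by (rule linearI) (auto simp: blk_def vec_eq_iff)

lemma inner_blk: "x \<bullet> y = (\<Sum>k\<in>UNIV. blk k x \<bullet> blk k y)"
  unfolding inner_vec_def blk_def
  by (simp add: sum.cartesian_product flip: UNIV_Times_UNIV) 

lemma block_sq_block_basis: "block_sq (block_basis k) x = (norm (blk k x))\<^sup>2"
proof -
  have "inj (\<lambda>i. axis (k, i) (1::real))" by (auto simp: inj_def axis_eq_axis)
  then have "block_sq (block_basis k) x = (\<Sum>i\<in>UNIV. (x $ (k, i))\<^sup>2)"
    unfolding block_sq_def block_basis_def by (subst sum.reindex) (auto simp: inner_axis)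
  then show ?thesis unfolding power2_norm_eq_inner inner_vec_def blk_def by (simp add: power2_eq_square)
qed

lemma card_block_basis: "card (block_basis k :: (real^('n::finite \<times> 'd::finite)) set) = CARD('d)"
  unfolding block_basis_def by (rule card_image) (auto simp: inj_def axis_eq_axis)

lemma block_basis_subset: "block_basis k \<subseteq> Basis"
  by (auto simp: block_basis_def axis_in_Basis_iff)

lemma blk_block_diag: "blk k (block_diag M *v x) = M *v blk k x"
proof -
  have "(block_diag M *v x) $ (k, i) = (M *v blk k x) $ i" for i
  proof -
    have "(block_diag M *v x) $ (k, i) = (\<Sum>q\<in>UNIV \<times> UNIV. (if k = fst q then M $ i $ snd q else 0) * x $ q)"
      by (simp add: block_diag_def matrix_vector_mult_def cong: if_cong)
    also have "\<dots> = (\<Sum>l\<in>UNIV. \<Sum>j\<in>UNIV. (if k = l then M $ i $ j else 0) * x $ (l, j))"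
      by (subst sum.cartesian_product) (simp add: case_prod_beta)
    also have "\<dots> = (\<Sum>l\<in>UNIV. if k = l then (\<Sum>j\<in>UNIV. M $ i $ j * x $ (k, j)) else 0)"
      by (intro sum.cong) auto
    finally show ?thesis by (simp add: matrix_vector_mult_def blk_def)
  qed
  then show ?thesis by (simp add: blk_def vec_eq_iff)
qed

lemma frame_inner:
  fixes A :: "nat \<Rightarrow> real^'d^'d" and y :: "real^'d"
  assumes A: "complete_tangent_system A" and ij: "i < CARD('d)" "j < CARD('d)"
  shows "(frame A i *v y) \<bullet> (frame A j *v y) = (if i = j then y \<bullet> y else 0)"
proof (cases "y = 0")
  case False
  let ?s = "(1 / norm y) *\<^sub>R y"
  have s: "?s \<in> sphere 0 1" using False by simp
  then have inj: "inj_on (\<lambda>i. frame A i *v ?s) {..<CARD('d)}"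
    and onb: "orthonormal_basis_of UNIV ((\<lambda>i. frame A i *v ?s) ` {..<CARD('d)})"
    using A unfolding complete_tangent_system_def by blast+
  have "(frame A i *v ?s) \<bullet> (frame A j *v ?s) = (if i = j then 1 else 0)"
  proof (cases "i = j")
    case True
    then show ?thesis using orthonormal_basis_ofD(2)[OF onb] ij by auto
  next
    case neq: False
    then have "frame A i *v ?s \<noteq> frame A j *v ?s" using inj ij by (auto simp: inj_on_def)
    then show ?thesis using orthonormal_basis_ofD(3)[OF onb] ij neq by auto
  qed
  moreover have "frame A i *v y = norm y *\<^sub>R (frame A i *v ?s)" for i
    using False by (simp add: matrix_vector_mult_scaleR)
  ultimately show ?thesis using False by (simp add: power2_norm_eq_inner[symmetric] power2_eq_square)
qed simp

text \<open>For a unit vector \<open>y\<close> this is the expansion of \<open>v\<close> in the basis \<open>y, A\<^sub>1 y, \<dots>\<close>; the general case is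
its rescaling.\<close>

lemma frame_expansion:
  fixes A :: "nat \<Rightarrow> real^'d^'d" and y v :: "real^'d"
  assumes A: "complete_tangent_system A"
  shows "(\<Sum>i<CARD('d). (v \<bullet> (frame A i *v y)) *\<^sub>R (frame A i *v y)) = (y \<bullet> y) *\<^sub>R v"
proof (cases "y = 0")
  case False
  let ?s = "(1 / norm y) *\<^sub>R y"
  have s: "?s \<in> sphere 0 1" using False by simp
  then have inj: "inj_on (\<lambda>i. frame A i *v ?s) {..<CARD('d)}"
    and onb: "orthonormal_basis_of UNIV ((\<lambda>i. frame A i *v ?s) ` {..<CARD('d)})"
    using A unfolding complete_tangent_system_def by blast+
  have "(\<Sum>i<CARD('d). (v \<bullet> (frame A i *v ?s)) *\<^sub>R (frame A i *v ?s)) = v"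
    using orthonormal_expansion[OF onb, of v] by (simp add: sum.reindex[OF inj] o_def)
  moreover have "frame A i *v y = norm y *\<^sub>R (frame A i *v ?s)" for i
    using False by (simp add: matrix_vector_mult_scaleR)
  then have "(\<Sum>i<CARD('d). (v \<bullet> (frame A i *v y)) *\<^sub>R (frame A i *v y))
     = (norm y)\<^sup>2 *\<^sub>R (\<Sum>i<CARD('d). (v \<bullet> (frame A i *v ?s)) *\<^sub>R (frame A i *v ?s))"
    by (simp only: inner_scaleR_right scaleR_scaleR scaleR_sum_right power2_eq_square mult_ac)
  ultimately show ?thesis by (simp add: power2_norm_eq_inner)
qed simp

text \<open>The coefficients of an element of \<open>G\<close> form a unit vector, and the vectors \<open>A\<^sub>i y\<close> are orthogonal of equal
length.\<close>

lemma G_block_norm: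
  fixes A :: "nat \<Rightarrow> real^'d^'d" and x :: "real^('n::finite \<times> 'd)"
  assumes A: "complete_tangent_system A" and h: "h \<in> G A"
  shows "norm (blk k (h *v x)) = norm (blk k x)"
proof -
  from h obtain l where l: "h = (\<Sum>i<CARD('d). l i *\<^sub>R block_diag (frame A i))" "(\<Sum>i<CARD('d). (l i)\<^sup>2) = 1"
    unfolding G_def by blast
  let ?y = "blk k x"
  have "(\<Sum>i<m. l i *\<^sub>R block_diag (frame A i)) *v x = (\<Sum>i<m. l i *\<^sub>R (block_diag (frame A i) *v x))" for m
    by (induction m) (simp_all add: matrix_vector_mult_add_rdistrib scaleR_matrix_vector_assoc)
  then have "h *v x = (\<Sum>i<CARD('d). l i *\<^sub>R (block_diag (frame A i) *v x))" by (simp only: l(1))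
  then have "blk k (h *v x) = (\<Sum>i<CARD('d). l i *\<^sub>R (frame A i *v ?y))"
    by (simp add: linear_sum[OF linear_blk] linear_cmul[OF linear_blk] blk_block_diag)
  then have "blk k (h *v x) \<bullet> blk k (h *v x) = (\<Sum>i<CARD('d). \<Sum>j<CARD('d). l i * l j * ((frame A i *v ?y) \<bullet> (frame A j *v ?y)))"
    by (simp add: inner_sum_left inner_sum_right sum_distrib_left mult.assoc mult.left_commute inner_commute)
  also have "\<dots> = (\<Sum>i<CARD('d). \<Sum>j<CARD('d). if i = j then (l i)\<^sup>2 * (?y \<bullet> ?y) else 0)"
    by (intro sum.cong) (auto simp: frame_inner[OF A] power2_eq_square)
  also have "\<dots> = (\<Sum>i<CARD('d). (l i)\<^sup>2 * (?y \<bullet> ?y))" by simp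
  also have "\<dots> = ?y \<bullet> ?y" using l(2) by (simp add: sum_distrib_right[symmetric])
  finally show ?thesis by (simp add: norm_eq_sqrt_inner)
qed

lemma norm_blk: "(norm x)\<^sup>2 = (\<Sum>k\<in>UNIV. (norm (blk k x))\<^sup>2)"
  by (simp add: power2_norm_eq_inner inner_blk[of x x])

lemma invariant_under_G:
  fixes A :: "nat \<Rightarrow> real^'d^'d" and K :: "(real^('n::finite \<times> 'd)) set"
  assumes A: "complete_tangent_system A"
    and K: "\<And>x y. block_sq (block_basis k) x = block_sq (block_basis k) y \<Longrightarrow> norm x = norm y \<Longrightarrow> x \<in> K \<longleftrightarrow> y \<in> K"
  shows "invariant_under (G A) K"
  unfolding invariant_under_def
proof (intro ballI)
  fix h :: "real^('n \<times> 'd)^('n \<times> 'd)" assume h: "h \<in> G A"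
  have nb: "norm (blk k (h *v x)) = norm (blk k x)" for k x by (rule G_block_norm[OF A h])
  have n: "norm (h *v x) = norm x" for x
  proof (rule power2_eq_imp_eq)
    show "(norm (h *v x))\<^sup>2 = (norm x)\<^sup>2" by (simp only: norm_blk nb)
  qed auto
  have iff: "h *v x \<in> K \<longleftrightarrow> x \<in> K" for x
    by (rule K) (simp_all add: block_sq_block_basis nb n)
  have lin: "linear (\<lambda>x. h *v x)" by (rule matrix_vector_mul_linear)
  have "inj (\<lambda>x. h *v x)"
    unfolding linear_injective_0[OF lin] by (metis n norm_eq_zero)
  then have surj: "surj (\<lambda>x. h *v x)"
    by (intro linear_injective_imp_surjective[OF lin]) simp_all
  show "(\<lambda>x. h *v x) ` K = K"
  proof
    show "(\<lambda>x. h *v x) ` K \<subseteq> K" using iff by blast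
    show "K \<subseteq> (\<lambda>x. h *v x) ` K"
    proof
      fix y assume y: "y \<in> K"
      obtain x where x: "y = h *v x" using surj by (auto simp: surj_def)
      then have "x \<in> K" using y iff by blast
      then show "y \<in> (\<lambda>x. h *v x) ` K" using x by blast
    qed
  qed
qed

lemma card_orthonormal_basis_of: "orthonormal_basis_of V B \<Longrightarrow> card B = dim V"
  using orthonormal_basis_ofD(4,5)[of V B] by (metis dim_span_eq_card_independent)

text \<open>Let \<open>u j\<close> be the projection to \<open>H\<^sub>\<theta>\<close> of the \<open>j\<close>-th standard vector of the block. For \<open>x\<close> in \<open>H\<^sub>\<theta>\<close>, the
block of \<open>x\<close> has the coordinates \<open>x \<bullet> u j\<close>, so all of \<open>B\<close> is carried by the span of the \<open>u j\<close>. The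
expansion in the frame at the block of \<open>\<theta>\<close> shows that the \<open>u j\<close> are orthogonal with squared length
\<open>\<tau>\<close>. Normalized, they are part of an orthonormal basis; if \<open>\<tau> = 0\<close>, then \<open>B\<close> vanishes on \<open>H\<^sub>\<theta>\<close>.\<close>

lemma adapted_basis:
  fixes A :: "nat \<Rightarrow> real^'d^'d" and \<theta> :: "real^('n::finite \<times> 'd)" and k :: 'n
  assumes A: "complete_tangent_system A" and \<theta>: "\<theta> \<in> sphere 0 1"
    and big: "2 * CARD('d) \<le> CARD('n) * CARD('d)"
  defines "\<tau> \<equiv> 1 - (norm (blk k \<theta>))\<^sup>2"
  obtains U Y where "orthonormal_basis_of (H A \<theta>) U" "card U = CARD('n) * CARD('d) - CARD('d)"
    "Y \<subseteq> U" "card Y = CARD('d)" "0 \<le> \<tau>" "\<tau> \<le> 1"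
    "\<And>c. block_sq (block_basis k) (\<Sum>b\<in>U. c b *\<^sub>R b) = \<tau> * (\<Sum>b\<in>Y. (c b)\<^sup>2)"
proof -
  let ?d = "CARD('d)"
  define w where "w i = block_diag (frame A i) *v \<theta>" for i
  have n\<theta>: "norm \<theta> = 1" using \<theta> by simp
  have blk_w: "blk l (w i) = frame A i *v blk l \<theta>" for l i by (simp add: w_def blk_block_diag)
  have ww: "w i \<bullet> w j = (if i = j then 1 else 0)" if "i < ?d" "j < ?d" for i j
  proof -
    have "w i \<bullet> w j = (\<Sum>l\<in>UNIV. if i = j then blk l \<theta> \<bullet> blk l \<theta> else 0)"
      unfolding inner_blk[of "w i"] blk_w by (intro sum.cong frame_inner[OF A that] refl)
    also have "\<dots> = (if i = j then \<theta> \<bullet> \<theta> else 0)" by (simp add: inner_blk[of \<theta> \<theta>])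
    finally show ?thesis using n\<theta> by (simp add: norm_eq_1)
  qed
  have H_iff: "x \<in> H A \<theta> \<longleftrightarrow> (\<forall>i<?d. x \<bullet> w i = 0)" for x
    by (simp add: H_def w_def orthogonal_def)
  have subH: "subspace (H A \<theta>)"
    unfolding subspace_def by (auto simp: H_iff inner_add_left)
  have wONB: "orthonormal_basis_of (span (w ` {..<?d})) (w ` {..<?d})"
    unfolding orthonormal_basis_of_def pairwise_def orthogonal_def
    by (auto simp: ww norm_eq_1 intro: span_base)
  have inj_w: "inj_on w {..<?d}"
  proof (rule inj_onI)
    fix i j assume ij: "i \<in> {..<?d}" "j \<in> {..<?d}" "w i = w j"
    then have "w i \<bullet> w j = 1" using ww[of i i] by simp
    then show "i = j" using ww[of i j] ij by (auto split: if_splits)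
  qed
  have dimH: "dim (H A \<theta>) = CARD('n) * ?d - ?d"
  proof -
    have "dim (span (w ` {..<?d})) = ?d"
      using card_orthonormal_basis_of[OF wONB] card_image[OF inj_w] by simp
    moreover have "H A \<theta> = {y \<in> UNIV. \<forall>x\<in>span (w ` {..<?d}). orthogonal x y}"
    proof -
      have "(\<forall>x\<in>span (w ` {..<?d}). orthogonal x y) \<longleftrightarrow> (\<forall>i<?d. y \<bullet> w i = 0)" for y
      proof
        assume "\<forall>x\<in>span (w ` {..<?d}). orthogonal x y"
        then show "\<forall>i<?d. y \<bullet> w i = 0" by (auto simp: orthogonal_def inner_commute intro!: span_base)
      next
        assume "\<forall>i<?d. y \<bullet> w i = 0"
        then have "\<And>x. x \<in> w ` {..<?d} \<Longrightarrow> orthogonal y x" by (auto simp: orthogonal_def)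
        then show "\<forall>x\<in>span (w ` {..<?d}). orthogonal x y"
          using orthogonal_to_span[of _ "w ` {..<?d}" y] by (auto simp: orthogonal_commute)
      qed
      then show ?thesis by (auto simp: H_iff)
    qed
    ultimately show ?thesis
      using dim_subspace_orthogonal_to_vectors[of "span (w ` {..<?d})" UNIV] by simp
  qed
  define a where "a j = (axis (k, j) 1 :: real^('n \<times> 'd))" for j
  define u where "u j = a j - (\<Sum>i<?d. (a j \<bullet> w i) *\<^sub>R w i)" for j
  let ?\<theta> = "blk k \<theta>"
  have xa: "x \<bullet> a j = blk k x $ j" for x j by (simp add: a_def blk_def inner_axis)
  have blk_a: "blk k (a j) = axis j 1" for j by (simp add: a_def blk_def vec_eq_iff axis_def)
  have uw: "u j \<bullet> w i = 0" if "i < ?d" for i j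
  proof -
    have "(\<Sum>l<?d. (a j \<bullet> w l) *\<^sub>R w l) \<bullet> w i = (\<Sum>l<?d. if l = i then a j \<bullet> w i else 0)"
      unfolding inner_sum_left using that by (intro sum.cong) (auto simp: ww)
    also have "\<dots> = a j \<bullet> w i" using that by simp
    finally show ?thesis by (simp add: u_def inner_diff_left)
  qed
  have uH: "u j \<in> H A \<theta>" for j by (simp add: H_iff uw)
  have xu: "x \<bullet> u j = blk k x $ j" if "x \<in> H A \<theta>" for x j
    using that by (simp add: u_def inner_diff_right inner_sum_right H_iff xa)
  have blk_u: "blk k (u j) = \<tau> *\<^sub>R axis j 1" for j
  proof -
    have "a j \<bullet> w i = axis j 1 \<bullet> (frame A i *v ?\<theta>)" for i
      using xa[of "w i" j] by (simp add: inner_commute[of "a j"] blk_w inner_axis')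
    then have "blk k (u j) = axis j 1 - (\<Sum>i<?d. (axis j 1 \<bullet> (frame A i *v ?\<theta>)) *\<^sub>R (frame A i *v ?\<theta>))"
      unfolding u_def linear_diff[OF linear_blk] linear_sum[OF linear_blk] linear_cmul[OF linear_blk] blk_a blk_w by simp
    also have "\<dots> = axis j 1 - (?\<theta> \<bullet> ?\<theta>) *\<^sub>R axis j 1" by (simp only: frame_expansion[OF A])
    finally show ?thesis by (simp add: \<tau>_def power2_norm_eq_inner algebra_simps)
  qed
  have uu: "u i \<bullet> u j = (if i = j then \<tau> else 0)" for i j
    using xu[OF uH, of i j] by (simp add: blk_u axis_def)
  have \<tau>0: "0 \<le> \<tau>" using uu[of undefined undefined] inner_ge_zero[of "u undefined"] by simp
  have \<tau>1: "\<tau> \<le> 1" by (simp add: \<tau>_def)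
  have sq: "block_sq (block_basis k) x = (\<Sum>j\<in>UNIV. (x \<bullet> u j)\<^sup>2)" if "x \<in> H A \<theta>" for x
  proof -
    have "block_sq (block_basis k) x = (\<Sum>j\<in>UNIV. (blk k x $ j)\<^sup>2)"
      unfolding block_sq_block_basis power2_norm_eq_inner inner_vec_def by (simp add: power2_eq_square)
    then show ?thesis by (simp only: xu[OF that])
  qed
  have sumH: "(\<Sum>b\<in>U. c b *\<^sub>R b) \<in> H A \<theta>" if "orthonormal_basis_of (H A \<theta>) U" for U c
    using that subH by (intro subspace_sum subspace_scale) (auto simp: orthonormal_basis_of_def)
  show thesis
  proof (cases "\<tau> = 0")
    case True
    obtain U where U: "U \<subseteq> H A \<theta>" "pairwise orthogonal U" "\<And>x. x \<in> U \<Longrightarrow> norm x = 1" "span U = H A \<theta>"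
      "card U = dim (H A \<theta>)"
      by (rule orthonormal_basis_subspace[OF subH]) blast
    then have onb: "orthonormal_basis_of (H A \<theta>) U" by (simp add: orthonormal_basis_of_def)
    have "?d \<le> card U" using U(5) dimH big by linarith
    then obtain Y where Y: "Y \<subseteq> U" "card Y = ?d" by (rule obtain_subset_with_card_n) blast
    have "u j = 0" for j using uu[of j j] True by simp
    then have "block_sq (block_basis k) (\<Sum>b\<in>U. c b *\<^sub>R b) = \<tau> * (\<Sum>b\<in>Y. (c b)\<^sup>2)" for c
      using sq[OF sumH[OF onb]] True by simp
    then show thesis using that[OF onb _ Y \<tau>0 \<tau>1] U(5) dimH by simp
  next
    case False
    then have \<tau>p: "\<tau> > 0" using \<tau>0 by simp
    define y where "y j = (1 / sqrt \<tau>) *\<^sub>R u j" for j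
    have yy: "y i \<bullet> y j = (if i = j then 1 else 0)" for i j
      using \<tau>p by (simp add: y_def uu)
    have yH: "y j \<in> H A \<theta>" for j using subH uH by (simp add: y_def subspace_scale)
    define Z where "Z = {x \<in> H A \<theta>. \<forall>j. x \<bullet> y j = 0}"
    have subZ: "subspace Z" using subH unfolding Z_def subspace_def by (auto simp: inner_add_left)
    obtain C where C: "C \<subseteq> Z" "pairwise orthogonal C" "\<And>x. x \<in> C \<Longrightarrow> norm x = 1" "span C = Z"
      by (rule orthonormal_basis_subspace[OF subZ]) blast
    let ?U = "range y \<union> C"
    have CZ: "c \<bullet> y j = 0" if "c \<in> C" for c j using that C(1) by (auto simp: Z_def)
    have "span ?U = H A \<theta>"
    proof
      show "span ?U \<subseteq> H A \<theta>" using yH C(1) subH by (intro span_minimal) (auto simp: Z_def)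
      show "H A \<theta> \<subseteq> span ?U"
      proof
        fix x assume x: "x \<in> H A \<theta>"
        let ?z = "x - (\<Sum>j\<in>UNIV. (x \<bullet> y j) *\<^sub>R y j)"
        have "?z \<bullet> y i = 0" for i
        proof -
          have "(\<Sum>j\<in>UNIV. (x \<bullet> y j) *\<^sub>R y j) \<bullet> y i = (\<Sum>j\<in>UNIV. if j = i then x \<bullet> y i else 0)"
            unfolding inner_sum_left by (intro sum.cong) (auto simp: yy)
          then show ?thesis by (simp add: inner_diff_left)
        qed
        moreover have "?z \<in> H A \<theta>" using x yH subH by (intro subspace_diff subspace_sum subspace_scale)
        ultimately have "?z \<in> span C" unfolding C(4) by (simp add: Z_def)
        then have "?z \<in> span ?U" by (rule rev_subsetD) (intro span_mono, auto)
        moreover have "(\<Sum>j\<in>UNIV. (x \<bullet> y j) *\<^sub>R y j) \<in> span ?U"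
          by (intro span_sum span_scale span_base) auto
        ultimately have "?z + (\<Sum>j\<in>UNIV. (x \<bullet> y j) *\<^sub>R y j) \<in> span ?U" by (rule span_add)
        then show "x \<in> span ?U" by simp
      qed
    qed
    moreover have "pairwise orthogonal ?U"
    proof (rule pairwiseI)
      fix r s assume rs: "r \<in> ?U" "s \<in> ?U" "r \<noteq> s"
      have CC: "r \<bullet> s = 0" if "r \<in> C" "s \<in> C"
        using C(2) that rs(3) by (auto simp: pairwise_def orthogonal_def)
      show "orthogonal r s"
        using rs CC CZ by (auto simp: orthogonal_def yy inner_commute)
    qed
    moreover have "\<forall>b\<in>?U. norm b = 1" using C(3) yy by (auto simp: norm_eq_1)
    moreover have "?U \<subseteq> H A \<theta>" using yH C(1) by (auto simp: Z_def)
    ultimately have onb: "orthonormal_basis_of (H A \<theta>) ?U" by (simp add: orthonormal_basis_of_def)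
    have inj_y: "inj y"
    proof (rule injI)
      fix i j assume "y i = y j"
      then have "y i \<bullet> y j = 1" using yy[of j j] by simp
      then show "i = j" using yy[of i j] by (auto split: if_splits)
    qed
    have form: "block_sq (block_basis k) (\<Sum>b\<in>?U. c b *\<^sub>R b) = \<tau> * (\<Sum>b\<in>range y. (c b)\<^sup>2)" for c
    proof -
      let ?x = "\<Sum>b\<in>?U. c b *\<^sub>R b"
      have "?x \<bullet> u j = sqrt \<tau> * c (y j)" for j
      proof -
        have "?x \<bullet> y j = c (y j)" by (rule orthonormal_sum_inner[OF onb]) simp
        then show ?thesis using \<tau>p by (simp add: y_def field_simps)
      qed
      then have "block_sq (block_basis k) ?x = (\<Sum>j\<in>UNIV. (sqrt \<tau> * c (y j))\<^sup>2)"
        using sq[OF sumH[OF onb]] by simp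
      also have "\<dots> = \<tau> * (\<Sum>j\<in>UNIV. (c (y j))\<^sup>2)"
        using \<tau>p by (simp add: power_mult_distrib sum_distrib_left)
      also have "(\<Sum>j\<in>UNIV. (c (y j))\<^sup>2) = (\<Sum>b\<in>range y. (c b)\<^sup>2)"
        by (simp add: sum.reindex[OF inj_y])
      finally show ?thesis .
    qed
    have "card ?U = CARD('n) * ?d - ?d" using card_orthonormal_basis_of[OF onb] dimH by simp
    moreover have "card (range y) = ?d" by (rule card_image[OF inj_y])
    ultimately show thesis using that[OF onb _ _ _ \<tau>0 \<tau>1 form] by simp
  qed
qed

section \<open>Existence of the counterexample\<close>

lemma measure_subspace_lborel:
  fixes V :: "'a::euclidean_space set"
  assumes "orthonormal_basis_of V B"
  obtains B' where "orthonormal_basis_of V B'"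
    "\<And>X. X \<in> sets borel \<Longrightarrow> measure (subspace_lborel V) (X \<inter> V) = measure (coord_lborel B') X"
proof -
  define B' where "B' = (SOME B. orthonormal_basis_of V B)"
  have B': "orthonormal_basis_of V B'" unfolding B'_def using assms by (rule someI)
  have eq: "subspace_lborel V = coord_lborel B'"
    by (simp add: subspace_lborel_def Let_def B'_def coord_lborel_def)
  have "V = span B'" using B' by (simp add: orthonormal_basis_of_def)
  then have V: "V \<in> sets borel" by (metis closed_span borel_closed)
  show thesis
  proof (rule that[OF B'])
    fix X :: "'a set" assume X: "X \<in> sets borel"
    have "AE x in coord_lborel B'. x \<in> X \<inter> V \<longleftrightarrow> x \<in> X"
      using coord_lborel_concentrated[OF B'] by eventually_elim auto
    then show "measure (subspace_lborel V) (X \<inter> V) = measure (coord_lborel B') X"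
      unfolding eq using X V by (intro measure_eq_AE) auto
  qed
qed

theorem theorem5p5:
  fixes A :: "nat \<Rightarrow> real^'d^'d"
  assumes "CARD('n::finite) > 1"
    and "CARD('d) \<in> {1, 2, 4, 8}"
    and "CARD('d) * CARD('n) > 2 * CARD('d) + 2"
    and "complete_tangent_system A"
  shows "\<exists>K L :: (real^('n \<times> 'd)) set.
           invariant_under (G A) K \<and> infinitely_smooth_body K \<and> convex_body K \<and>
           invariant_under (G A) L \<and> infinitely_smooth_body L \<and> convex_body L \<and>
           (\<forall>\<theta>\<in>sphere 0 1.
              measure (subspace_lborel (H A \<theta>)) (K \<inter> H A \<theta>)
                \<le> measure (subspace_lborel (H A \<theta>)) (L \<inter> H A \<theta>)) \<and>
           measure lborel K > measure lborel L"
proof -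
  note A = assms(4)
  define k :: 'n where "k = undefined"
  let ?S = "block_basis k :: (real^('n \<times> 'd)) set"
  interpret block_split ?S
  proof
    show "?S \<subseteq> Basis" by (rule block_basis_subset)
    show "?S \<noteq> {}" by (simp add: block_basis_def)
    show "2 * card ?S + 2 < DIM(real^('n \<times> 'd))"
      using assms(3) by (simp add: card_block_basis mult.commute)
  qed
  obtain K L where K: "infinitely_smooth_body K" "convex_body K" and L: "infinitely_smooth_body L" "convex_body L"
    and inv: "\<And>x y. block_sq ?S x = block_sq ?S y \<Longrightarrow> norm x = norm y \<Longrightarrow> (x \<in> K \<longleftrightarrow> y \<in> K) \<and> (x \<in> L \<longleftrightarrow> y \<in> L)"
    and sec: "\<And>\<tau> M. 0 \<le> \<tau> \<Longrightarrow> \<tau> \<le> 1 \<Longrightarrow> section_measure \<tau> M \<Longrightarrow> measure M K \<le> measure M L"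
    and vol: "measure lborel L < measure lborel K"
    using counterexample_bodies by metis
  have borel: "X \<in> sets borel" if "convex_body X" for X :: "(real^('n \<times> 'd)) set"
    using that by (simp add: convex_body_def borel_compact)
  have "measure (subspace_lborel (H A \<theta>)) (K \<inter> H A \<theta>) \<le> measure (subspace_lborel (H A \<theta>)) (L \<inter> H A \<theta>)"
    if \<theta>: "\<theta> \<in> sphere 0 1" for \<theta>
  proof -
    have big: "2 * CARD('d) \<le> CARD('n) * CARD('d)" 
      using assms(3) mult.commute[of "CARD('d)" "CARD('n)"] by linarith
    obtain U Y \<tau> where U: "orthonormal_basis_of (H A \<theta>) U" "card U = CARD('n) * CARD('d) - CARD('d)"
      and Y: "Y \<subseteq> U" "card Y = CARD('d)" and \<tau>: "0 \<le> \<tau>" "\<tau> \<le> 1"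
      and form: "\<And>c. block_sq ?S (\<Sum>b\<in>U. c b *\<^sub>R b) = \<tau> * (\<Sum>b\<in>Y. (c b)\<^sup>2)"
      by (rule adapted_basis[OF A \<theta> big, of k]) blast
    have "section_measure \<tau> (coord_lborel U)"
      by (rule section_measure_coord_lborel[OF U(1) _ Y(1) _ \<tau>(1) form])
         (simp_all add: U(2) Y(2) card_block_basis)
    moreover obtain U' where U': "orthonormal_basis_of (H A \<theta>) U'"
      and m: "\<And>X. X \<in> sets borel \<Longrightarrow> measure (subspace_lborel (H A \<theta>)) (X \<inter> H A \<theta>) = measure (coord_lborel U') X"
      by (rule measure_subspace_lborel[OF U(1)]) blast
    ultimately have "section_measure \<tau> (coord_lborel U')"
      using section_measure_basis_independent[OF U(1) U'] by blast
    from sec[OF \<tau> this] show ?thesis using m borel K(2) L(2) by simp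
  qed
  moreover have "invariant_under (G A) K" "invariant_under (G A) L"
    using inv by (auto intro!: invariant_under_G[OF A, of k])
  ultimately show ?thesis using K L vol by blast
qed

end
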